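(* Let $R$ be a Banach ring. Suppose we are given a system $$\cdots\to V_4\to V_3\to V_2\to V_1$$ in $\mathrm{Ban}_R$ such that all morphisms in the system are in $\mathrm{Ban}^{\le1}_R$. Let $\Psi$ be the poset consisting of non-decreasing functions $\psi:\mathbb{Z}_{\ge1}\to\mathbb{Z}_{\ge1}$ with the order $\psi_1\le\psi_2$ if $\psi_1(i)\le\psi_2(i)$ for all $i\in\mathbb{Z}_{\ge1}$. Then the natural morphism in $\mathrm{Ind}(\mathrm{Ban}_R)$ $$\text{``}\mathop{\mathrm{colim}}_{\psi\in\Psi}"\ker\Big[\prod_{i\in\mathbb{Z}_{\ge1}}{}^{\le1}\big((V_i)_{\psi(i)^{-1}}\big)\xrightarrow{\ \mathrm{id}-s\ }\prod_{i\in\mathbb{Z}_{\ge1}}{}^{\le1}\big((V_i)_{2^{-1}\psi(i+1)^{-1}}\big)\Big]\longrightarrow\lim_{i\in\mathbb{Z}_{\ge1}}V_i$$ is an isomorphism in $\mathrm{Ind}(\mathrm{Ban}_R)$, the limit on the right being taken in $\mathrm{Ind}(\mathrm{Ban}_R)$. Furthermore, $\lim_{i\in\mathbb{Z}_{\ge1}}V_i$ is metrizable, and so any Fréchet module is metrizable.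
   Context: A Banach ring $R$ is a commutative unital ring with a function $|\cdot|:R\to\mathbb{R}_{\ge0}$ with $|a|=0$ iff $a=0$, $|a+b|\le|a|+|b|$, $|ab|\le C|a||b|$ for some constant $C>0$, complete for $|a-b|$. A Banach $R$-module is an $R$-module $M$ with a complete norm satisfying the triangle inequality and $\|am\|\le C|a|\|m\|$ for some $C>0$. $\mathrm{Ban}_R$ is the category of Banach $R$-modules and bounded $R$-linear maps; $\mathrm{Ban}^{\le1}_R$ has the same objects and morphisms of norm $\le1$. The product in $\mathrm{Ban}^{\le1}_R$ is $\prod^{\le1}_iV_i=\{(v_i):\sup_i\|v_i\|<\infty\}$ with norm $\sup_i\|v_i\|$. For $r>0$, $V_r$ (e.g. $(V_i)_{\psi(i)^{-1}}$) denotes $V$ with its norm multiplied by $r$. $\mathrm{Ind}(\mathrm{Ban}_R)$ is the ind-completion and ``colim" the formal filtered colimit. The map $\mathrm{id}-s$ sends $(\alpha_1,\alpha_2,\dots)$ to the sequence whose $j$-th term is $\alpha_j$ minus the image of $\alpha_{j+1}$ in $V_j$. An object $V$ of $\mathrm{Ind}(\mathrm{Ban}_R)$ is metrizable if the category of pairs (an object $X$ of $\mathrm{Ban}_R$, a morphism $X\to V$), with commuting triangles as morphisms, is $\aleph_1$-filtered (every countable diagram has a cocone). A Fréchet module over $R$ is an object of $\mathrm{Ind}(\mathrm{Ban}_R)$ which is a countable limit of a diagram in $\mathrm{Ban}_R$.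
   Formalization: The isomorphism claim additionally assumes that the product of the V_i (bounded families with sup norm) is a Banach R-module, i.e. the constants C of the V_i are uniformly bounded; otherwise the displayed products are not in Ban_R. Metrizability is unconditional. *)

theory Defs
  imports Complex_Main "HOL-Library.FuncSet" "HOL-Library.Infinite_Typeclass" "HOL-Algebra.Module"
begin

section \<open>Universes\<close>

text \<open>
  A category of ``all'' Banach modules is only available relative to a universe. Here a universe is
  a type closed, up to an injective coding, under countable tuples. Carriers of Banach modules and
  the index categories of ind-objects are subsets of such a type. For every infinite type \<open>'a\<close> the
  type \<open>'a set\<close> is a universe, so modules of arbitrary cardinality occur in suitable universes.
\<close>

class universe =
  fixes utuple :: "(nat \<Rightarrow> 'a) \<Rightarrow> 'a"
    and unat :: "nat \<Rightarrow> 'a"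
  assumes inj_utuple: "inj utuple"
    and inj_unat: "inj unat"

definition uproj :: "'u::universe \<Rightarrow> nat \<Rightarrow> 'u" where
  "uproj t i = inv_into UNIV utuple t i"

lemma uproj_utuple [simp]: "uproj (utuple v) i = v i"
  by (simp add: uproj_def inj_utuple)

lemma infinite_type_times_nat: "\<exists>g :: 'a::infinite \<times> nat \<Rightarrow> 'a. inj g"
proof -
  obtain h :: "nat \<Rightarrow> 'a" where h: "inj h"
    using infinite_countable_subset[OF infinite_UNIV] by blast
  have "(card_of (UNIV \<times> UNIV :: ('a \<times> 'a) set), card_of (UNIV :: 'a set)) \<in> ordIso"
    by (rule card_of_Times_same_infinite[OF infinite_UNIV])
  then have "\<exists>p :: 'a \<times> 'a \<Rightarrow> 'a. bij_betw p (UNIV \<times> UNIV) UNIV"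
    by (simp only: card_of_ordIso)
  then obtain p :: "'a \<times> 'a \<Rightarrow> 'a" where "bij_betw p (UNIV \<times> UNIV) UNIV" ..
  then have p: "inj p"
    by (simp add: bij_betw_def)
  have "inj (\<lambda>z. p (fst z, h (snd z)))"
    by (rule injI) (auto dest!: injD[OF p] injD[OF h] simp: prod_eq_iff)
  then show ?thesis
    by (intro exI[of _ "\<lambda>z. p (fst z, h (snd z))"])
qed

instantiation set :: (infinite) universe
begin

definition utuple_set :: "(nat \<Rightarrow> 'a set) \<Rightarrow> 'a set" where
  "utuple_set f = (SOME g :: 'a \<times> nat \<Rightarrow> 'a. inj g) ` {(x, n). x \<in> f n}"

definition unat_set :: "nat \<Rightarrow> 'a set" where
  "unat_set n = {(SOME h :: nat \<Rightarrow> 'a. inj h) n}"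

instance
proof
  let ?g = "SOME g :: 'a \<times> nat \<Rightarrow> 'a. inj g"
  have g: "inj ?g"
    by (rule someI_ex[OF infinite_type_times_nat])
  show "inj (utuple :: (nat \<Rightarrow> 'a set) \<Rightarrow> 'a set)"
  proof (rule injI)
    fix f f' :: "nat \<Rightarrow> 'a set"
    assume "utuple f = utuple f'"
    then have "{(x, n). x \<in> f n} = {(x, n). x \<in> f' n}"
      by (simp add: utuple_set_def inj_image_eq_iff[OF g])
    then show "f = f'" by (auto simp: fun_eq_iff set_eq_iff)
  qed
  have "\<exists>h :: nat \<Rightarrow> 'a. inj h"
    using infinite_countable_subset[OF infinite_UNIV] by blast
  then have h: "inj (SOME h :: nat \<Rightarrow> 'a. inj h)"
    by (rule someI_ex)
  show "inj (unat :: nat \<Rightarrow> 'a set)"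
    by (rule injI) (simp only: unat_set_def singleton_inject inj_eq[OF h] singleton_insert_inj_eq)
qed

end


section \<open>Categories, diagrams, limits\<close>

text \<open>
  Morphisms do not carry their domain and codomain, so composition takes the three objects as
  arguments: for \<open>f \<in> Mor C x y\<close> and \<open>g \<in> Mor C y z\<close> the composite \<open>g \<circ> f\<close> is \<open>Cmp C x y z g f\<close>.
\<close>

record ('o, 'm) cat =
  Ob :: "'o set"
  Mor :: "'o \<Rightarrow> 'o \<Rightarrow> 'm set"
  Ident :: "'o \<Rightarrow> 'm"
  Cmp :: "'o \<Rightarrow> 'o \<Rightarrow> 'o \<Rightarrow> 'm \<Rightarrow> 'm \<Rightarrow> 'm"

definition is_category :: "('o, 'm) cat \<Rightarrow> bool" where
  "is_category C \<longleftrightarrow>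
     (\<forall>x\<in>Ob C. Ident C x \<in> Mor C x x) \<and>
     (\<forall>x\<in>Ob C. \<forall>y\<in>Ob C. \<forall>z\<in>Ob C. \<forall>f\<in>Mor C x y. \<forall>g\<in>Mor C y z. Cmp C x y z g f \<in> Mor C x z) \<and>
     (\<forall>x\<in>Ob C. \<forall>y\<in>Ob C. \<forall>f\<in>Mor C x y.
        Cmp C x x y f (Ident C x) = f \<and> Cmp C x y y (Ident C y) f = f) \<and>
     (\<forall>w\<in>Ob C. \<forall>x\<in>Ob C. \<forall>y\<in>Ob C. \<forall>z\<in>Ob C. \<forall>f\<in>Mor C w x. \<forall>g\<in>Mor C x y. \<forall>h\<in>Mor C y z.
        Cmp C w x z (Cmp C x y z h g) f = Cmp C w y z h (Cmp C w x y g f))"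

definition is_isomorphism :: "('o, 'm) cat \<Rightarrow> 'o \<Rightarrow> 'o \<Rightarrow> 'm \<Rightarrow> bool" where
  "is_isomorphism C x y f \<longleftrightarrow> f \<in> Mor C x y \<and>
     (\<exists>g\<in>Mor C y x. Cmp C x y x g f = Ident C x \<and> Cmp C y x y f g = Ident C y)"

record ('i, 'a, 'o, 'm) diagram =
  shape :: "('i, 'a) cat"
  dob :: "'i \<Rightarrow> 'o"
  dmor :: "'i \<Rightarrow> 'i \<Rightarrow> 'a \<Rightarrow> 'm"

definition is_diagram :: "('o, 'm) cat \<Rightarrow> ('i, 'a, 'o, 'm) diagram \<Rightarrow> bool" where
  "is_diagram C D \<longleftrightarrow> is_category (shape D) \<and>
     (\<forall>i\<in>Ob (shape D). dob D i \<in> Ob C) \<and>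
     (\<forall>i\<in>Ob (shape D). \<forall>j\<in>Ob (shape D). \<forall>a\<in>Mor (shape D) i j.
        dmor D i j a \<in> Mor C (dob D i) (dob D j)) \<and>
     (\<forall>i\<in>Ob (shape D). dmor D i i (Ident (shape D) i) = Ident C (dob D i)) \<and>
     (\<forall>i\<in>Ob (shape D). \<forall>j\<in>Ob (shape D). \<forall>k\<in>Ob (shape D).
      \<forall>a\<in>Mor (shape D) i j. \<forall>b\<in>Mor (shape D) j k.
        dmor D i k (Cmp (shape D) i j k b a) =
          Cmp C (dob D i) (dob D j) (dob D k) (dmor D j k b) (dmor D i j a))"

definition is_cone ::
    "('o, 'm) cat \<Rightarrow> ('i, 'a, 'o, 'm) diagram \<Rightarrow> 'o \<Rightarrow> ('i \<Rightarrow> 'm) \<Rightarrow> bool" where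
  "is_cone C D x c \<longleftrightarrow> x \<in> Ob C \<and>
     (\<forall>i\<in>Ob (shape D). c i \<in> Mor C x (dob D i)) \<and>
     (\<forall>i\<in>Ob (shape D). \<forall>j\<in>Ob (shape D). \<forall>a\<in>Mor (shape D) i j.
        Cmp C x (dob D i) (dob D j) (dmor D i j a) (c i) = c j)"

definition is_cocone ::
    "('o, 'm) cat \<Rightarrow> ('i, 'a, 'o, 'm) diagram \<Rightarrow> 'o \<Rightarrow> ('i \<Rightarrow> 'm) \<Rightarrow> bool" where
  "is_cocone C D x c \<longleftrightarrow> x \<in> Ob C \<and>
     (\<forall>i\<in>Ob (shape D). c i \<in> Mor C (dob D i) x) \<and>
     (\<forall>i\<in>Ob (shape D). \<forall>j\<in>Ob (shape D). \<forall>a\<in>Mor (shape D) i j.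
        Cmp C (dob D i) (dob D j) x (c j) (dmor D i j a) = c i)"

definition is_limit ::
    "('o, 'm) cat \<Rightarrow> ('i, 'a, 'o, 'm) diagram \<Rightarrow> 'o \<Rightarrow> ('i \<Rightarrow> 'm) \<Rightarrow> bool" where
  "is_limit C D x c \<longleftrightarrow> is_cone C D x c \<and>
     (\<forall>y d. is_cone C D y d \<longrightarrow>
        (\<exists>!h. h \<in> Mor C y x \<and> (\<forall>i\<in>Ob (shape D). Cmp C y x (dob D i) (c i) h = d i)))"

text \<open>The morphism \<open>y \<rightarrow> x\<close> into the limit \<open>(x, c)\<close> induced by the cone \<open>(y, d)\<close>.\<close>

definition limit_lift ::
    "('o, 'm) cat \<Rightarrow> ('i, 'a, 'o, 'm) diagram \<Rightarrow> 'o \<Rightarrow> ('i \<Rightarrow> 'm) \<Rightarrow> 'o \<Rightarrow> ('i \<Rightarrow> 'm) \<Rightarrow> 'm" where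
  "limit_lift C D x c y d =
     (THE h. h \<in> Mor C y x \<and> (\<forall>i\<in>Ob (shape D). Cmp C y x (dob D i) (c i) h = d i))"

text \<open>The preorder \<open>leq\<close> on \<open>A\<close> as a category; every arrow is named \<open>p\<close>.\<close>

definition poset_cat :: "'i set \<Rightarrow> ('i \<Rightarrow> 'i \<Rightarrow> bool) \<Rightarrow> 'a \<Rightarrow> ('i, 'a) cat" where
  "poset_cat A leq p = \<lparr>Ob = A, Mor = (\<lambda>x y. if leq x y then {p} else {}),
     Ident = (\<lambda>_. p), Cmp = (\<lambda>_ _ _ _ _. p)\<rparr>"

definition filtered :: "('i, 'a) cat \<Rightarrow> bool" where
  "filtered I \<longleftrightarrow> is_category I \<and> Ob I \<noteq> {} \<and>
     (\<forall>i\<in>Ob I. \<forall>j\<in>Ob I. \<exists>k\<in>Ob I. Mor I i k \<noteq> {} \<and> Mor I j k \<noteq> {}) \<and>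
     (\<forall>i\<in>Ob I. \<forall>j\<in>Ob I. \<forall>a\<in>Mor I i j. \<forall>b\<in>Mor I i j.
        \<exists>k\<in>Ob I. \<exists>c\<in>Mor I j k. Cmp I i j k c a = Cmp I i j k c b)"

text \<open>
  Up to isomorphism a countable category has its objects and its arrows (between any two fixed
  objects) in \<open>nat\<close>; conversely any category on these types is countable.
\<close>

definition aleph1_filtered :: "('o, 'm) cat \<Rightarrow> bool" where
  "aleph1_filtered C \<longleftrightarrow>
     (\<forall>D :: (nat, nat, 'o, 'm) diagram. is_diagram C D \<longrightarrow> (\<exists>x c. is_cocone C D x c))"


section \<open>The ind-completion\<close>

text \<open>
  Objects of \<open>Ind C\<close> are the diagrams in \<open>C\<close> with a small filtered shape, each standing for its
  formal colimit, and \<open>Hom(X, Y) = lim\<^sub>i colim\<^sub>j C(X\<^sub>i, Y\<^sub>j)\<close>. The filtered colimit of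
  sets \<open>colim\<^sub>j C(x, Y\<^sub>j)\<close> is the set of classes (``germs'') of pairs \<open>(j, f : x \<rightarrow> Y\<^sub>j)\<close>.
\<close>

type_synonym ('u, 'o, 'm) ind_ob = "('u, 'u, 'o, 'm) diagram"
type_synonym ('u, 'm) ind_mor = "'u \<Rightarrow> ('u \<times> 'm) set"

definition ind_pairs :: "('o, 'm) cat \<Rightarrow> ('u, 'o, 'm) ind_ob \<Rightarrow> 'o \<Rightarrow> ('u \<times> 'm) set" where
  "ind_pairs C Y x = (SIGMA j:Ob (shape Y). Mor C x (dob Y j))"

definition ind_equiv ::
    "('o, 'm) cat \<Rightarrow> ('u, 'o, 'm) ind_ob \<Rightarrow> 'o \<Rightarrow> (('u \<times> 'm) \<times> ('u \<times> 'm)) set" where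
  "ind_equiv C Y x = {((j, f), (j', f')).
     (j, f) \<in> ind_pairs C Y x \<and> (j', f') \<in> ind_pairs C Y x \<and>
     (\<exists>k\<in>Ob (shape Y). \<exists>a\<in>Mor (shape Y) j k. \<exists>b\<in>Mor (shape Y) j' k.
        Cmp C x (dob Y j) (dob Y k) (dmor Y j k a) f =
        Cmp C x (dob Y j') (dob Y k) (dmor Y j' k b) f')}"

definition colim_hom :: "('o, 'm) cat \<Rightarrow> ('u, 'o, 'm) ind_ob \<Rightarrow> 'o \<Rightarrow> ('u \<times> 'm) set set" where
  "colim_hom C Y x = ind_pairs C Y x // ind_equiv C Y x"

definition germ ::
    "('o, 'm) cat \<Rightarrow> ('u, 'o, 'm) ind_ob \<Rightarrow> 'o \<Rightarrow> 'u \<Rightarrow> 'm \<Rightarrow> ('u \<times> 'm) set" where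
  "germ C Y x j f = ind_equiv C Y x `` {(j, f)}"

text \<open>
  The condition in \<open>Mor\<close> says that the component at \<open>i'\<close> restricts along \<open>X a\<close> to the component
  at \<open>i\<close>; the union in \<open>Cmp\<close> runs over representatives of one and the same germ.
\<close>

definition Ind ::
    "('o, 'm) cat \<Rightarrow> (('u::universe, 'o, 'm) ind_ob, ('u, 'm) ind_mor) cat" where
  "Ind C = \<lparr>
     Ob = {X. is_diagram C X \<and> filtered (shape X)},
     Mor = (\<lambda>X Y. {F \<in> (\<Pi>\<^sub>E i\<in>Ob (shape X). colim_hom C Y (dob X i)).
        \<forall>i\<in>Ob (shape X). \<forall>i'\<in>Ob (shape X). \<forall>a\<in>Mor (shape X) i i'.
          \<forall>(j, f)\<in>F i'. (j, Cmp C (dob X i) (dob X i') (dob Y j) f (dmor X i i' a)) \<in> F i}),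
     Ident = (\<lambda>X. \<lambda>i\<in>Ob (shape X). germ C X (dob X i) i (Ident C (dob X i))),
     Cmp = (\<lambda>X Y Z G F. \<lambda>i\<in>Ob (shape X). \<Union>(j, f)\<in>F i. \<Union>(k, g)\<in>G j.
        germ C Z (dob X i) k (Cmp C (dob X i) (dob Y j) (dob Z k) g f))\<rparr>"

text \<open>The embedding of \<open>C\<close> into \<open>Ind C\<close> by diagrams on the one-point category.\<close>

definition ind_const :: "('o, 'm) cat \<Rightarrow> 'o \<Rightarrow> ('u::universe, 'o, 'm) ind_ob" where
  "ind_const C x = \<lparr>shape = poset_cat {unat 0} (=) (unat 0),
     dob = (\<lambda>_. x), dmor = (\<lambda>_ _ _. Ident C x)\<rparr>"

definition ind_const_mor :: "('o, 'm) cat \<Rightarrow> 'o \<Rightarrow> 'o \<Rightarrow> 'm \<Rightarrow> ('u::universe, 'm) ind_mor" where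
  "ind_const_mor C x y f = (\<lambda>i\<in>{unat 0}. germ C (ind_const C y) x (unat 0) f)"

definition ind_const_diagram ::
    "('o, 'm) cat \<Rightarrow> ('i, 'a, 'o, 'm) diagram \<Rightarrow>
     ('i, 'a, ('u::universe, 'o, 'm) ind_ob, ('u, 'm) ind_mor) diagram" where
  "ind_const_diagram C D = \<lparr>shape = shape D, dob = (\<lambda>i. ind_const C (dob D i)),
     dmor = (\<lambda>i j a. ind_const_mor C (dob D i) (dob D j) (dmor D i j a))\<rparr>"

text \<open>The category of pairs \<open>(X, \<phi> : X \<rightarrow> V)\<close> with \<open>X\<close> in \<open>C\<close>.\<close>

definition over_cat ::
    "('o, 'm) cat \<Rightarrow> ('u::universe, 'o, 'm) ind_ob \<Rightarrow> ('o \<times> ('u, 'm) ind_mor, 'm) cat" where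
  "over_cat C V = \<lparr>
     Ob = (SIGMA X:Ob C. Mor (Ind C) (ind_const C X) V),
     Mor = (\<lambda>(X, \<phi>) (Y, \<chi>). {f \<in> Mor C X Y.
        Cmp (Ind C) (ind_const C X) (ind_const C Y) V \<chi> (ind_const_mor C X Y f) = \<phi>}),
     Ident = (\<lambda>(X, _). Ident C X),
     Cmp = (\<lambda>(X, _) (Y, _) (Z, _). Cmp C X Y Z)\<rparr>"

definition metrizable :: "('o, 'm) cat \<Rightarrow> ('u::universe, 'o, 'm) ind_ob \<Rightarrow> bool" where
  "metrizable C V \<longleftrightarrow> V \<in> Ob (Ind C) \<and> aleph1_filtered (over_cat C V)"

definition frechet :: "('o, 'm) cat \<Rightarrow> ('u::universe, 'o, 'm) ind_ob \<Rightarrow> bool" where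
  "frechet C F \<longleftrightarrow> (\<exists>D :: (nat, nat, 'o, 'm) diagram. is_diagram C D \<and>
     (\<exists>\<pi>. is_limit (Ind C) (ind_const_diagram C D) F \<pi>))"


section \<open>Banach rings and Banach modules\<close>

record 'r normed_ring = "'r ring" +
  rnorm :: "'r \<Rightarrow> real"

text \<open>
  The fields \<open>mult\<close> and \<open>one\<close>, which the library's module record inherits from rings, carry no
  meaning here.
\<close>

record ('r, 'u) normed_module = "('r, 'u) module" +
  mnorm :: "'u \<Rightarrow> real"

text \<open>
  Symmetry \<open>nrm (- x) = nrm x\<close> is not required; in Banach rings and modules the norm of \<open>- x\<close> is
  bounded by a constant times the norm of \<open>x\<close>.
\<close>

definition complete_norm :: "('a, 'b) ring_scheme \<Rightarrow> ('a \<Rightarrow> real) \<Rightarrow> bool" where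
  "complete_norm G nrm \<longleftrightarrow>
     (\<forall>x\<in>carrier G. nrm x \<ge> 0) \<and>
     (\<forall>x\<in>carrier G. nrm x = 0 \<longleftrightarrow> x = \<zero>\<^bsub>G\<^esub>) \<and>
     (\<forall>x\<in>carrier G. \<forall>y\<in>carrier G. nrm (x \<oplus>\<^bsub>G\<^esub> y) \<le> nrm x + nrm y) \<and>
     (\<forall>s :: nat \<Rightarrow> 'a. (\<forall>n. s n \<in> carrier G) \<longrightarrow>
        (\<forall>e>0. \<exists>N. \<forall>m\<ge>N. \<forall>n\<ge>N. nrm (s m \<ominus>\<^bsub>G\<^esub> s n) < e) \<longrightarrow>
        (\<exists>l\<in>carrier G. (\<lambda>n. nrm (s n \<ominus>\<^bsub>G\<^esub> l)) \<longlonglongrightarrow> 0))"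

definition banach_ring :: "'r normed_ring \<Rightarrow> bool" where
  "banach_ring R \<longleftrightarrow> cring R \<and> complete_norm R (rnorm R) \<and>
     (\<exists>C>0. \<forall>a\<in>carrier R. \<forall>b\<in>carrier R. rnorm R (a \<otimes>\<^bsub>R\<^esub> b) \<le> C * rnorm R a * rnorm R b)"

definition banach_module :: "'r normed_ring \<Rightarrow> ('r, 'u) normed_module \<Rightarrow> bool" where
  "banach_module R M \<longleftrightarrow> module R M \<and> complete_norm M (mnorm M) \<and>
     (\<exists>C>0. \<forall>a\<in>carrier R. \<forall>x\<in>carrier M. mnorm M (a \<odot>\<^bsub>M\<^esub> x) \<le> C * rnorm R a * mnorm M x)"

definition linear_maps ::
    "'r normed_ring \<Rightarrow> ('r, 'u) normed_module \<Rightarrow> ('r, 'u) normed_module \<Rightarrow> ('u \<Rightarrow> 'u) set" where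
  "linear_maps R M N = {f \<in> carrier M \<rightarrow>\<^sub>E carrier N.
     (\<forall>x\<in>carrier M. \<forall>y\<in>carrier M. f (x \<oplus>\<^bsub>M\<^esub> y) = f x \<oplus>\<^bsub>N\<^esub> f y) \<and>
     (\<forall>a\<in>carrier R. \<forall>x\<in>carrier M. f (a \<odot>\<^bsub>M\<^esub> x) = a \<odot>\<^bsub>N\<^esub> f x)}"

definition Ban :: "'r normed_ring \<Rightarrow> (('r, 'u) normed_module, 'u \<Rightarrow> 'u) cat" where
  "Ban R = \<lparr>Ob = {M. banach_module R M},
     Mor = (\<lambda>M N. {f \<in> linear_maps R M N. \<exists>C. \<forall>x\<in>carrier M. mnorm N (f x) \<le> C * mnorm M x}),
     Ident = (\<lambda>M. \<lambda>x\<in>carrier M. x),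
     Cmp = (\<lambda>M _ _ g f. compose (carrier M) g f)\<rparr>"

definition Ban_le1 :: "'r normed_ring \<Rightarrow> (('r, 'u) normed_module, 'u \<Rightarrow> 'u) cat" where
  "Ban_le1 R = (Ban R)\<lparr>Mor := (\<lambda>M N.
     {f \<in> linear_maps R M N. \<forall>x\<in>carrier M. mnorm N (f x) \<le> mnorm M x})\<rparr>"

definition rescale :: "real \<Rightarrow> ('r, 'u) normed_module \<Rightarrow> ('r, 'u) normed_module" where
  "rescale r M = M\<lparr>mnorm := (\<lambda>x. r * mnorm M x)\<rparr>"

text \<open>
  The bounded families \<open>(v\<^sub>i)\<close> with the supremum norm. This is a Banach module if the
  constants in the inequalities \<open>\<parallel>a x\<parallel> \<le> C\<^sub>i \<bar>a\<bar> \<parallel>x\<parallel>\<close> of the factors can be chosen bounded in \<open>i\<close>;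
  otherwise it need not even be closed under scalar multiplication.
\<close>

definition ban_prod ::
    "nat set \<Rightarrow> (nat \<Rightarrow> ('r, 'u::universe) normed_module) \<Rightarrow> ('r, 'u) normed_module" where
  "ban_prod I V = \<lparr>
     carrier = utuple ` {v \<in> (\<Pi>\<^sub>E i\<in>I. carrier (V i)). bdd_above ((\<lambda>i. mnorm (V i) (v i)) ` I)},
     mult = undefined, one = undefined,
     zero = utuple (\<lambda>i\<in>I. \<zero>\<^bsub>V i\<^esub>),
     add = (\<lambda>s t. utuple (\<lambda>i\<in>I. uproj s i \<oplus>\<^bsub>V i\<^esub> uproj t i)),
     smult = (\<lambda>a t. utuple (\<lambda>i\<in>I. a \<odot>\<^bsub>V i\<^esub> uproj t i)),
     mnorm = (\<lambda>t. SUP i\<in>I. mnorm (V i) (uproj t i))\<rparr>"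

definition ban_ker ::
    "('r, 'u) normed_module \<Rightarrow> ('r, 'u) normed_module \<Rightarrow> ('u \<Rightarrow> 'u) \<Rightarrow> ('r, 'u) normed_module" where
  "ban_ker M N f = M\<lparr>carrier := {x \<in> carrier M. f x = \<zero>\<^bsub>N\<^esub>}\<rparr>"


section \<open>Towers and their formal colimit of kernels\<close>

text \<open>
  A tower consists of modules \<open>V i\<close> and maps \<open>f i : V (i + 1) \<rightarrow> V i\<close> for \<open>i \<ge> 1\<close>;
  \<open>tower_comp V f n k\<close> is the composite \<open>V (n + k) \<rightarrow> V n\<close>.
\<close>

fun tower_comp ::
    "(nat \<Rightarrow> ('r, 'u) normed_module) \<Rightarrow> (nat \<Rightarrow> 'u \<Rightarrow> 'u) \<Rightarrow> nat \<Rightarrow> nat \<Rightarrow> 'u \<Rightarrow> 'u" where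
  "tower_comp V f n 0 = (\<lambda>x\<in>carrier (V n). x)"
| "tower_comp V f n (Suc k) = compose (carrier (V (n + Suc k))) (tower_comp V f n k) (f (n + k))"

definition tower ::
    "(nat \<Rightarrow> ('r, 'u) normed_module) \<Rightarrow> (nat \<Rightarrow> 'u \<Rightarrow> 'u) \<Rightarrow>
     (nat, unit, ('r, 'u) normed_module, 'u \<Rightarrow> 'u) diagram" where
  "tower V f = \<lparr>shape = poset_cat {1..} (\<lambda>i j. j \<le> i) (), dob = V,
     dmor = (\<lambda>i j _. tower_comp V f j (i - j))\<rparr>"

definition Psi :: "(nat \<Rightarrow> nat) set" where
  "Psi = {\<psi> \<in> {1..} \<rightarrow>\<^sub>E {1..}. mono_on {1..} \<psi>}"

text \<open>Index sets of ind-objects are subsets of the universe, so \<open>\<psi>\<close> is replaced by a code for it.\<close>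

definition psi_code :: "(nat \<Rightarrow> nat) \<Rightarrow> 'u::universe" where
  "psi_code \<psi> = utuple (\<lambda>i. unat (\<psi> i))"

definition psi_decode :: "'u::universe \<Rightarrow> nat \<Rightarrow> nat" where
  "psi_decode = inv_into Psi psi_code"

definition ker_dom ::
    "(nat \<Rightarrow> ('r, 'u::universe) normed_module) \<Rightarrow> (nat \<Rightarrow> nat) \<Rightarrow> ('r, 'u) normed_module" where
  "ker_dom V \<psi> = ban_prod {1..} (\<lambda>i. rescale (inverse (real (\<psi> i))) (V i))"

definition ker_cod ::
    "(nat \<Rightarrow> ('r, 'u::universe) normed_module) \<Rightarrow> (nat \<Rightarrow> nat) \<Rightarrow> ('r, 'u) normed_module" where
  "ker_cod V \<psi> = ban_prod {1..} (\<lambda>i. rescale (inverse 2 * inverse (real (\<psi> (i + 1)))) (V i))"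

definition id_minus_s ::
    "(nat \<Rightarrow> ('r, 'u::universe) normed_module) \<Rightarrow> (nat \<Rightarrow> 'u \<Rightarrow> 'u) \<Rightarrow> (nat \<Rightarrow> nat) \<Rightarrow> 'u \<Rightarrow> 'u" where
  "id_minus_s V f \<psi> = (\<lambda>t\<in>carrier (ker_dom V \<psi>).
     utuple (\<lambda>j\<in>{1..}. uproj t j \<ominus>\<^bsub>V j\<^esub> f j (uproj t (j + 1))))"

definition tower_ker ::
    "(nat \<Rightarrow> ('r, 'u::universe) normed_module) \<Rightarrow> (nat \<Rightarrow> 'u \<Rightarrow> 'u) \<Rightarrow> (nat \<Rightarrow> nat) \<Rightarrow>
     ('r, 'u) normed_module" where
  "tower_ker V f \<psi> = ban_ker (ker_dom V \<psi>) (ker_cod V \<psi>) (id_minus_s V f \<psi>)"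

text \<open>The formal colimit of the kernels over \<open>Psi\<close>; the transition maps are inclusions.\<close>

definition tower_colim ::
    "(nat \<Rightarrow> ('r, 'u::universe) normed_module) \<Rightarrow> (nat \<Rightarrow> 'u \<Rightarrow> 'u) \<Rightarrow>
     ('u, ('r, 'u) normed_module, 'u \<Rightarrow> 'u) ind_ob" where
  "tower_colim V f = \<lparr>
     shape = poset_cat (psi_code ` Psi)
       (\<lambda>a b. \<forall>i\<in>{1..}. psi_decode a i \<le> psi_decode b i) (unat 0),
     dob = (\<lambda>a. tower_ker V f (psi_decode a)),
     dmor = (\<lambda>a b _. \<lambda>t\<in>carrier (tower_ker V f (psi_decode a)). t)\<rparr>"

text \<open>
  The morphism from the formal colimit to \<open>V i\<close> whose component at \<open>\<psi>\<close> is the \<open>i\<close>-th projection.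
\<close>

definition tower_proj ::
    "'r normed_ring \<Rightarrow> (nat \<Rightarrow> ('r, 'u::universe) normed_module) \<Rightarrow> (nat \<Rightarrow> 'u \<Rightarrow> 'u) \<Rightarrow>
     nat \<Rightarrow> ('u, 'u \<Rightarrow> 'u) ind_mor" where
  "tower_proj R V f i = (\<lambda>a\<in>psi_code ` Psi.
     germ (Ban R) (ind_const (Ban R) (V i)) (tower_ker V f (psi_decode a)) (unat 0)
       (\<lambda>t\<in>carrier (tower_ker V f (psi_decode a)). uproj t i))"

end

theory Submission
  imports Defs
begin

text \<open>
  \<^emph>\<open>The limit.\<close> A morphism from a constant ind-object \<open>X\<close> to a limit of Banach modules \<open>V\<^sub>i\<close> is a cone:
  a compatible family of bounded maps \<open>g\<^sub>i : X \<rightarrow> V\<^sub>i\<close>. The norms \<open>\<parallel>g\<^sub>i\<parallel>\<close> form some sequence, so there is a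
  non-decreasing weight \<open>\<psi>\<close> with \<open>\<parallel>g\<^sub>i\<parallel> \<le> L \<psi>(i)\<close>, and then \<open>x \<mapsto> (g\<^sub>i x)\<^sub>i\<close> is a bounded map from \<open>X\<close> to
  the module of those compatible families \<open>v\<close> for which \<open>\<parallel>v\<^sub>i\<parallel> / \<psi>(i)\<close> is bounded. For a tower this module is
  the kernel of \<open>id - s\<close>. The transition maps between the kernels are inclusions, so a morphism
  to their formal colimit is determined by the underlying functions of its components
  (\<open>L_germ_mem\<close>), hence by the composites with the projections. This is the universal property of
  the limit (\<open>is_limit_tower_cone\<close>), and the comparison of two limits is an isomorphism
  (\<open>limit_lift_isomorphism\<close>).

  \<^emph>\<open>Constants.\<close> The families with bounded \<open>\<parallel>v\<^sub>i\<parallel> / \<psi>(i)\<close> form a Banach module if the constants of the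
  scalar multiplications of the \<open>V\<^sub>i\<close> can be chosen independently of \<open>i\<close>. This is so if the product of
  the \<open>V\<^sub>i\<close> is a Banach module (\<open>smult_bound_of_ban_prod\<close>). In general each \<open>V\<^sub>i\<close> carries an equivalent norm
  whose constant depends on the ring only (\<open>uniform_renorming\<close>); the identity is an isomorphism
  in \<open>Ban R\<close> between the two norms, so the renormed kernels compute the limit of the original tower.

  \<^emph>\<open>Metrizability.\<close> Let \<open>F\<close> be a limit of any countable diagram \<open>D\<close> of Banach modules. The pairs
  \<open>(X, X \<rightarrow> F)\<close> are the cones over \<open>D\<close> with apex \<open>X\<close>. Given countably many of them, with components
  of norm at most \<open>B\<^sub>n\<^sub>i\<close>, a diagonal argument (\<open>dominating_weight\<close>) gives one weight \<open>\<psi>\<close> and constants \<open>L\<^sub>n\<close>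
  with \<open>B\<^sub>n\<^sub>i \<le> L\<^sub>n \<psi>(i)\<close>. All the cones then factor, compatibly with all morphisms between them, through the
  module of compatible families that are bounded with respect to \<open>\<psi>\<close> (\<open>weighted_cone\<close>).
\<close>


section \<open>Categories and limits\<close>

lemma cat_ident: "is_category C \<Longrightarrow> x \<in> Ob C \<Longrightarrow> Ident C x \<in> Mor C x x"
  by (simp add: is_category_def)

lemma cat_comp:
  "is_category C \<Longrightarrow> x \<in> Ob C \<Longrightarrow> y \<in> Ob C \<Longrightarrow> z \<in> Ob C \<Longrightarrow>
   f \<in> Mor C x y \<Longrightarrow> g \<in> Mor C y z \<Longrightarrow> Cmp C x y z g f \<in> Mor C x z"
  by (simp add: is_category_def)

lemma cat_id_right:
  "is_category C \<Longrightarrow> x \<in> Ob C \<Longrightarrow> y \<in> Ob C \<Longrightarrow> f \<in> Mor C x y \<Longrightarrow>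
   Cmp C x x y f (Ident C x) = f"
  by (simp add: is_category_def)

lemma cat_id_left:
  "is_category C \<Longrightarrow> x \<in> Ob C \<Longrightarrow> y \<in> Ob C \<Longrightarrow> f \<in> Mor C x y \<Longrightarrow>
   Cmp C x y y (Ident C y) f = f"
  by (simp add: is_category_def)

lemma cat_assoc:
  assumes "is_category C" "w \<in> Ob C" "x \<in> Ob C" "y \<in> Ob C" "z \<in> Ob C"
    "f \<in> Mor C w x" "g \<in> Mor C x y" "h \<in> Mor C y z"
  shows "Cmp C w x z (Cmp C x y z h g) f = Cmp C w y z h (Cmp C w x y g f)"
  using assms unfolding is_category_def by blast

lemma is_limit_lift:
  assumes "is_limit C D x c" "is_cone C D y d"
  shows "limit_lift C D x c y d \<in> Mor C y x"
    and "\<And>i. i \<in> Ob (shape D) \<Longrightarrow> Cmp C y x (dob D i) (c i) (limit_lift C D x c y d) = d i"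
proof -
  have "\<exists>!h. h \<in> Mor C y x \<and> (\<forall>i\<in>Ob (shape D). Cmp C y x (dob D i) (c i) h = d i)"
    using assms unfolding is_limit_def by blast
  from theI'[OF this, folded limit_lift_def]
  show "limit_lift C D x c y d \<in> Mor C y x"
    and "\<And>i. i \<in> Ob (shape D) \<Longrightarrow> Cmp C y x (dob D i) (c i) (limit_lift C D x c y d) = d i"
    by auto
qed

lemma is_cone_restrict:
  assumes "is_category C" "is_cone C D x c" "\<forall>i\<in>Ob (shape D). dob D i \<in> Ob C"
    "\<forall>i\<in>Ob (shape D). \<forall>j\<in>Ob (shape D). \<forall>a\<in>Mor (shape D) i j.
       dmor D i j a \<in> Mor C (dob D i) (dob D j)"
    "y \<in> Ob C" "h \<in> Mor C y x"
  shows "is_cone C D y (\<lambda>i. Cmp C y x (dob D i) (c i) h)"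
  unfolding is_cone_def
proof (intro conjI ballI)
  have x: "x \<in> Ob C" and c: "\<And>i. i \<in> Ob (shape D) \<Longrightarrow> c i \<in> Mor C x (dob D i)"
    using assms(2) by (auto simp: is_cone_def)
  show "y \<in> Ob C" by fact
  fix i assume i: "i \<in> Ob (shape D)"
  show "Cmp C y x (dob D i) (c i) h \<in> Mor C y (dob D i)"
    using assms x c i by (blast intro: cat_comp)
  fix j a assume j: "j \<in> Ob (shape D)" and a: "a \<in> Mor (shape D) i j"
  have "Cmp C x (dob D i) (dob D j) (dmor D i j a) (c i) = c j"
    using assms(2) i j a unfolding is_cone_def by blast
  moreover have "Cmp C y (dob D i) (dob D j) (dmor D i j a) (Cmp C y x (dob D i) (c i) h) =
      Cmp C y x (dob D j) (Cmp C x (dob D i) (dob D j) (dmor D i j a) (c i)) h"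
    using assms x c i j a by (intro cat_assoc[symmetric]) auto
  ultimately show "Cmp C y (dob D i) (dob D j) (dmor D i j a) (Cmp C y x (dob D i) (c i) h) =
      Cmp C y x (dob D j) (c j) h" by simp
qed

lemma is_limit_mor_eqI:
  assumes "is_category C" "is_limit C D x c" "\<forall>i\<in>Ob (shape D). dob D i \<in> Ob C"
    "\<forall>i\<in>Ob (shape D). \<forall>j\<in>Ob (shape D). \<forall>a\<in>Mor (shape D) i j.
       dmor D i j a \<in> Mor C (dob D i) (dob D j)"
    "y \<in> Ob C" "h \<in> Mor C y x" "h' \<in> Mor C y x"
    and eq: "\<And>i. i \<in> Ob (shape D) \<Longrightarrow>
      Cmp C y x (dob D i) (c i) h = Cmp C y x (dob D i) (c i) h'"
  shows "h = h'"
proof -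
  have "is_cone C D y (\<lambda>i. Cmp C y x (dob D i) (c i) h')"
    using assms(2) by (intro is_cone_restrict[OF assms(1) _ assms(3-5,7)]) (simp add: is_limit_def)
  then have "\<exists>!k. k \<in> Mor C y x \<and>
      (\<forall>i\<in>Ob (shape D). Cmp C y x (dob D i) (c i) k = Cmp C y x (dob D i) (c i) h')"
    using assms(2) unfolding is_limit_def by blast
  then show ?thesis using assms(6,7) eq by blast
qed

lemma limit_lift_isomorphism:
  assumes C: "is_category C" and D: "\<forall>i\<in>Ob (shape D). dob D i \<in> Ob C"
    "\<forall>i\<in>Ob (shape D). \<forall>j\<in>Ob (shape D). \<forall>a\<in>Mor (shape D) i j.
       dmor D i j a \<in> Mor C (dob D i) (dob D j)"
    and x: "is_limit C D x c" and y: "is_limit C D y d"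
  shows "is_isomorphism C y x (limit_lift C D x c y d)"
proof -
  have cx: "is_cone C D x c" and cy: "is_cone C D y d"
    using x y by (auto simp: is_limit_def)
  then have xO: "x \<in> Ob C" and yO: "y \<in> Ob C"
    and c: "\<And>i. i \<in> Ob (shape D) \<Longrightarrow> c i \<in> Mor C x (dob D i)"
    and d: "\<And>i. i \<in> Ob (shape D) \<Longrightarrow> d i \<in> Mor C y (dob D i)"
    by (auto simp: is_cone_def)
  define h k where "h = limit_lift C D x c y d" and "k = limit_lift C D y d x c"
  have h: "h \<in> Mor C y x" "\<And>i. i \<in> Ob (shape D) \<Longrightarrow> Cmp C y x (dob D i) (c i) h = d i"
    unfolding h_def using is_limit_lift[OF x cy] by auto
  have k: "k \<in> Mor C x y" "\<And>i. i \<in> Ob (shape D) \<Longrightarrow> Cmp C x y (dob D i) (d i) k = c i"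
    unfolding k_def using is_limit_lift[OF y cx] by auto
  have "Cmp C y x y k h = Ident C y"
  proof (rule is_limit_mor_eqI[OF C y D yO])
    show "Cmp C y x y k h \<in> Mor C y y" "Ident C y \<in> Mor C y y"
      using C xO yO h k by (auto intro: cat_comp cat_ident)
    fix i assume i: "i \<in> Ob (shape D)"
    show "Cmp C y y (dob D i) (d i) (Cmp C y x y k h) = Cmp C y y (dob D i) (d i) (Ident C y)"
      using cat_assoc[OF C yO xO yO _ h(1) k(1) d[OF i]] D(1) i h(2) k(2) d
        cat_id_right[OF C yO _ d[OF i]] by auto
  qed
  moreover have "Cmp C x y x h k = Ident C x"
  proof (rule is_limit_mor_eqI[OF C x D xO])
    show "Cmp C x y x h k \<in> Mor C x x" "Ident C x \<in> Mor C x x"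
      using C xO yO h k by (auto intro: cat_comp cat_ident)
    fix i assume i: "i \<in> Ob (shape D)"
    show "Cmp C x x (dob D i) (c i) (Cmp C x y x h k) = Cmp C x x (dob D i) (c i) (Ident C x)"
      using cat_assoc[OF C xO yO xO _ k(1) h(1) c[OF i]] D(1) i h(2) k(2) c
        cat_id_right[OF C xO _ c[OF i]] by auto
  qed
  ultimately show ?thesis
    using h k unfolding is_isomorphism_def h_def by blast
qed

lemma is_cone_cong:
  assumes "\<And>i. i \<in> Ob (shape D) \<Longrightarrow> c i = c' i"
  shows "is_cone C D x c \<longleftrightarrow> is_cone C D x c'"
  using assms by (auto simp: is_cone_def)

lemma is_limit_cong:
  assumes "\<And>i. i \<in> Ob (shape D) \<Longrightarrow> c i = c' i"
  shows "is_limit C D x c \<longleftrightarrow> is_limit C D x c'"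
  using assms is_cone_cong[of D c c' C x] by (simp add: is_limit_def cong: conj_cong)

lemma is_category_poset_cat:
  assumes "\<And>x. x \<in> A \<Longrightarrow> leq x x"
    "\<And>x y z. x \<in> A \<Longrightarrow> y \<in> A \<Longrightarrow> z \<in> A \<Longrightarrow> leq x y \<Longrightarrow> leq y z \<Longrightarrow> leq x z"
  shows "is_category (poset_cat A leq p)"
proof -
  have "Cmp (poset_cat A leq p) x y z g f \<in> Mor (poset_cat A leq p) x z"
    if "x \<in> A" "y \<in> A" "z \<in> A" "f \<in> Mor (poset_cat A leq p) x y"
      "g \<in> Mor (poset_cat A leq p) y z" for x y z f g
    using that assms(2)[of x y z] by (simp add: poset_cat_def split: if_splits)
  then show ?thesis
    unfolding is_category_def by (auto simp: poset_cat_def assms(1) split: if_splits)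
qed

lemma filtered_poset_cat:
  assumes "is_category (poset_cat A leq p)" "A \<noteq> {}"
    "\<And>x y. x \<in> A \<Longrightarrow> y \<in> A \<Longrightarrow> \<exists>z\<in>A. leq x z \<and> leq y z"
    "\<And>x. x \<in> A \<Longrightarrow> leq x x"
  shows "filtered (poset_cat A leq p)"
  unfolding filtered_def
proof (intro conjI ballI assms(1))
  show "Ob (poset_cat A leq p) \<noteq> {}" using assms(2) by (simp add: poset_cat_def)
  fix i j assume ij: "i \<in> Ob (poset_cat A leq p)" "j \<in> Ob (poset_cat A leq p)"
  then obtain k where "k \<in> A" "leq i k" "leq j k" using assms(3) by (auto simp: poset_cat_def)
  then show "\<exists>k\<in>Ob (poset_cat A leq p). Mor (poset_cat A leq p) i k \<noteq> {} \<and>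
      Mor (poset_cat A leq p) j k \<noteq> {}" by (auto simp: poset_cat_def)
  show "\<exists>k\<in>Ob (poset_cat A leq p). \<exists>c\<in>Mor (poset_cat A leq p) j k.
      Cmp (poset_cat A leq p) i j k c a = Cmp (poset_cat A leq p) i j k c b" for a b
    using ij assms(4) by (intro bexI[of _ j]) (auto simp: poset_cat_def)
qed


section \<open>The ind-completion is a category\<close>

lemma Ind_simps:
  "Ob (Ind C) = {X. is_diagram C X \<and> filtered (shape X)}"
  "Ident (Ind C) X = (\<lambda>i\<in>Ob (shape X). germ C X (dob X i) i (Ident C (dob X i)))"
  "Cmp (Ind C) X Y Z G F = (\<lambda>i\<in>Ob (shape X). \<Union>(j, f)\<in>F i. \<Union>(k, g)\<in>G j.
        germ C Z (dob X i) k (Cmp C (dob X i) (dob Y j) (dob Z k) g f))"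
  by (simp_all add: Ind_def)

lemma Ind_Mor_iff:
  "F \<in> Mor (Ind C) X Y \<longleftrightarrow> F \<in> (\<Pi>\<^sub>E i\<in>Ob (shape X). colim_hom C Y (dob X i)) \<and>
     (\<forall>i\<in>Ob (shape X). \<forall>i'\<in>Ob (shape X). \<forall>a\<in>Mor (shape X) i i'. \<forall>j f.
        (j, f) \<in> F i' \<longrightarrow> (j, Cmp C (dob X i) (dob X i') (dob Y j) f (dmor X i i' a)) \<in> F i)"
  by (simp add: Ind_def Ball_def split_paired_All)

lemma ind_pairs_iff [simp]:
  "(j, f) \<in> ind_pairs C Y x \<longleftrightarrow> j \<in> Ob (shape Y) \<and> f \<in> Mor C x (dob Y j)"
  by (simp add: ind_pairs_def)

lemma diagram_simps:
  assumes "is_diagram C X"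
  shows "is_category (shape X)"
    "i \<in> Ob (shape X) \<Longrightarrow> dob X i \<in> Ob C"
    "i \<in> Ob (shape X) \<Longrightarrow> j \<in> Ob (shape X) \<Longrightarrow> a \<in> Mor (shape X) i j \<Longrightarrow>
       dmor X i j a \<in> Mor C (dob X i) (dob X j)"
    "i \<in> Ob (shape X) \<Longrightarrow> dmor X i i (Ident (shape X) i) = Ident C (dob X i)"
    "i \<in> Ob (shape X) \<Longrightarrow> j \<in> Ob (shape X) \<Longrightarrow> k \<in> Ob (shape X) \<Longrightarrow>
     a \<in> Mor (shape X) i j \<Longrightarrow> b \<in> Mor (shape X) j k \<Longrightarrow>
        dmor X i k (Cmp (shape X) i j k b a) =
          Cmp C (dob X i) (dob X j) (dob X k) (dmor X j k b) (dmor X i j a)"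
  using assms unfolding is_diagram_def by blast+

locale ind_setting =
  fixes C :: "('o, 'm) cat"
  assumes cat: "is_category C"
begin

lemma ind_equivI:
  assumes "j \<in> Ob (shape Y)" "f \<in> Mor C x (dob Y j)" "j' \<in> Ob (shape Y)"
    "f' \<in> Mor C x (dob Y j')" "k \<in> Ob (shape Y)" "a \<in> Mor (shape Y) j k" "b \<in> Mor (shape Y) j' k"
    "Cmp C x (dob Y j) (dob Y k) (dmor Y j k a) f = Cmp C x (dob Y j') (dob Y k) (dmor Y j' k b) f'"
  shows "((j, f), (j', f')) \<in> ind_equiv C Y x"
  using assms unfolding ind_equiv_def by auto

lemma ind_equivE:
  assumes "((j, f), (j', f')) \<in> ind_equiv C Y x"
  obtains k a b where "j \<in> Ob (shape Y)" "f \<in> Mor C x (dob Y j)" "j' \<in> Ob (shape Y)"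
    "f' \<in> Mor C x (dob Y j')" "k \<in> Ob (shape Y)" "a \<in> Mor (shape Y) j k" "b \<in> Mor (shape Y) j' k"
    "Cmp C x (dob Y j) (dob Y k) (dmor Y j k a) f = Cmp C x (dob Y j') (dob Y k) (dmor Y j' k b) f'"
  using assms unfolding ind_equiv_def by auto

lemma ind_equiv_transition:
  assumes Y: "Y \<in> Ob (Ind C)" and x: "x \<in> Ob C" and j: "j \<in> Ob (shape Y)" "k \<in> Ob (shape Y)"
    and a: "a \<in> Mor (shape Y) j k" and f: "f \<in> Mor C x (dob Y j)"
  shows "((j, f), (k, Cmp C x (dob Y j) (dob Y k) (dmor Y j k a) f)) \<in> ind_equiv C Y x"
proof -
  have D: "is_diagram C Y" using Y by (simp add: Ind_simps)
  note d = diagram_simps[OF D]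
  have m: "Cmp C x (dob Y j) (dob Y k) (dmor Y j k a) f \<in> Mor C x (dob Y k)"
    using cat x f d j a by (auto intro: cat_comp)
  show ?thesis
    using j f m a d cat_ident[OF d(1) j(2)] cat_id_left[OF cat x _ m]
    by (intro ind_equivI[of j Y f x k _ k a "Ident (shape Y) k"]) auto
qed

text \<open>Transitivity is the point where the shape of \<open>Y\<close> has to be filtered.\<close>

lemma equiv_ind_equiv:
  assumes Y: "Y \<in> Ob (Ind C)" and x: "x \<in> Ob C"
  shows "equiv (ind_pairs C Y x) (ind_equiv C Y x)"
proof (rule equivI)
  have D: "is_diagram C Y" and fl: "filtered (shape Y)" using Y by (auto simp: Ind_simps)
  note d = diagram_simps[OF D]
  show "ind_equiv C Y x \<subseteq> ind_pairs C Y x \<times> ind_pairs C Y x"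
    unfolding ind_equiv_def by auto
  show "refl_on (ind_pairs C Y x) (ind_equiv C Y x)"
  proof (rule refl_onI)
    fix p assume "p \<in> ind_pairs C Y x"
    then obtain j f where p: "p = (j, f)" "j \<in> Ob (shape Y)" "f \<in> Mor C x (dob Y j)"
      by (auto simp: ind_pairs_def)
    show "(p, p) \<in> ind_equiv C Y x"
      unfolding p(1) using p cat_ident[OF d(1) p(2)] by (intro ind_equivI) auto
  qed
  show "sym (ind_equiv C Y x)"
    by (rule symI) (auto simp: ind_equiv_def; metis)
  show "trans (ind_equiv C Y x)"
  proof (rule transI, clarify)
    fix j f j' f' j'' f''
    assume "((j, f), (j', f')) \<in> ind_equiv C Y x" "((j', f'), (j'', f'')) \<in> ind_equiv C Y x"
    then obtain k a b k' a' b'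
      where 1: "j \<in> Ob (shape Y)" "f \<in> Mor C x (dob Y j)" "j' \<in> Ob (shape Y)"
        "f' \<in> Mor C x (dob Y j')" "k \<in> Ob (shape Y)" "a \<in> Mor (shape Y) j k" "b \<in> Mor (shape Y) j' k"
        "Cmp C x (dob Y j) (dob Y k) (dmor Y j k a) f = Cmp C x (dob Y j') (dob Y k) (dmor Y j' k b) f'"
      and 2: "j'' \<in> Ob (shape Y)" "f'' \<in> Mor C x (dob Y j'')" "k' \<in> Ob (shape Y)"
        "a' \<in> Mor (shape Y) j' k'" "b' \<in> Mor (shape Y) j'' k'"
        "Cmp C x (dob Y j') (dob Y k') (dmor Y j' k' a') f' =
         Cmp C x (dob Y j'') (dob Y k') (dmor Y j'' k' b') f''"
      by (elim ind_equivE) blast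
    \<comment> \<open>Bound the two witnesses by \<open>l\<close>, then coequalise the two resulting arrows from \<open>j'\<close> by \<open>e\<close>.\<close>
    obtain l c c' where l: "l \<in> Ob (shape Y)" "c \<in> Mor (shape Y) k l" "c' \<in> Mor (shape Y) k' l"
      using fl 1(5) 2(3) unfolding filtered_def by blast
    let ?S = "shape Y"
    have cb: "Cmp ?S j' k l c b \<in> Mor ?S j' l" and ca: "Cmp ?S j' k' l c' a' \<in> Mor ?S j' l"
      using d(1) 1 2 l by (auto intro: cat_comp)
    then obtain m e where m: "m \<in> Ob ?S" "e \<in> Mor ?S l m"
      "Cmp ?S j' l m e (Cmp ?S j' k l c b) = Cmp ?S j' l m e (Cmp ?S j' k' l c' a')"
      using fl 1(3) l(1) unfolding filtered_def by blast
    have ec: "Cmp ?S k l m e c \<in> Mor ?S k m" and ec': "Cmp ?S k' l m e c' \<in> Mor ?S k' m"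
      using d(1) 1 2 l m by (auto intro: cat_comp)
    have key: "Cmp ?S j' k m (Cmp ?S k l m e c) b = Cmp ?S j' k' m (Cmp ?S k' l m e c') a'"
      using m(3) cat_assoc[OF d(1) 1(3) 1(5) l(1) m(1) 1(7) l(2) m(2)]
        cat_assoc[OF d(1) 1(3) 2(3) l(1) m(1) 2(4) l(3) m(2)] by simp
    \<comment> \<open>The transition map along a composite arrow of the shape acts in two steps.\<close>
    have comp: "Cmp C x (dob Y p) (dob Y m) (dmor Y p m (Cmp ?S p q m v u)) g =
        Cmp C x (dob Y q) (dob Y m) (dmor Y q m v) (Cmp C x (dob Y p) (dob Y q) (dmor Y p q u) g)"
      if "p \<in> Ob ?S" "q \<in> Ob ?S" "u \<in> Mor ?S p q" "v \<in> Mor ?S q m" "g \<in> Mor C x (dob Y p)"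
      for p q u v g
      using that m(1) d(5)[of p q m u v] cat_assoc[OF cat x, of "dob Y p" "dob Y q" "dob Y m" g] d
      by auto
    have "Cmp C x (dob Y j) (dob Y m) (dmor Y j m (Cmp ?S j k m (Cmp ?S k l m e c) a)) f =
       Cmp C x (dob Y j') (dob Y m) (dmor Y j' m (Cmp ?S j' k m (Cmp ?S k l m e c) b)) f'"
      using 1 ec by (simp add: comp)
    also have "\<dots> = Cmp C x (dob Y j') (dob Y m) (dmor Y j' m (Cmp ?S j' k' m (Cmp ?S k' l m e c') a')) f'"
      by (simp add: key)
    also have "\<dots> = Cmp C x (dob Y j'') (dob Y m) (dmor Y j'' m (Cmp ?S j'' k' m (Cmp ?S k' l m e c') b')) f''"
      using 1 2 ec' by (simp add: comp)
    finally show "((j, f), (j'', f'')) \<in> ind_equiv C Y x"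
      using 1 2 m(1) ec ec' d(1)
      by (intro ind_equivI[where k = m]) (auto intro: cat_comp)
  qed
qed

lemma germ_mem_iff: "(j', f') \<in> germ C Y x j f \<longleftrightarrow> ((j, f), (j', f')) \<in> ind_equiv C Y x"
  by (simp add: germ_def)

lemma germ_eqI:
  assumes "Y \<in> Ob (Ind C)" "x \<in> Ob C" "((j, f), (j', f')) \<in> ind_equiv C Y x"
  shows "germ C Y x j f = germ C Y x j' f'"
  using equiv_class_eq[OF equiv_ind_equiv[OF assms(1,2)] assms(3)] by (simp add: germ_def)

lemma germ_self:
  assumes "Y \<in> Ob (Ind C)" "x \<in> Ob C" "j \<in> Ob (shape Y)" "f \<in> Mor C x (dob Y j)"
  shows "(j, f) \<in> germ C Y x j f"
  unfolding germ_def using equiv_class_self[OF equiv_ind_equiv[OF assms(1,2)], of "(j, f)"] assms(3,4)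
  by simp

lemma germ_colim_hom:
  assumes "j \<in> Ob (shape Y)" "f \<in> Mor C x (dob Y j)"
  shows "germ C Y x j f \<in> colim_hom C Y x"
  unfolding germ_def colim_hom_def using assms by (intro quotientI) simp

lemma germ_transition:
  assumes Y: "Y \<in> Ob (Ind C)" and x: "x \<in> Ob C" and j: "j \<in> Ob (shape Y)" "k \<in> Ob (shape Y)"
    and a: "a \<in> Mor (shape Y) j k" and f: "f \<in> Mor C x (dob Y j)"
  shows "germ C Y x k (Cmp C x (dob Y j) (dob Y k) (dmor Y j k a) f) = germ C Y x j f"
  using germ_eqI[OF Y x ind_equiv_transition[OF assms]] by simp

lemma colim_hom_mem:
  assumes "Y \<in> Ob (Ind C)" "x \<in> Ob C" "E \<in> colim_hom C Y x" "(j, f) \<in> E"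
  shows "j \<in> Ob (shape Y)" "f \<in> Mor C x (dob Y j)" "E = germ C Y x j f"
proof -
  note e = equiv_ind_equiv[OF assms(1,2)]
  have "(j, f) \<in> ind_pairs C Y x"
    using assms(3,4) Union_quotient[OF e] unfolding colim_hom_def by blast
  then show "j \<in> Ob (shape Y)" "f \<in> Mor C x (dob Y j)" by auto
  obtain p where p: "E = ind_equiv C Y x `` {p}"
    using assms(3) unfolding colim_hom_def by (rule quotientE)
  show "E = germ C Y x j f"
    using equiv_class_eq[OF e, of p "(j, f)"] assms(4) unfolding p germ_def by simp
qed

lemma colim_hom_ex:
  assumes "Y \<in> Ob (Ind C)" "x \<in> Ob C" "E \<in> colim_hom C Y x"
  obtains j f where "(j, f) \<in> E"
  using in_quotient_imp_non_empty[OF equiv_ind_equiv[OF assms(1,2)]] assms(3)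
  unfolding colim_hom_def by fastforce

lemma ind_equiv_precomp:
  assumes Y: "Y \<in> Ob (Ind C)" and x: "x \<in> Ob C" "y \<in> Ob C" and h: "h \<in> Mor C x y"
    and e: "((j, f), (j', f')) \<in> ind_equiv C Y y"
  shows "((j, Cmp C x y (dob Y j) f h), (j', Cmp C x y (dob Y j') f' h)) \<in> ind_equiv C Y x"
  using e
proof (rule ind_equivE)
  fix k a b
  assume 1: "j \<in> Ob (shape Y)" "f \<in> Mor C y (dob Y j)" "j' \<in> Ob (shape Y)"
    "f' \<in> Mor C y (dob Y j')" "k \<in> Ob (shape Y)" "a \<in> Mor (shape Y) j k" "b \<in> Mor (shape Y) j' k"
    "Cmp C y (dob Y j) (dob Y k) (dmor Y j k a) f = Cmp C y (dob Y j') (dob Y k) (dmor Y j' k b) f'"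
  have D: "is_diagram C Y" using Y by (simp add: Ind_simps)
  note d = diagram_simps[OF D]
  show ?thesis
    using cat_assoc[OF cat x _ _ h, of "dob Y j" "dob Y k" f "dmor Y j k a"]
      cat_assoc[OF cat x _ _ h, of "dob Y j'" "dob Y k" f' "dmor Y j' k b"] 1 d h x cat
    by (intro ind_equivI[where k = k and a = a and b = b]) (auto intro: cat_comp)
qed

lemma Ind_MorD:
  assumes X: "X \<in> Ob (Ind C)" and Y: "Y \<in> Ob (Ind C)" and F: "F \<in> Mor (Ind C) X Y"
    and i: "i \<in> Ob (shape X)"
  shows "dob X i \<in> Ob C" "\<exists>j f. (j, f) \<in> F i"
    "(j, f) \<in> F i \<Longrightarrow> j \<in> Ob (shape Y)"
    "(j, f) \<in> F i \<Longrightarrow> dob Y j \<in> Ob C"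
    "(j, f) \<in> F i \<Longrightarrow> f \<in> Mor C (dob X i) (dob Y j)"
    "(j, f) \<in> F i \<Longrightarrow> F i = germ C Y (dob X i) j f"
    "i' \<in> Ob (shape X) \<Longrightarrow> a \<in> Mor (shape X) i i' \<Longrightarrow> (j, f) \<in> F i' \<Longrightarrow>
      (j, Cmp C (dob X i) (dob X i') (dob Y j) f (dmor X i i' a)) \<in> F i"
proof -
  have D: "is_diagram C X" "is_diagram C Y" using X Y by (auto simp: Ind_simps)
  show x: "dob X i \<in> Ob C" using diagram_simps(2)[OF D(1) i] .
  have E: "F i \<in> colim_hom C Y (dob X i)" using F i by (auto simp: Ind_Mor_iff)
  show "\<exists>j f. (j, f) \<in> F i" using colim_hom_ex[OF Y x E] by metis
  show "(j, f) \<in> F i \<Longrightarrow> j \<in> Ob (shape Y)"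
    "(j, f) \<in> F i \<Longrightarrow> f \<in> Mor C (dob X i) (dob Y j)"
    "(j, f) \<in> F i \<Longrightarrow> F i = germ C Y (dob X i) j f"
    using colim_hom_mem[OF Y x E] by blast+
  then show "(j, f) \<in> F i \<Longrightarrow> dob Y j \<in> Ob C" using diagram_simps(2)[OF D(2)] by blast
  show "i' \<in> Ob (shape X) \<Longrightarrow> a \<in> Mor (shape X) i i' \<Longrightarrow> (j, f) \<in> F i' \<Longrightarrow>
      (j, Cmp C (dob X i) (dob X i') (dob Y j) f (dmor X i i' a)) \<in> F i"
    using F i by (auto simp: Ind_Mor_iff)
qed

lemma Ind_Mor_eqI:
  assumes "X \<in> Ob (Ind C)" "Y \<in> Ob (Ind C)" "F \<in> Mor (Ind C) X Y" "G \<in> Mor (Ind C) X Y"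
    and "\<And>i. i \<in> Ob (shape X) \<Longrightarrow> \<exists>p. p \<in> F i \<and> p \<in> G i"
  shows "F = G"
proof (rule PiE_ext)
  show "F \<in> (\<Pi>\<^sub>E i\<in>Ob (shape X). colim_hom C Y (dob X i))"
    "G \<in> (\<Pi>\<^sub>E i\<in>Ob (shape X). colim_hom C Y (dob X i))"
    using assms(3,4) by (simp_all add: Ind_Mor_iff)
  fix i assume i: "i \<in> Ob (shape X)"
  then obtain j f where "(j, f) \<in> F i" "(j, f) \<in> G i" using assms(5) by fastforce
  then show "F i = G i"
    using Ind_MorD(6)[OF assms(1-3) i] Ind_MorD(6)[OF assms(1,2,4) i] by blast
qed

text \<open>Any choice of representatives computes a composite.\<close>

lemma Ind_Cmp_germ:
  assumes X: "X \<in> Ob (Ind C)" and Y: "Y \<in> Ob (Ind C)" and Z: "Z \<in> Ob (Ind C)"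
    and F: "F \<in> Mor (Ind C) X Y" and G: "G \<in> Mor (Ind C) Y Z" and i: "i \<in> Ob (shape X)"
    and f: "(j, f) \<in> F i" and g: "(k, g) \<in> G j"
  shows "Cmp (Ind C) X Y Z G F i = germ C Z (dob X i) k (Cmp C (dob X i) (dob Y j) (dob Z k) g f)"
    (is "_ = ?E")
proof -
  have D: "is_diagram C X" "is_diagram C Y" "is_diagram C Z" using X Y Z by (auto simp: Ind_simps)
  have x: "dob X i \<in> Ob C" using diagram_simps(2)[OF D(1) i] .
  note F' = Ind_MorD[OF X Y F i] and G' = Ind_MorD[OF Y Z G]
  have eq: "germ C Z (dob X i) k' (Cmp C (dob X i) (dob Y j') (dob Z k') g' f') = ?E"
    if f': "(j', f') \<in> F i" and g': "(k', g') \<in> G j'" for j' f' k' g'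
  proof -
    have "((j, f), (j', f')) \<in> ind_equiv C Y (dob X i)"
      using F'(6)[OF f] f' by (simp add: germ_mem_iff)
    then obtain l a b where 1: "j \<in> Ob (shape Y)" "f \<in> Mor C (dob X i) (dob Y j)"
      "j' \<in> Ob (shape Y)" "f' \<in> Mor C (dob X i) (dob Y j')" "l \<in> Ob (shape Y)"
      "a \<in> Mor (shape Y) j l" "b \<in> Mor (shape Y) j' l"
      "Cmp C (dob X i) (dob Y j) (dob Y l) (dmor Y j l a) f =
       Cmp C (dob X i) (dob Y j') (dob Y l) (dmor Y j' l b) f'"
      by (rule ind_equivE)
    \<comment> \<open>Restricting one representative at \<open>l\<close> along both \<open>a\<close> and \<open>b\<close> compares the two composites.\<close>
    obtain m h where h: "(m, h) \<in> G l" using G'(2)[OF 1(5)] by blast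
    note hh = G'(3,4,5)[OF 1(5) h]
    have "((k, g), (m, Cmp C (dob Y j) (dob Y l) (dob Z m) h (dmor Y j l a))) \<in> ind_equiv C Z (dob Y j)"
      using G'(6)[OF 1(1) g] G'(7)[OF 1(1,5,6) h] by (simp add: germ_mem_iff)
    from ind_equiv_precomp[OF Z x G'(1)[OF 1(1)] 1(2) this]
    have "?E = germ C Z (dob X i) m (Cmp C (dob X i) (dob Y j) (dob Z m)
        (Cmp C (dob Y j) (dob Y l) (dob Z m) h (dmor Y j l a)) f)"
      by (rule germ_eqI[OF Z x])
    also have "\<dots> = germ C Z (dob X i) m (Cmp C (dob X i) (dob Y l) (dob Z m) h
        (Cmp C (dob X i) (dob Y j) (dob Y l) (dmor Y j l a) f))"
      using x 1 hh diagram_simps[OF D(2)] by (subst cat_assoc[OF cat]) auto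
    also have "\<dots> = germ C Z (dob X i) m (Cmp C (dob X i) (dob Y l) (dob Z m) h
        (Cmp C (dob X i) (dob Y j') (dob Y l) (dmor Y j' l b) f'))"
      using 1(8) by simp
    also have "\<dots> = germ C Z (dob X i) m (Cmp C (dob X i) (dob Y j') (dob Z m)
        (Cmp C (dob Y j') (dob Y l) (dob Z m) h (dmor Y j' l b)) f')"
      using x 1 hh diagram_simps[OF D(2)] by (subst cat_assoc[OF cat]) auto
    also have "\<dots> = germ C Z (dob X i) k' (Cmp C (dob X i) (dob Y j') (dob Z k') g' f')"
    proof -
      have "((k', g'), (m, Cmp C (dob Y j') (dob Y l) (dob Z m) h (dmor Y j' l b))) \<in> ind_equiv C Z (dob Y j')"
        using G'(6)[OF 1(3) g'] G'(7)[OF 1(3,5,7) h] by (simp add: germ_mem_iff)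
      from ind_equiv_precomp[OF Z x G'(1)[OF 1(3)] 1(4) this] show ?thesis
        by (rule germ_eqI[OF Z x, symmetric])
    qed
    finally show ?thesis by simp
  qed
  have "(\<Union>(k', g')\<in>G j'. germ C Z (dob X i) k' (Cmp C (dob X i) (dob Y j') (dob Z k') g' f')) = ?E"
    if f': "(j', f') \<in> F i" for j' f'
  proof (rule SUP_eq_const)
    show "G j' \<noteq> {}" using G'(2)[OF F'(3)[OF f']] by blast
    show "(case p of (k', g') \<Rightarrow>
        germ C Z (dob X i) k' (Cmp C (dob X i) (dob Y j') (dob Z k') g' f')) = ?E" if "p \<in> G j'" for p
      using that eq[OF f'] by (simp only: split_beta prod.collapse)
  qed
  then have "(\<Union>(j', f')\<in>F i. \<Union>(k', g')\<in>G j'.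
      germ C Z (dob X i) k' (Cmp C (dob X i) (dob Y j') (dob Z k') g' f')) = ?E"
    using f by (intro SUP_eq_const) (auto simp only: split_beta prod.collapse)
  then show ?thesis using i by (simp add: Ind_simps)
qed

lemma Ind_Cmp_mem:
  assumes X: "X \<in> Ob (Ind C)" and Y: "Y \<in> Ob (Ind C)" and Z: "Z \<in> Ob (Ind C)"
    and F: "F \<in> Mor (Ind C) X Y" and G: "G \<in> Mor (Ind C) Y Z" and i: "i \<in> Ob (shape X)"
    and f: "(j, f) \<in> F i" and g: "(k, g) \<in> G j"
  shows "(k, Cmp C (dob X i) (dob Y j) (dob Z k) g f) \<in> Cmp (Ind C) X Y Z G F i"
proof -
  note F' = Ind_MorD[OF X Y F i]
  note G' = Ind_MorD[OF Y Z G F'(3)[OF f]]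
  show ?thesis
    unfolding Ind_Cmp_germ[OF assms] using F' G' f g cat
    by (intro germ_self[OF Z]) (auto intro: cat_comp)
qed

lemma Ind_Cmp_Mor:
  assumes X: "X \<in> Ob (Ind C)" and Y: "Y \<in> Ob (Ind C)" and Z: "Z \<in> Ob (Ind C)"
    and F: "F \<in> Mor (Ind C) X Y" and G: "G \<in> Mor (Ind C) Y Z"
  shows "Cmp (Ind C) X Y Z G F \<in> Mor (Ind C) X Z"
  unfolding Ind_Mor_iff
proof (intro conjI ballI allI impI PiE_I)
  note F' = Ind_MorD[OF X Y F] and G' = Ind_MorD[OF Y Z G]
  fix i assume i: "i \<in> Ob (shape X)"
  obtain j f where f: "(j, f) \<in> F i" using F'(2)[OF i] by blast
  obtain k g where g: "(k, g) \<in> G j" using G'(2)[OF F'(3)[OF i f]] by blast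
  show "Cmp (Ind C) X Y Z G F i \<in> colim_hom C Z (dob X i)"
    unfolding Ind_Cmp_germ[OF assms i f g]
    using F'[OF i] G'[OF F'(3)[OF i f]] f g cat
    by (intro germ_colim_hom) (auto intro: cat_comp)
next
  note F' = Ind_MorD[OF X Y F] and G' = Ind_MorD[OF Y Z G]
  fix i i' a k h
  assume i: "i \<in> Ob (shape X)" "i' \<in> Ob (shape X)" and a: "a \<in> Mor (shape X) i i'"
    and h: "(k, h) \<in> Cmp (Ind C) X Y Z G F i'"
  have D: "is_diagram C X" using X by (auto simp: Ind_simps)
  have xa: "dmor X i i' a \<in> Mor C (dob X i) (dob X i')" using diagram_simps(3)[OF D i a] .
  obtain j0 f0 where f0: "(j0, f0) \<in> F i'" using F'(2)[OF i(2)] by blast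
  obtain k0 g0 where g0: "(k0, g0) \<in> G j0" using G'(2)[OF F'(3)[OF i(2) f0]] by blast
  have xa0: "(j0, Cmp C (dob X i) (dob X i') (dob Y j0) f0 (dmor X i i' a)) \<in> F i"
    using F'(7)[OF i a f0] .
  have "((k0, Cmp C (dob X i') (dob Y j0) (dob Z k0) g0 f0), (k, h)) \<in> ind_equiv C Z (dob X i')"
    using h unfolding Ind_Cmp_germ[OF assms i(2) f0 g0] by (simp add: germ_mem_iff)
  from ind_equiv_precomp[OF Z F'(1)[OF i(1)] F'(1)[OF i(2)] xa this]
  show "(k, Cmp C (dob X i) (dob X i') (dob Z k) h (dmor X i i' a)) \<in> Cmp (Ind C) X Y Z G F i"
    unfolding Ind_Cmp_germ[OF assms i(1) xa0 g0] germ_mem_iff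
    using F'[OF i(1)] F'[OF i(2)] G'[OF F'(3)[OF i(2) f0]] f0 g0 xa
    by (subst (asm) cat_assoc[OF cat]) auto
qed (simp add: Ind_simps)

lemma Ind_Ident_mem:
  assumes "X \<in> Ob (Ind C)" "i \<in> Ob (shape X)"
  shows "(i, Ident C (dob X i)) \<in> Ident (Ind C) X i"
  using assms diagram_simps(2)[of C X i] by (auto simp: Ind_simps intro!: germ_self cat_ident[OF cat])

lemma Ind_Ident_Mor:
  assumes X: "X \<in> Ob (Ind C)"
  shows "Ident (Ind C) X \<in> Mor (Ind C) X X"
  unfolding Ind_Mor_iff
proof (intro conjI ballI allI impI PiE_I)
  have D: "is_diagram C X" using X by (auto simp: Ind_simps)
  note d = diagram_simps[OF D]
  show "Ident (Ind C) X i \<in> colim_hom C X (dob X i)" if "i \<in> Ob (shape X)" for i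
    using that d(2) by (simp add: Ind_simps germ_colim_hom cat_ident[OF cat])
  fix i i' a j f
  assume i: "i \<in> Ob (shape X)" "i' \<in> Ob (shape X)" and a: "a \<in> Mor (shape X) i i'"
    and f: "(j, f) \<in> Ident (Ind C) X i'"
  have xa: "dmor X i i' a \<in> Mor C (dob X i) (dob X i')" using d(3)[OF i a] .
  have "((i', Ident C (dob X i')), (j, f)) \<in> ind_equiv C X (dob X i')"
    using f i by (simp add: Ind_simps germ_mem_iff)
  from ind_equiv_precomp[OF X d(2)[OF i(1)] d(2)[OF i(2)] xa this]
  have "((i', dmor X i i' a), (j, Cmp C (dob X i) (dob X i') (dob X j) f (dmor X i i' a)))
      \<in> ind_equiv C X (dob X i)"
    using cat_id_left[OF cat d(2) d(2) xa] i by simp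
  moreover have "germ C X (dob X i) i' (dmor X i i' a) = germ C X (dob X i) i (Ident C (dob X i))"
    using germ_transition[OF X d(2) i a cat_ident[OF cat d(2)]] cat_id_right[OF cat d(2) d(2) xa] i
    by simp
  ultimately show "(j, Cmp C (dob X i) (dob X i') (dob X j) f (dmor X i i' a)) \<in> Ident (Ind C) X i"
    using i by (simp add: Ind_simps flip: germ_mem_iff)
qed (simp add: Ind_simps)

lemma is_category_Ind: "is_category (Ind C)"
  unfolding is_category_def
proof (intro conjI ballI)
  fix X :: "('u::universe, 'o, 'm) ind_ob" assume X: "X \<in> Ob (Ind C)"
  show "Ident (Ind C) X \<in> Mor (Ind C) X X" using Ind_Ident_Mor[OF X] .
next
  fix X Y Z :: "('u::universe, 'o, 'm) ind_ob" and F G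
  assume "X \<in> Ob (Ind C)" "Y \<in> Ob (Ind C)" "Z \<in> Ob (Ind C)"
    "F \<in> Mor (Ind C) X Y" "G \<in> Mor (Ind C) Y Z"
  then show "Cmp (Ind C) X Y Z G F \<in> Mor (Ind C) X Z" by (rule Ind_Cmp_Mor)
next
  fix X Y :: "('u::universe, 'o, 'm) ind_ob" and F
  assume X: "X \<in> Ob (Ind C)" and Y: "Y \<in> Ob (Ind C)" and F: "F \<in> Mor (Ind C) X Y"
  note F' = Ind_MorD[OF X Y F]
  show "Cmp (Ind C) X X Y F (Ident (Ind C) X) = F"
  proof (rule Ind_Mor_eqI[OF X Y Ind_Cmp_Mor[OF X X Y Ind_Ident_Mor[OF X] F] F])
    fix i assume i: "i \<in> Ob (shape X)"
    obtain j f where f: "(j, f) \<in> F i" using F'(2)[OF i] by blast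
    show "\<exists>p. p \<in> Cmp (Ind C) X X Y F (Ident (Ind C) X) i \<and> p \<in> F i"
      using Ind_Cmp_mem[OF X X Y Ind_Ident_Mor[OF X] F i Ind_Ident_mem[OF X i] f]
        cat_id_right[OF cat F'(1)[OF i] F'(4,5)[OF i f]] f by auto
  qed
  show "Cmp (Ind C) X Y Y (Ident (Ind C) Y) F = F"
  proof (rule Ind_Mor_eqI[OF X Y Ind_Cmp_Mor[OF X Y Y F Ind_Ident_Mor[OF Y]] F])
    fix i assume i: "i \<in> Ob (shape X)"
    obtain j f where f: "(j, f) \<in> F i" using F'(2)[OF i] by blast
    show "\<exists>p. p \<in> Cmp (Ind C) X Y Y (Ident (Ind C) Y) F i \<and> p \<in> F i"
      using Ind_Cmp_mem[OF X Y Y F Ind_Ident_Mor[OF Y] i f Ind_Ident_mem[OF Y F'(3)[OF i f]]]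
        cat_id_left[OF cat F'(1)[OF i] F'(4,5)[OF i f]] f by auto
  qed
next
  fix W X Y Z :: "('u::universe, 'o, 'm) ind_ob" and F G H
  assume W: "W \<in> Ob (Ind C)" and X: "X \<in> Ob (Ind C)" and Y: "Y \<in> Ob (Ind C)"
    and Z: "Z \<in> Ob (Ind C)"
    and F: "F \<in> Mor (Ind C) W X" and G: "G \<in> Mor (Ind C) X Y" and H: "H \<in> Mor (Ind C) Y Z"
  note GF = Ind_Cmp_Mor[OF W X Y F G] and HG = Ind_Cmp_Mor[OF X Y Z G H]
  show "Cmp (Ind C) W X Z (Cmp (Ind C) X Y Z H G) F = Cmp (Ind C) W Y Z H (Cmp (Ind C) W X Y G F)"
  proof (rule Ind_Mor_eqI[OF W Z Ind_Cmp_Mor[OF W X Z F HG] Ind_Cmp_Mor[OF W Y Z GF H]])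
    fix i assume i: "i \<in> Ob (shape W)"
    note F' = Ind_MorD[OF W X F i]
    obtain j f where f: "(j, f) \<in> F i" using F'(2) by blast
    note j = F'(3)[OF f]
    note G' = Ind_MorD[OF X Y G j]
    obtain k g where g: "(k, g) \<in> G j" using G'(2) by blast
    note k = G'(3)[OF g]
    note H' = Ind_MorD[OF Y Z H k]
    obtain l h where h: "(l, h) \<in> H k" using H'(2) by blast
    have "Cmp C (dob W i) (dob X j) (dob Z l) (Cmp C (dob X j) (dob Y k) (dob Z l) h g) f =
          Cmp C (dob W i) (dob Y k) (dob Z l) h (Cmp C (dob W i) (dob X j) (dob Y k) g f)"
      using F' G' H' f g h by (intro cat_assoc[OF cat]) auto
    then show "\<exists>p. p \<in> Cmp (Ind C) W X Z (Cmp (Ind C) X Y Z H G) F i \<and>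
        p \<in> Cmp (Ind C) W Y Z H (Cmp (Ind C) W X Y G F) i"
      using Ind_Cmp_mem[OF W X Z F HG i f Ind_Cmp_mem[OF X Y Z G H j g h]]
        Ind_Cmp_mem[OF W Y Z GF H i Ind_Cmp_mem[OF W X Y F G i f g] h] by auto
  qed
qed


section \<open>Constant ind-objects\<close>

lemma ind_const_simps [simp]:
  "Ob (shape (ind_const C x)) = {unat 0}"
  "Mor (shape (ind_const C x)) i j = (if i = j then {unat 0} else {})"
  "dob (ind_const C x) i = x"
  "dmor (ind_const C x) i j a = Ident C x"
  by (simp_all add: ind_const_def poset_cat_def)

lemma ind_const_Ob:
  assumes "x \<in> Ob C"
  shows "ind_const C x \<in> Ob (Ind C)"
  using cat_ident[OF cat assms] cat_id_left[OF cat assms assms cat_ident[OF cat assms]] assms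
  by (auto simp: Ind_simps is_diagram_def filtered_def is_category_def ind_const_def poset_cat_def)

lemma germ_ind_const:
  assumes "x \<in> Ob C" "y \<in> Ob C" "f \<in> Mor C x y"
  shows "germ C (ind_const C y) x (unat 0) f = {(unat 0, f)}"
  using assms cat_id_left[OF cat assms(1,2)]
  by (auto simp: germ_def ind_equiv_def)

lemma ind_const_mor_eq:
  assumes "x \<in> Ob C" "y \<in> Ob C" "f \<in> Mor C x y"
  shows "ind_const_mor C x y f = (\<lambda>i\<in>{unat 0}. {(unat 0, f)})"
  by (simp add: ind_const_mor_def germ_ind_const[OF assms])

lemma ind_const_mor_Mor:
  assumes "x \<in> Ob C" "y \<in> Ob C" "f \<in> Mor C x y"
  shows "ind_const_mor C x y f \<in> Mor (Ind C) (ind_const C x) (ind_const C y)"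
  using assms cat_id_right[OF cat assms] germ_colim_hom[of "unat 0" "ind_const C y" f x]
  by (auto simp: Ind_Mor_iff ind_const_mor_def germ_ind_const)

lemma ind_const_mor_mem:
  assumes "x \<in> Ob C" "y \<in> Ob C" "f \<in> Mor C x y"
  shows "(unat 0, f) \<in> ind_const_mor C x y f (unat 0)"
  by (simp add: ind_const_mor_eq[OF assms])

text \<open>A component of a morphism to a constant ind-object is the same as a morphism of \<open>C\<close>.\<close>

lemma Mor_to_ind_const:
  assumes "X \<in> Ob (Ind C)" "y \<in> Ob C" "F \<in> Mor (Ind C) X (ind_const C y)" "i \<in> Ob (shape X)"
  obtains f where "f \<in> Mor C (dob X i) y" "F i = {(unat 0, f)}"
proof -
  note F' = Ind_MorD[OF assms(1) ind_const_Ob[OF assms(2)] assms(3,4)]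
  obtain j f where f: "(j, f) \<in> F i" using F'(2) by blast
  show ?thesis
    using that[of f] F'(1) F'(3,5,6)[OF f] germ_ind_const[OF _ assms(2), of "dob X i" f] by auto
qed

text \<open>The morphism from \<open>X\<close> to a constant ind-object with components \<open>g\<close>.\<close>

definition to_const :: "('u::universe, 'o, 'm) ind_ob \<Rightarrow> ('u \<Rightarrow> 'm) \<Rightarrow> ('u, 'm) ind_mor" where
  "to_const X g = (\<lambda>k\<in>Ob (shape X). {(unat 0, g k)})"

lemma to_const_mem: "k \<in> Ob (shape X) \<Longrightarrow> (unat 0, g k) \<in> to_const X g k"
  by (simp add: to_const_def)

lemma to_const_eq_iff:
  "to_const X g = to_const X h \<longleftrightarrow> (\<forall>k\<in>Ob (shape X). g k = h k)"
  by (auto simp: to_const_def fun_eq_iff restrict_def)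

lemma to_const_Mor:
  assumes "X \<in> Ob (Ind C)" "y \<in> Ob C"
    "\<And>k. k \<in> Ob (shape X) \<Longrightarrow> g k \<in> Mor C (dob X k) y"
    "\<And>k l a. k \<in> Ob (shape X) \<Longrightarrow> l \<in> Ob (shape X) \<Longrightarrow> a \<in> Mor (shape X) k l \<Longrightarrow>
       Cmp C (dob X k) (dob X l) y (g l) (dmor X k l a) = g k"
  shows "to_const X g \<in> Mor (Ind C) X (ind_const C y)"
  unfolding Ind_Mor_iff
proof (intro conjI ballI allI impI PiE_I)
  fix k assume k: "k \<in> Ob (shape X)"
  have "dob X k \<in> Ob C" using assms(1) k diagram_simps(2) by (auto simp: Ind_simps)
  then show "to_const X g k \<in> colim_hom C (ind_const C y) (dob X k)"
    using germ_colim_hom[of "unat 0" "ind_const C y" "g k" "dob X k"] assms(2,3) k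
    by (simp add: germ_ind_const to_const_def)
qed (use assms(4) in \<open>auto simp: to_const_def\<close>)

lemma Mor_eq_to_const:
  assumes X: "X \<in> Ob (Ind C)" and y: "y \<in> Ob C" and F: "F \<in> Mor (Ind C) X (ind_const C y)"
  obtains g where "F = to_const X g"
    "\<And>k. k \<in> Ob (shape X) \<Longrightarrow> g k \<in> Mor C (dob X k) y"
    "\<And>k l a. k \<in> Ob (shape X) \<Longrightarrow> l \<in> Ob (shape X) \<Longrightarrow> a \<in> Mor (shape X) k l \<Longrightarrow>
       Cmp C (dob X k) (dob X l) y (g l) (dmor X k l a) = g k"
proof -
  have "\<forall>k\<in>Ob (shape X). \<exists>f. f \<in> Mor C (dob X k) y \<and> F k = {(unat 0, f)}"
    using Mor_to_ind_const[OF X y F] by metis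
  then obtain g where g: "\<And>k. k \<in> Ob (shape X) \<Longrightarrow> g k \<in> Mor C (dob X k) y"
    "\<And>k. k \<in> Ob (shape X) \<Longrightarrow> F k = {(unat 0, g k)}" by (metis bchoice)
  have "F \<in> extensional (Ob (shape X))" using F by (auto simp: Ind_Mor_iff PiE_def)
  then have "F = to_const X g"
    by (rule extensionalityI) (auto simp: to_const_def g)
  moreover have "Cmp C (dob X k) (dob X l) y (g l) (dmor X k l a) = g k"
    if "k \<in> Ob (shape X)" "l \<in> Ob (shape X)" "a \<in> Mor (shape X) k l" for k l a
    using Ind_MorD(7)[OF X ind_const_Ob[OF y] F that, of "unat 0" "g l"] g(2) that by simp
  ultimately show ?thesis using that g(1) by blast
qed

lemma Cmp_ind_const_mor_to_const:
  assumes X: "X \<in> Ob (Ind C)" and y: "y \<in> Ob C" and z: "z \<in> Ob C" and h: "h \<in> Mor C y z"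
    and g: "to_const X g \<in> Mor (Ind C) X (ind_const C y)"
  shows "Cmp (Ind C) X (ind_const C y) (ind_const C z) (ind_const_mor C y z h) (to_const X g) =
    to_const X (\<lambda>k. Cmp C (dob X k) y z h (g k))" (is "?l = ?r")
proof (rule extensionalityI[of _ "Ob (shape X)"])
  fix k assume k: "k \<in> Ob (shape X)"
  note Y = ind_const_Ob[OF y] and Z = ind_const_Ob[OF z]
  have gk: "g k \<in> Mor C (dob X k) y" and xk: "dob X k \<in> Ob C"
    using Ind_MorD(1,5)[OF X Y g k] to_const_mem[OF k] by auto
  then have "Cmp C (dob X k) y z h (g k) \<in> Mor C (dob X k) z"
    using cat y z h by (auto intro: cat_comp)
  moreover have "?r k = {(unat 0, Cmp C (dob X k) y z h (g k))}"
    using k by (simp add: to_const_def)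
  ultimately show "?l k = ?r k"
    using Ind_Cmp_germ[OF X Y Z g ind_const_mor_Mor[OF y z h] k to_const_mem[OF k]
        ind_const_mor_mem[OF y z h]] germ_ind_const[OF xk z] by simp
qed (auto simp: to_const_def Ind_simps)

lemma Cmp_to_const:
  assumes X: "X \<in> Ob (Ind C)" and Y: "Y \<in> Ob (Ind C)" and z: "z \<in> Ob C"
    and F: "F \<in> Mor (Ind C) X Y"
    and g: "to_const Y g \<in> Mor (Ind C) Y (ind_const C z)"
    and k: "k \<in> Ob (shape X)" and f: "(j, f) \<in> F k"
  shows "Cmp (Ind C) X Y (ind_const C z) (to_const Y g) F k =
    {(unat 0, Cmp C (dob X k) (dob Y j) z (g j) f)}"
proof -
  note F' = Ind_MorD[OF X Y F k] and Z = ind_const_Ob[OF z]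
  note j = F'(3)[OF f]
  have gj: "g j \<in> Mor C (dob Y j) z"
    using Ind_MorD(5)[OF Y Z g j to_const_mem[OF j]] by simp
  have "Cmp C (dob X k) (dob Y j) z (g j) f \<in> Mor C (dob X k) z"
    using cat F'(1) F'(4,5)[OF f] z gj by (auto intro: cat_comp)
  then show ?thesis
    using Ind_Cmp_germ[OF X Y Z F g k f to_const_mem[OF j]] germ_ind_const[OF F'(1) z] by simp
qed

lemma ind_const_mor_to_const:
  assumes "x \<in> Ob C" "y \<in> Ob C" "f \<in> Mor C x y"
  shows "ind_const_mor C x y f = to_const (ind_const C x) (\<lambda>_. f)"
  using ind_const_mor_eq[OF assms] by (simp add: to_const_def)

lemma ind_const_mor_inject:
  assumes "x \<in> Ob C" "y \<in> Ob C" "f \<in> Mor C x y" "g \<in> Mor C x y"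
  shows "ind_const_mor C x y f = ind_const_mor C x y g \<longleftrightarrow> f = g"
  using assms by (simp add: ind_const_mor_to_const to_const_eq_iff)

lemma ind_const_mor_comp:
  assumes "x \<in> Ob C" "y \<in> Ob C" "z \<in> Ob C" "f \<in> Mor C x y" "g \<in> Mor C y z"
  shows "Cmp (Ind C) (ind_const C x) (ind_const C y) (ind_const C z)
    (ind_const_mor C y z g) (ind_const_mor C x y f) = ind_const_mor C x z (Cmp C x y z g f)"
proof -
  have gf: "Cmp C x y z g f \<in> Mor C x z" using cat assms by (auto intro: cat_comp)
  show ?thesis
    using Cmp_ind_const_mor_to_const[OF ind_const_Ob[OF assms(1)] assms(2,3,5), of "\<lambda>_. f"]
      ind_const_mor_Mor[OF assms(1,2,4)] assms gf
    by (simp add: ind_const_mor_to_const)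
qed

lemma ind_const_diagram_simps [simp]:
  "shape (ind_const_diagram C D) = shape D"
  "dob (ind_const_diagram C D) i = ind_const C (dob D i)"
  "dmor (ind_const_diagram C D) i j a = ind_const_mor C (dob D i) (dob D j) (dmor D i j a)"
  by (simp_all add: ind_const_diagram_def)

text \<open>
  The objects and arrows of \<open>D\<close> lie in \<open>C\<close>; functoriality plays no role for cones and limits.
\<close>

definition well_typed :: "('i, 'a, 'o, 'm) diagram \<Rightarrow> bool" where
  "well_typed D \<longleftrightarrow> (\<forall>i\<in>Ob (shape D). dob D i \<in> Ob C) \<and>
     (\<forall>i\<in>Ob (shape D). \<forall>j\<in>Ob (shape D). \<forall>a\<in>Mor (shape D) i j.
        dmor D i j a \<in> Mor C (dob D i) (dob D j))"

lemma ind_const_diagram_typed: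
  assumes "well_typed D"
  shows "\<forall>i\<in>Ob (shape (ind_const_diagram C D)). dob (ind_const_diagram C D) i \<in> Ob (Ind C)"
    "\<forall>i\<in>Ob (shape (ind_const_diagram C D)). \<forall>j\<in>Ob (shape (ind_const_diagram C D)).
       \<forall>a\<in>Mor (shape (ind_const_diagram C D)) i j.
       dmor (ind_const_diagram C D) i j a \<in>
         Mor (Ind C) (dob (ind_const_diagram C D) i) (dob (ind_const_diagram C D) j)"
  using assms by (auto simp: well_typed_def intro: ind_const_Ob ind_const_mor_Mor)

text \<open>
  A cone in \<open>Ind C\<close> over a diagram of constant ind-objects is a family of cones in \<open>C\<close>, natural in
  the index of the apex.
\<close>

lemma cone_to_constE:
  assumes D: "well_typed D" and c: "is_cone (Ind C) (ind_const_diagram C D) X c"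
  obtains g where
    "\<And>i. i \<in> Ob (shape D) \<Longrightarrow> c i = to_const X (g i)"
    "\<And>i k. i \<in> Ob (shape D) \<Longrightarrow> k \<in> Ob (shape X) \<Longrightarrow> g i k \<in> Mor C (dob X k) (dob D i)"
    "\<And>i k l a. i \<in> Ob (shape D) \<Longrightarrow> k \<in> Ob (shape X) \<Longrightarrow> l \<in> Ob (shape X) \<Longrightarrow>
       a \<in> Mor (shape X) k l \<Longrightarrow> Cmp C (dob X k) (dob X l) (dob D i) (g i l) (dmor X k l a) = g i k"
    "\<And>i j a k. i \<in> Ob (shape D) \<Longrightarrow> j \<in> Ob (shape D) \<Longrightarrow> a \<in> Mor (shape D) i j \<Longrightarrow>
       k \<in> Ob (shape X) \<Longrightarrow> Cmp C (dob X k) (dob D i) (dob D j) (dmor D i j a) (g i k) = g j k"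
proof -
  have X: "X \<in> Ob (Ind C)" using c by (simp add: is_cone_def)
  have "\<forall>i\<in>Ob (shape D). \<exists>g. c i = to_const X g \<and>
      (\<forall>k\<in>Ob (shape X). g k \<in> Mor C (dob X k) (dob D i)) \<and>
      (\<forall>k\<in>Ob (shape X). \<forall>l\<in>Ob (shape X). \<forall>a\<in>Mor (shape X) k l.
         Cmp C (dob X k) (dob X l) (dob D i) (g l) (dmor X k l a) = g k)"
  proof
    fix i assume i: "i \<in> Ob (shape D)"
    have "c i \<in> Mor (Ind C) X (ind_const C (dob D i))" "dob D i \<in> Ob C"
      using c D i by (auto simp: is_cone_def well_typed_def)
    then show "\<exists>g. c i = to_const X g \<and> (\<forall>k\<in>Ob (shape X). g k \<in> Mor C (dob X k) (dob D i)) \<and>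
      (\<forall>k\<in>Ob (shape X). \<forall>l\<in>Ob (shape X). \<forall>a\<in>Mor (shape X) k l.
         Cmp C (dob X k) (dob X l) (dob D i) (g l) (dmor X k l a) = g k)"
      using Mor_eq_to_const[OF X, of "dob D i" "c i"] by metis
  qed
  from bchoice[OF this] obtain g where g: "\<And>i. i \<in> Ob (shape D) \<Longrightarrow> c i = to_const X (g i)"
    "\<And>i k. i \<in> Ob (shape D) \<Longrightarrow> k \<in> Ob (shape X) \<Longrightarrow> g i k \<in> Mor C (dob X k) (dob D i)"
    "\<And>i k l a. i \<in> Ob (shape D) \<Longrightarrow> k \<in> Ob (shape X) \<Longrightarrow> l \<in> Ob (shape X) \<Longrightarrow>
       a \<in> Mor (shape X) k l \<Longrightarrow> Cmp C (dob X k) (dob X l) (dob D i) (g i l) (dmor X k l a) = g i k"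
    by blast
  have "Cmp C (dob X k) (dob D i) (dob D j) (dmor D i j a) (g i k) = g j k"
    if i: "i \<in> Ob (shape D)" "j \<in> Ob (shape D)" "a \<in> Mor (shape D) i j" and k: "k \<in> Ob (shape X)"
    for i j a k
  proof -
    have "Cmp (Ind C) X (ind_const C (dob D i)) (ind_const C (dob D j))
        (ind_const_mor C (dob D i) (dob D j) (dmor D i j a)) (c i) = c j"
      using c i unfolding is_cone_def by auto
    moreover have "c i \<in> Mor (Ind C) X (ind_const C (dob D i))"
      using c i by (auto simp: is_cone_def)
    ultimately have "to_const X (\<lambda>k. Cmp C (dob X k) (dob D i) (dob D j) (dmor D i j a) (g i k)) =
        to_const X (g j)"
      using Cmp_ind_const_mor_to_const[OF X, of "dob D i" "dob D j" "dmor D i j a" "g i"] g(1) D i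
      by (simp add: well_typed_def)
    then show ?thesis using k by (simp add: to_const_eq_iff)
  qed
  then show ?thesis using that g by blast
qed

lemma cone_to_constI:
  assumes D: "well_typed D" and X: "X \<in> Ob (Ind C)" and
    c: "\<And>i. i \<in> Ob (shape D) \<Longrightarrow> c i = to_const X (g i)" and
    g: "\<And>i k. i \<in> Ob (shape D) \<Longrightarrow> k \<in> Ob (shape X) \<Longrightarrow> g i k \<in> Mor C (dob X k) (dob D i)"
    "\<And>i k l a. i \<in> Ob (shape D) \<Longrightarrow> k \<in> Ob (shape X) \<Longrightarrow> l \<in> Ob (shape X) \<Longrightarrow>
       a \<in> Mor (shape X) k l \<Longrightarrow> Cmp C (dob X k) (dob X l) (dob D i) (g i l) (dmor X k l a) = g i k"
    "\<And>i j a k. i \<in> Ob (shape D) \<Longrightarrow> j \<in> Ob (shape D) \<Longrightarrow> a \<in> Mor (shape D) i j \<Longrightarrow>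
       k \<in> Ob (shape X) \<Longrightarrow> Cmp C (dob X k) (dob D i) (dob D j) (dmor D i j a) (g i k) = g j k"
  shows "is_cone (Ind C) (ind_const_diagram C D) X c"
  unfolding is_cone_def ind_const_diagram_simps
proof (intro conjI ballI X)
  fix i assume i: "i \<in> Ob (shape D)"
  have m: "to_const X (g i) \<in> Mor (Ind C) X (ind_const C (dob D i))"
    using D i g(1,2) by (intro to_const_Mor[OF X]) (auto simp: well_typed_def)
  then show "c i \<in> Mor (Ind C) X (ind_const C (dob D i))" using c[OF i] by simp
  fix j a assume j: "j \<in> Ob (shape D)" and a: "a \<in> Mor (shape D) i j"
  have "to_const X (\<lambda>k. Cmp C (dob X k) (dob D i) (dob D j) (dmor D i j a) (g i k)) = to_const X (g j)"
    using g(3)[OF i j a] by (simp add: to_const_eq_iff)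
  then show "Cmp (Ind C) X (ind_const C (dob D i)) (ind_const C (dob D j))
      (ind_const_mor C (dob D i) (dob D j) (dmor D i j a)) (c i) = c j"
    using Cmp_ind_const_mor_to_const[OF X _ _ _ m] D i j a c
    by (simp add: well_typed_def)
qed

end


section \<open>Banach modules\<close>

lemma Ban_simps [simp]:
  "Ob (Ban R) = {M. banach_module R M}"
  "Ident (Ban R) M = (\<lambda>x\<in>carrier M. x)"
  "Cmp (Ban R) M N P g f = compose (carrier M) g f"
  by (simp_all add: Ban_def)

lemma Ban_Mor_iff:
  "f \<in> Mor (Ban R) M N \<longleftrightarrow> f \<in> carrier M \<rightarrow>\<^sub>E carrier N \<and>
     (\<forall>x\<in>carrier M. \<forall>y\<in>carrier M. f (x \<oplus>\<^bsub>M\<^esub> y) = f x \<oplus>\<^bsub>N\<^esub> f y) \<and>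
     (\<forall>a\<in>carrier R. \<forall>x\<in>carrier M. f (a \<odot>\<^bsub>M\<^esub> x) = a \<odot>\<^bsub>N\<^esub> f x) \<and>
     (\<exists>C. \<forall>x\<in>carrier M. mnorm N (f x) \<le> C * mnorm M x)"
  by (auto simp: Ban_def linear_maps_def)

text \<open>\<open>K\<close> is a constant for the scalar multiplication of \<open>M\<close>.\<close>

definition smult_bound :: "'r normed_ring \<Rightarrow> ('r, 'u) normed_module \<Rightarrow> real \<Rightarrow> bool" where
  "smult_bound R M K \<longleftrightarrow> K > 0 \<and>
     (\<forall>a\<in>carrier R. \<forall>x\<in>carrier M. mnorm M (a \<odot>\<^bsub>M\<^esub> x) \<le> K * rnorm R a * mnorm M x)"

lemma banach_module_iff:
  "banach_module R M \<longleftrightarrow>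
     module R M \<and> complete_norm M (mnorm M) \<and> (\<exists>K. smult_bound R M K)"
  by (simp add: banach_module_def smult_bound_def)

lemma banach_moduleD:
  assumes "banach_module R M"
  shows "module R M" "abelian_group M" "cring R"
    "\<zero>\<^bsub>M\<^esub> \<in> carrier M"
    "x \<in> carrier M \<Longrightarrow> mnorm M x \<ge> 0"
    "x \<in> carrier M \<Longrightarrow> mnorm M x = 0 \<longleftrightarrow> x = \<zero>\<^bsub>M\<^esub>"
    "mnorm M \<zero>\<^bsub>M\<^esub> = 0"
    "x \<in> carrier M \<Longrightarrow> y \<in> carrier M \<Longrightarrow> x \<oplus>\<^bsub>M\<^esub> y \<in> carrier M"
    "x \<in> carrier M \<Longrightarrow> y \<in> carrier M \<Longrightarrow> x \<ominus>\<^bsub>M\<^esub> y \<in> carrier M"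
    "x \<in> carrier M \<Longrightarrow> \<ominus>\<^bsub>M\<^esub> x \<in> carrier M"
    "a \<in> carrier R \<Longrightarrow> x \<in> carrier M \<Longrightarrow> a \<odot>\<^bsub>M\<^esub> x \<in> carrier M"
    "x \<in> carrier M \<Longrightarrow> y \<in> carrier M \<Longrightarrow> mnorm M (x \<oplus>\<^bsub>M\<^esub> y) \<le> mnorm M x + mnorm M y"
proof -
  have m: "module R M" and c: "complete_norm M (mnorm M)"
    using assms by (auto simp: banach_module_def)
  interpret module R M by fact
  show "module R M" "abelian_group M" "cring R" by unfold_locales
  show "\<zero>\<^bsub>M\<^esub> \<in> carrier M" by simp
  show "mnorm M \<zero>\<^bsub>M\<^esub> = 0" using c by (simp add: complete_norm_def)
  show "x \<in> carrier M \<Longrightarrow> mnorm M x \<ge> 0"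
    "x \<in> carrier M \<Longrightarrow> mnorm M x = 0 \<longleftrightarrow> x = \<zero>\<^bsub>M\<^esub>"
    "x \<in> carrier M \<Longrightarrow> y \<in> carrier M \<Longrightarrow> mnorm M (x \<oplus>\<^bsub>M\<^esub> y) \<le> mnorm M x + mnorm M y"
    using c by (auto simp: complete_norm_def)
  show "x \<in> carrier M \<Longrightarrow> y \<in> carrier M \<Longrightarrow> x \<oplus>\<^bsub>M\<^esub> y \<in> carrier M"
    "x \<in> carrier M \<Longrightarrow> y \<in> carrier M \<Longrightarrow> x \<ominus>\<^bsub>M\<^esub> y \<in> carrier M"
    "x \<in> carrier M \<Longrightarrow> \<ominus>\<^bsub>M\<^esub> x \<in> carrier M"
    "a \<in> carrier R \<Longrightarrow> x \<in> carrier M \<Longrightarrow> a \<odot>\<^bsub>M\<^esub> x \<in> carrier M"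
    by auto
qed

lemma banach_module_complete:
  assumes "banach_module R M" "\<And>n. s n \<in> carrier M"
    "\<And>e. e > 0 \<Longrightarrow> \<exists>N. \<forall>m\<ge>N. \<forall>n\<ge>N. mnorm M (s m \<ominus>\<^bsub>M\<^esub> s n) < e"
  shows "\<exists>l\<in>carrier M. (\<lambda>n. mnorm M (s n \<ominus>\<^bsub>M\<^esub> l)) \<longlonglongrightarrow> 0"
  using assms unfolding banach_module_def complete_norm_def by blast

lemma banach_ringD:
  assumes "banach_ring R"
  shows "cring R" "a \<in> carrier R \<Longrightarrow> rnorm R a \<ge> 0"
    "a \<in> carrier R \<Longrightarrow> rnorm R a = 0 \<longleftrightarrow> a = \<zero>\<^bsub>R\<^esub>"
  using assms by (auto simp: banach_ring_def complete_norm_def)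

lemma Ban_MorE:
  assumes "f \<in> Mor (Ban R) M N" "banach_module R M"
  obtains K where "K > 0" "\<And>x. x \<in> carrier M \<Longrightarrow> mnorm N (f x) \<le> K * mnorm M x"
proof -
  obtain C where C: "\<And>x. x \<in> carrier M \<Longrightarrow> mnorm N (f x) \<le> C * mnorm M x"
    using assms(1) unfolding Ban_Mor_iff by blast
  have "mnorm N (f x) \<le> (\<bar>C\<bar> + 1) * mnorm M x" if x: "x \<in> carrier M" for x
    using C[OF x] mult_right_mono[of C "\<bar>C\<bar> + 1" "mnorm M x"] banach_moduleD(5)[OF assms(2) x]
    by linarith
  then show ?thesis using that[of "\<bar>C\<bar> + 1"] by auto
qed

lemma is_category_Ban: "is_category (Ban R)"
  unfolding is_category_def
proof (intro conjI ballI)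
  fix M assume M: "M \<in> Ob (Ban R)"
  have "mnorm M (if x \<in> carrier M then x else undefined) \<le> 1 * mnorm M x" if "x \<in> carrier M" for x
    using that by simp
  then show "Ident (Ban R) M \<in> Mor (Ban R) M M"
    using M banach_moduleD[of R M] unfolding Ban_Mor_iff by (auto intro!: exI[of _ 1])
next
  fix M N P f g
  assume *: "M \<in> Ob (Ban R)" "N \<in> Ob (Ban R)" "P \<in> Ob (Ban R)"
    "f \<in> Mor (Ban R) M N" "g \<in> Mor (Ban R) N P"
  obtain K where K: "K > 0" "\<And>x. x \<in> carrier M \<Longrightarrow> mnorm N (f x) \<le> K * mnorm M x"
    using * by (auto elim: Ban_MorE)
  obtain L where L: "L > 0" "\<And>x. x \<in> carrier N \<Longrightarrow> mnorm P (g x) \<le> L * mnorm N x"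
    using * by (auto elim: Ban_MorE)
  have "mnorm P (g (f x)) \<le> (L * K) * mnorm M x" if x: "x \<in> carrier M" for x
  proof -
    have "f x \<in> carrier N" using *(4) x by (auto simp: Ban_Mor_iff)
    then have "mnorm P (g (f x)) \<le> L * mnorm N (f x)" by (rule L(2))
    also have "\<dots> \<le> L * (K * mnorm M x)" using K(2)[OF x] L(1) by (intro mult_left_mono) auto
    finally show ?thesis by simp
  qed
  then show "Cmp (Ban R) M N P g f \<in> Mor (Ban R) M P"
    using * banach_moduleD(8,11)[of R M] unfolding Ban_Mor_iff
    by (auto simp: compose_def PiE_iff intro!: exI[of _ "L * K"])
next
  fix M N f assume "M \<in> Ob (Ban R)" "N \<in> Ob (Ban R)" "f \<in> Mor (Ban R) M N"
  then show "Cmp (Ban R) M M N f (Ident (Ban R) M) = f" "Cmp (Ban R) M N N (Ident (Ban R) N) f = f"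
    by (auto simp: Ban_Mor_iff fun_eq_iff compose_def PiE_iff extensional_def)
next
  fix M N P Q f g h
  assume "f \<in> Mor (Ban R) M N" "g \<in> Mor (Ban R) N P" "h \<in> Mor (Ban R) P Q"
  then show "Cmp (Ban R) M N Q (Cmp (Ban R) N P Q h g) f =
      Cmp (Ban R) M P Q h (Cmp (Ban R) M N P g f)"
    by (auto simp: Ban_Mor_iff fun_eq_iff compose_def PiE_iff)
qed

text \<open>The norm of \<open>- x\<close> is controlled by the constant of the scalar multiplication.\<close>

lemma mnorm_uminus_le:
  assumes "banach_module R M" "smult_bound R M K" "x \<in> carrier M"
  shows "mnorm M (\<ominus>\<^bsub>M\<^esub> x) \<le> K * rnorm R (\<ominus>\<^bsub>R\<^esub> \<one>\<^bsub>R\<^esub>) * mnorm M x"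
proof -
  interpret module R M using banach_moduleD(1)[OF assms(1)] .
  have "(\<ominus>\<^bsub>R\<^esub> \<one>\<^bsub>R\<^esub>) \<odot>\<^bsub>M\<^esub> x = \<ominus>\<^bsub>M\<^esub> x" using assms(3) by (simp add: smult_l_minus)
  then show ?thesis using assms(2,3) unfolding smult_bound_def by (metis R.a_inv_closed R.one_closed)
qed

lemma mnorm_diff_tri:
  assumes "banach_module R M" "x \<in> carrier M" "y \<in> carrier M" "z \<in> carrier M"
  shows "mnorm M (x \<ominus>\<^bsub>M\<^esub> z) \<le> mnorm M (x \<ominus>\<^bsub>M\<^esub> y) + mnorm M (y \<ominus>\<^bsub>M\<^esub> z)"
proof -
  interpret abelian_group M using banach_moduleD(2)[OF assms(1)] .
  have "x \<ominus>\<^bsub>M\<^esub> z = (x \<ominus>\<^bsub>M\<^esub> y) \<oplus>\<^bsub>M\<^esub> (y \<ominus>\<^bsub>M\<^esub> z)"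
    using assms(2-4) by (simp add: a_minus_def a_assoc r_neg1)
  then show ?thesis
    using banach_moduleD(12)[OF assms(1), of "x \<ominus>\<^bsub>M\<^esub> y" "y \<ominus>\<^bsub>M\<^esub> z"] assms(2-4) by simp
qed

lemma minus_swap:
  assumes "abelian_group M" "x \<in> carrier M" "y \<in> carrier M"
  shows "\<ominus>\<^bsub>M\<^esub> (x \<ominus>\<^bsub>M\<^esub> y) = y \<ominus>\<^bsub>M\<^esub> x"
proof -
  interpret abelian_group M by fact
  show ?thesis using assms(2,3) by (simp add: a_minus_def minus_add a_comm)
qed

lemma minus_eq_zero_iff:
  assumes "abelian_group M" "x \<in> carrier M" "y \<in> carrier M"
  shows "x \<ominus>\<^bsub>M\<^esub> y = \<zero>\<^bsub>M\<^esub> \<longleftrightarrow> x = y"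
proof -
  interpret abelian_group M by fact
  show ?thesis
  proof
    assume "x \<ominus>\<^bsub>M\<^esub> y = \<zero>\<^bsub>M\<^esub>"
    then have "(x \<ominus>\<^bsub>M\<^esub> y) \<oplus>\<^bsub>M\<^esub> y = y" using assms by simp
    then show "x = y" using assms by (simp add: a_minus_def a_assoc l_neg)
  next
    assume "x = y"
    then show "x \<ominus>\<^bsub>M\<^esub> y = \<zero>\<^bsub>M\<^esub>" using assms by (simp add: a_minus_def r_neg)
  qed
qed

lemma Ban_Mor_minus:
  assumes "banach_module R M" "banach_module R N" "f \<in> Mor (Ban R) M N"
    "x \<in> carrier M" "y \<in> carrier M"
  shows "f (x \<ominus>\<^bsub>M\<^esub> y) = f x \<ominus>\<^bsub>N\<^esub> f y"
proof -
  interpret M: abelian_group M using banach_moduleD(2)[OF assms(1)] .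
  interpret N: abelian_group N using banach_moduleD(2)[OF assms(2)] .
  have f: "f x \<in> carrier N" "f y \<in> carrier N" "f (x \<ominus>\<^bsub>M\<^esub> y) \<in> carrier N"
    using assms(3-5) by (auto simp: Ban_Mor_iff PiE_iff)
  have "(x \<ominus>\<^bsub>M\<^esub> y) \<oplus>\<^bsub>M\<^esub> y = x" using assms(4,5) by (simp add: a_minus_def M.a_assoc M.l_neg)
  moreover have "f ((x \<ominus>\<^bsub>M\<^esub> y) \<oplus>\<^bsub>M\<^esub> y) = f (x \<ominus>\<^bsub>M\<^esub> y) \<oplus>\<^bsub>N\<^esub> f y"
    using assms(3-5) M.minus_closed[of x y] by (auto simp: Ban_Mor_iff)
  ultimately have "f x = f (x \<ominus>\<^bsub>M\<^esub> y) \<oplus>\<^bsub>N\<^esub> f y" by simp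
  then show ?thesis using f by (simp add: a_minus_def N.a_assoc N.r_neg)
qed


section \<open>Equivalent norms\<close>

lemma mnorm_update_simps [simp]:
  "a_inv (M\<lparr>mnorm := n\<rparr>) = a_inv M"
  "x \<ominus>\<^bsub>M\<lparr>mnorm := n\<rparr>\<^esub> y = x \<ominus>\<^bsub>M\<^esub> y"
  by (simp_all add: a_inv_def a_minus_def)

lemma module_mnorm_update [simp]: "module R (M\<lparr>mnorm := n\<rparr>) \<longleftrightarrow> module R M"
  unfolding module_def abelian_group_def abelian_monoid_def abelian_group_axioms_def module_axioms_def
  by simp

text \<open>The function \<open>n\<close> and the norm of \<open>M\<close> bound each other on the carrier up to a constant.\<close>

definition equivalent_norm :: "('r, 'u) normed_module \<Rightarrow> ('u \<Rightarrow> real) \<Rightarrow> bool" where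
  "equivalent_norm M n \<longleftrightarrow> (\<exists>A>0. \<forall>x\<in>carrier M. n x \<le> A * mnorm M x \<and> mnorm M x \<le> A * n x)"

lemma banach_module_equivalent_norm:
  assumes M: "banach_module R M" and n: "equivalent_norm M n"
    and tri: "\<And>x y. x \<in> carrier M \<Longrightarrow> y \<in> carrier M \<Longrightarrow> n (x \<oplus>\<^bsub>M\<^esub> y) \<le> n x + n y"
    and K: "smult_bound R (M\<lparr>mnorm := n\<rparr>) K"
  shows "banach_module R (M\<lparr>mnorm := n\<rparr>)"
proof -
  obtain A where A: "A > 0" "\<And>x. x \<in> carrier M \<Longrightarrow> n x \<le> A * mnorm M x"
    "\<And>x. x \<in> carrier M \<Longrightarrow> mnorm M x \<le> A * n x"
    using n unfolding equivalent_norm_def by blast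
  have nonneg: "n x \<ge> 0" if "x \<in> carrier M" for x
    using A(1) A(3)[OF that] banach_moduleD(5)[OF M that] by (meson order_trans zero_le_mult_iff linorder_not_less)
  have zero: "n x = 0 \<longleftrightarrow> x = \<zero>\<^bsub>M\<^esub>" if "x \<in> carrier M" for x
    using A(2,3)[OF that] A(1) banach_moduleD(5,6)[OF M that] nonneg[OF that] by auto
  have "\<exists>l\<in>carrier M. (\<lambda>k. n (s k \<ominus>\<^bsub>M\<^esub> l)) \<longlonglongrightarrow> 0"
    if s: "\<And>k. s k \<in> carrier M"
      and cau: "\<And>e. e > 0 \<Longrightarrow> \<exists>N. \<forall>k\<ge>N. \<forall>m\<ge>N. n (s k \<ominus>\<^bsub>M\<^esub> s m) < e" for s :: "nat \<Rightarrow> 'b"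
  proof -
    note d = banach_moduleD(9)[OF M]
    have "\<exists>N. \<forall>k\<ge>N. \<forall>m\<ge>N. mnorm M (s k \<ominus>\<^bsub>M\<^esub> s m) < e" if "e > 0" for e
    proof -
      obtain N where N: "\<And>k m. k \<ge> N \<Longrightarrow> m \<ge> N \<Longrightarrow> n (s k \<ominus>\<^bsub>M\<^esub> s m) < e / A"
        using cau[of "e / A"] \<open>e > 0\<close> A(1) by auto
      have "mnorm M (s k \<ominus>\<^bsub>M\<^esub> s m) < e" if "k \<ge> N" "m \<ge> N" for k m
        using A(3)[OF d[OF s s], of k m] mult_strict_left_mono[OF N[OF that] A(1)] A(1) by simp
      then show ?thesis by blast
    qed
    then obtain l where l: "l \<in> carrier M" "(\<lambda>k. mnorm M (s k \<ominus>\<^bsub>M\<^esub> l)) \<longlonglongrightarrow> 0"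
      using banach_module_complete[OF M, of s] s by blast
    have "(\<lambda>k. n (s k \<ominus>\<^bsub>M\<^esub> l)) \<longlonglongrightarrow> 0"
    proof (rule tendsto_sandwich)
      show "(\<lambda>k. 0 :: real) \<longlonglongrightarrow> 0" by simp
      show "(\<lambda>k. A * mnorm M (s k \<ominus>\<^bsub>M\<^esub> l)) \<longlonglongrightarrow> 0"
        using tendsto_mult_left[OF l(2), of A] by simp
    qed (use A(2) nonneg d s l(1) in auto)
    then show ?thesis using l(1) by blast
  qed
  then have "complete_norm (M\<lparr>mnorm := n\<rparr>) n"
    unfolding complete_norm_def using nonneg zero tri by auto
  then show ?thesis
    using K banach_moduleD(1)[OF M] unfolding banach_module_iff by auto
qed

lemma Ban_Mor_equivalent_norm_cod:
  assumes "equivalent_norm M n"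
  shows "Mor (Ban R) X (M\<lparr>mnorm := n\<rparr>) = Mor (Ban R) X M"
proof -
  obtain A where A: "A > 0" "\<And>x. x \<in> carrier M \<Longrightarrow> n x \<le> A * mnorm M x"
    "\<And>x. x \<in> carrier M \<Longrightarrow> mnorm M x \<le> A * n x"
    using assms unfolding equivalent_norm_def by blast
  have "(\<exists>C. \<forall>x\<in>carrier X. n (f x) \<le> C * mnorm X x) \<longleftrightarrow>
      (\<exists>C. \<forall>x\<in>carrier X. mnorm M (f x) \<le> C * mnorm X x)"
    if f: "f \<in> carrier X \<rightarrow> carrier M" for f
  proof (intro iffI; elim exE)
    fix C assume C: "\<forall>x\<in>carrier X. n (f x) \<le> C * mnorm X x"
    have "mnorm M (f x) \<le> (A * C) * mnorm X x" if "x \<in> carrier X" for x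
    proof -
      have "mnorm M (f x) \<le> A * n (f x)" using f that by (intro A(3)) auto
      also have "\<dots> \<le> A * (C * mnorm X x)" using C that A(1) by (intro mult_left_mono) auto
      finally show ?thesis by (simp add: mult.assoc)
    qed
    then show "\<exists>C. \<forall>x\<in>carrier X. mnorm M (f x) \<le> C * mnorm X x" by blast
  next
    fix C assume C: "\<forall>x\<in>carrier X. mnorm M (f x) \<le> C * mnorm X x"
    have "n (f x) \<le> (A * C) * mnorm X x" if "x \<in> carrier X" for x
    proof -
      have "n (f x) \<le> A * mnorm M (f x)" using f that by (intro A(2)) auto
      also have "\<dots> \<le> A * (C * mnorm X x)" using C that A(1) by (intro mult_left_mono) auto
      finally show ?thesis by (simp add: mult.assoc)
    qed
    then show "\<exists>C. \<forall>x\<in>carrier X. n (f x) \<le> C * mnorm X x" by blast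
  qed
  then show ?thesis by (auto simp: Ban_Mor_iff PiE_iff set_eq_iff Pi_iff)
qed

lemma Ban_Mor_equivalent_norm_dom:
  assumes n: "equivalent_norm M n" and M: "banach_module R M" "banach_module R (M\<lparr>mnorm := n\<rparr>)"
  shows "Mor (Ban R) (M\<lparr>mnorm := n\<rparr>) X = Mor (Ban R) M X"
proof -
  obtain A where A: "A > 0" "\<And>x. x \<in> carrier M \<Longrightarrow> n x \<le> A * mnorm M x"
    "\<And>x. x \<in> carrier M \<Longrightarrow> mnorm M x \<le> A * n x"
    using n unfolding equivalent_norm_def by blast
  have le: "C * p \<le> (\<bar>C\<bar> * A) * q" if "p \<le> A * q" "0 \<le> p" for C p q :: real
  proof -
    have "C * p \<le> \<bar>C\<bar> * p" using that(2) by (intro mult_right_mono) auto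
    also have "\<dots> \<le> \<bar>C\<bar> * (A * q)" using that(1) by (intro mult_left_mono) auto
    finally show ?thesis by (simp add: mult.assoc)
  qed
  have "(\<exists>C. \<forall>x\<in>carrier M. mnorm X (f x) \<le> C * n x) \<longleftrightarrow>
      (\<exists>C. \<forall>x\<in>carrier M. mnorm X (f x) \<le> C * mnorm M x)" for f
  proof (intro iffI; elim exE)
    fix C assume C: "\<forall>x\<in>carrier M. mnorm X (f x) \<le> C * n x"
    have "mnorm X (f x) \<le> (\<bar>C\<bar> * A) * mnorm M x" if "x \<in> carrier M" for x
    proof -
      have "0 \<le> n x" using banach_moduleD(5)[OF M(2), of x] that by simp
      from le[OF A(2)[OF that] this, of C] C that show ?thesis by (meson order_trans)
    qed
    then show "\<exists>C. \<forall>x\<in>carrier M. mnorm X (f x) \<le> C * mnorm M x" by blast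
  next
    fix C assume C: "\<forall>x\<in>carrier M. mnorm X (f x) \<le> C * mnorm M x"
    have "mnorm X (f x) \<le> (\<bar>C\<bar> * A) * n x" if "x \<in> carrier M" for x
    proof -
      have "0 \<le> mnorm M x" using banach_moduleD(5)[OF M(1) that] .
      from le[OF A(3)[OF that] this, of C] C that show ?thesis by (meson order_trans)
    qed
    then show "\<exists>C. \<forall>x\<in>carrier M. mnorm X (f x) \<le> C * n x" by blast
  qed
  then show ?thesis by (auto simp: Ban_Mor_iff set_eq_iff)
qed

lemma rescale_simps [simp]:
  "carrier (rescale r M) = carrier M"
  "\<zero>\<^bsub>rescale r M\<^esub> = \<zero>\<^bsub>M\<^esub>"
  "x \<oplus>\<^bsub>rescale r M\<^esub> y = x \<oplus>\<^bsub>M\<^esub> y"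
  "a \<odot>\<^bsub>rescale r M\<^esub> x = a \<odot>\<^bsub>M\<^esub> x"
  "mnorm (rescale r M) x = r * mnorm M x"
  by (simp_all add: rescale_def)

lemma equivalent_norm_rescale:
  assumes "r > 0" "banach_module R M"
  shows "equivalent_norm M (\<lambda>x. r * mnorm M x)"
proof -
  have "r * mnorm M x \<le> (r + inverse r) * mnorm M x" "mnorm M x \<le> (r + inverse r) * (r * mnorm M x)"
    if "x \<in> carrier M" for x
    using banach_moduleD(5)[OF assms(2) that] assms(1) by (auto simp: field_simps)
  moreover have "r + inverse r > 0" using assms(1) by (simp add: add_pos_pos)
  ultimately show ?thesis unfolding equivalent_norm_def by blast
qed

lemma smult_bound_rescale:
  assumes "r > 0" "smult_bound R M K"
  shows "smult_bound R (rescale r M) K"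
  unfolding smult_bound_def
proof (intro conjI ballI)
  show "K > 0" using assms(2) by (simp add: smult_bound_def)
  fix a x assume "a \<in> carrier R" "x \<in> carrier (rescale r M)"
  then have "mnorm M (a \<odot>\<^bsub>M\<^esub> x) \<le> K * rnorm R a * mnorm M x"
    using assms(2) by (simp add: smult_bound_def)
  from mult_left_mono[OF this, of r] assms(1)
  show "mnorm (rescale r M) (a \<odot>\<^bsub>rescale r M\<^esub> x) \<le> K * rnorm R a * mnorm (rescale r M) x"
    by (simp add: mult_ac)
qed

lemma banach_module_rescale:
  assumes "r > 0" "banach_module R M"
  shows "banach_module R (rescale r M)"
proof -
  obtain K where "smult_bound R M K" using assms(2) by (auto simp: banach_module_iff)
  then have "smult_bound R (rescale r M) K" using assms by (intro smult_bound_rescale)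
  then show ?thesis
    unfolding rescale_def
    using assms equivalent_norm_rescale[OF assms] banach_moduleD(12)[OF assms(2)]
    by (intro banach_module_equivalent_norm[where K = K])
       (auto simp flip: distrib_left intro: mult_left_mono)
qed

lemma Ban_Mor_rescale:
  assumes "r > 0" "banach_module R M"
  shows "Mor (Ban R) X (rescale r M) = Mor (Ban R) X M"
    and "Mor (Ban R) (rescale r M) X = Mor (Ban R) M X"
  using assms banach_module_rescale[OF assms] unfolding rescale_def
  by (auto simp: Ban_Mor_equivalent_norm_cod[OF equivalent_norm_rescale[OF assms]]
    Ban_Mor_equivalent_norm_dom[OF equivalent_norm_rescale[OF assms]])

text \<open>
  The equivalent norm \<open>max \<parallel>x\<parallel> (sup\<^sub>a \<parallel>a x\<parallel> / \<bar>a\<bar>)\<close>, whose scalar multiplication constant depends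
  on the ring only; at \<open>a = 0\<close> the quotient is \<open>0\<close>.
\<close>

definition uniform_norm :: "'r normed_ring \<Rightarrow> ('r, 'u) normed_module \<Rightarrow> 'u \<Rightarrow> real" where
  "uniform_norm R M x = max (mnorm M x) (SUP a\<in>carrier R. mnorm M (a \<odot>\<^bsub>M\<^esub> x) / rnorm R a)"

context
  fixes R :: "'r normed_ring" and M :: "('r, 'u) normed_module"
  assumes R: "banach_ring R" and M: "banach_module R M"
begin

lemma uniform_norm_bdd:
  assumes "smult_bound R M K" "x \<in> carrier M" "a \<in> carrier R"
  shows "mnorm M (a \<odot>\<^bsub>M\<^esub> x) / rnorm R a \<le> K * mnorm M x"
proof (cases "rnorm R a = 0")
  case True
  then show ?thesis using assms banach_moduleD(5)[OF M assms(2)] by (simp add: smult_bound_def)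
next
  case False
  then have "rnorm R a > 0" using banach_ringD(2)[OF R assms(3)] by simp
  then show ?thesis using assms by (simp add: smult_bound_def divide_le_eq mult_ac)
qed

lemma uniform_norm_bdd_above:
  assumes "x \<in> carrier M"
  shows "bdd_above ((\<lambda>a. mnorm M (a \<odot>\<^bsub>M\<^esub> x) / rnorm R a) ` carrier R)"
  using M uniform_norm_bdd[OF _ assms] unfolding banach_module_iff by (meson bdd_aboveI2)

lemma uniform_norm_ge:
  assumes "x \<in> carrier M"
  shows "mnorm M x \<le> uniform_norm R M x"
    and "a \<in> carrier R \<Longrightarrow> mnorm M (a \<odot>\<^bsub>M\<^esub> x) \<le> rnorm R a * uniform_norm R M x"
proof -
  show "mnorm M x \<le> uniform_norm R M x" by (simp add: uniform_norm_def)
  assume a: "a \<in> carrier R"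
  interpret module R M using banach_moduleD(1)[OF M] .
  have "mnorm M (a \<odot>\<^bsub>M\<^esub> x) / rnorm R a \<le> uniform_norm R M x"
    unfolding uniform_norm_def
    by (rule max.coboundedI2, rule cSUP_upper[OF a uniform_norm_bdd_above[OF assms]])
  moreover have "mnorm M (a \<odot>\<^bsub>M\<^esub> x) = 0" if "rnorm R a = 0"
    using that banach_ringD(3)[OF R a] banach_moduleD(7)[OF M] assms by simp
  ultimately show "mnorm M (a \<odot>\<^bsub>M\<^esub> x) \<le> rnorm R a * uniform_norm R M x"
    using banach_ringD(2)[OF R a] by (cases "rnorm R a = 0") (simp_all add: divide_le_eq mult.commute)
qed

lemma uniform_norm_le:
  assumes "mnorm M x \<le> B" "0 \<le> B"
    "\<And>a. a \<in> carrier R \<Longrightarrow> rnorm R a > 0 \<Longrightarrow> mnorm M (a \<odot>\<^bsub>M\<^esub> x) \<le> rnorm R a * B"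
  shows "uniform_norm R M x \<le> B"
  unfolding uniform_norm_def
proof (rule max.boundedI[OF assms(1)], rule cSUP_least)
  interpret module R M using banach_moduleD(1)[OF M] .
  show "carrier R \<noteq> {}" using R.zero_closed by blast
  fix a assume a: "a \<in> carrier R"
  show "mnorm M (a \<odot>\<^bsub>M\<^esub> x) / rnorm R a \<le> B"
    using assms(2) assms(3)[OF a] banach_ringD(2)[OF R a]
    by (cases "rnorm R a = 0") (auto simp: divide_le_eq mult.commute)
qed

lemma equivalent_norm_uniform: "equivalent_norm M (uniform_norm R M)"
proof -
  obtain K where K: "smult_bound R M K" using M by (auto simp: banach_module_iff)
  have K0: "K > 0" using K by (simp add: smult_bound_def)
  have "uniform_norm R M x \<le> max 1 K * mnorm M x \<and> mnorm M x \<le> max 1 K * uniform_norm R M x"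
    if x: "x \<in> carrier M" for x
  proof
    note x0 = banach_moduleD(5)[OF M x]
    show "uniform_norm R M x \<le> max 1 K * mnorm M x"
    proof (rule uniform_norm_le)
      show "mnorm M x \<le> max 1 K * mnorm M x" using mult_right_mono[OF _ x0, of 1 "max 1 K"] by simp
      show "0 \<le> max 1 K * mnorm M x" using x0 by simp
      fix a assume a: "a \<in> carrier R" "rnorm R a > 0"
      have "mnorm M (a \<odot>\<^bsub>M\<^esub> x) \<le> K * rnorm R a * mnorm M x" using K a x by (simp add: smult_bound_def)
      also have "\<dots> \<le> max 1 K * rnorm R a * mnorm M x"
        using a x0 by (intro mult_right_mono) auto
      finally show "mnorm M (a \<odot>\<^bsub>M\<^esub> x) \<le> rnorm R a * (max 1 K * mnorm M x)" by (simp add: mult_ac)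
    qed
    have "0 \<le> uniform_norm R M x" using uniform_norm_ge(1)[OF x] x0 by simp
    then show "mnorm M x \<le> max 1 K * uniform_norm R M x"
      using uniform_norm_ge(1)[OF x] mult_right_mono[of 1 "max 1 K" "uniform_norm R M x"] by simp
  qed
  then show ?thesis unfolding equivalent_norm_def by (intro exI[of _ "max 1 K"]) auto
qed

lemma smult_bound_uniform:
  assumes C: "C > 0" "\<And>a b. a \<in> carrier R \<Longrightarrow> b \<in> carrier R \<Longrightarrow>
    rnorm R (a \<otimes>\<^bsub>R\<^esub> b) \<le> C * rnorm R a * rnorm R b"
  shows "smult_bound R (M\<lparr>mnorm := uniform_norm R M\<rparr>) (max 1 C)"
proof -
  interpret module R M using banach_moduleD(1)[OF M] .
  have "uniform_norm R M (b \<odot>\<^bsub>M\<^esub> x) \<le> max 1 C * rnorm R b * uniform_norm R M x"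
    if b: "b \<in> carrier R" and x: "x \<in> carrier M" for b x
  proof (rule uniform_norm_le)
    note b0 = banach_ringD(2)[OF R b]
    have u0: "0 \<le> uniform_norm R M x" using uniform_norm_ge(1)[OF x] banach_moduleD(5)[OF M x] by simp
    have bu: "0 \<le> rnorm R b * uniform_norm R M x" using b0 u0 by simp
    have "mnorm M (b \<odot>\<^bsub>M\<^esub> x) \<le> 1 * (rnorm R b * uniform_norm R M x)"
      using uniform_norm_ge(2)[OF x b] by simp
    also have "\<dots> \<le> max 1 C * (rnorm R b * uniform_norm R M x)"
      using bu by (intro mult_right_mono) auto
    finally show "mnorm M (b \<odot>\<^bsub>M\<^esub> x) \<le> max 1 C * rnorm R b * uniform_norm R M x"
      by (simp add: mult.assoc)
    show "0 \<le> max 1 C * rnorm R b * uniform_norm R M x" using b0 u0 by simp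
    fix a assume a: "a \<in> carrier R" "rnorm R a > 0"
    have "mnorm M (a \<odot>\<^bsub>M\<^esub> (b \<odot>\<^bsub>M\<^esub> x)) = mnorm M ((a \<otimes>\<^bsub>R\<^esub> b) \<odot>\<^bsub>M\<^esub> x)"
      using a b x by (simp add: smult_assoc1)
    also have "\<dots> \<le> rnorm R (a \<otimes>\<^bsub>R\<^esub> b) * uniform_norm R M x"
      using a b x by (intro uniform_norm_ge(2)) auto
    also have "\<dots> \<le> (max 1 C * rnorm R a * rnorm R b) * uniform_norm R M x"
    proof (rule mult_right_mono[OF order_trans[OF C(2)[OF a(1) b]] u0])
      show "C * rnorm R a * rnorm R b \<le> max 1 C * rnorm R a * rnorm R b"
        using a b0 by (intro mult_right_mono) auto
    qed
    finally show "mnorm M (a \<odot>\<^bsub>M\<^esub> (b \<odot>\<^bsub>M\<^esub> x)) \<le>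
        rnorm R a * (max 1 C * rnorm R b * uniform_norm R M x)"
      by (simp add: mult_ac)
  qed
  then show ?thesis using C(1) by (simp add: smult_bound_def)
qed

lemma uniform_norm_triangle:
  assumes x: "x \<in> carrier M" and y: "y \<in> carrier M"
  shows "uniform_norm R M (x \<oplus>\<^bsub>M\<^esub> y) \<le> uniform_norm R M x + uniform_norm R M y"
proof (rule uniform_norm_le)
  interpret module R M using banach_moduleD(1)[OF M] .
  note u = uniform_norm_ge[OF x] uniform_norm_ge[OF y]
  show "mnorm M (x \<oplus>\<^bsub>M\<^esub> y) \<le> uniform_norm R M x + uniform_norm R M y"
    using banach_moduleD(12)[OF M x y] u by linarith
  show "0 \<le> uniform_norm R M x + uniform_norm R M y"
    using u banach_moduleD(5)[OF M x] banach_moduleD(5)[OF M y] by linarith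
  fix a assume a: "a \<in> carrier R" "rnorm R a > 0"
  have "mnorm M (a \<odot>\<^bsub>M\<^esub> (x \<oplus>\<^bsub>M\<^esub> y)) \<le> mnorm M (a \<odot>\<^bsub>M\<^esub> x) + mnorm M (a \<odot>\<^bsub>M\<^esub> y)"
    using banach_moduleD(12)[OF M, of "a \<odot>\<^bsub>M\<^esub> x" "a \<odot>\<^bsub>M\<^esub> y"] a x y by (simp add: smult_r_distr)
  then show "mnorm M (a \<odot>\<^bsub>M\<^esub> (x \<oplus>\<^bsub>M\<^esub> y)) \<le> rnorm R a * (uniform_norm R M x + uniform_norm R M y)"
    using u(2)[OF a(1)] u(4)[OF a(1)] by (simp add: distrib_left)
qed

end

lemma banach_module_uniform:
  assumes "banach_ring R" "banach_module R M"
  shows "banach_module R (M\<lparr>mnorm := uniform_norm R M\<rparr>)"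
proof -
  obtain C where C: "C > 0" "\<And>a b. a \<in> carrier R \<Longrightarrow> b \<in> carrier R \<Longrightarrow>
      rnorm R (a \<otimes>\<^bsub>R\<^esub> b) \<le> C * rnorm R a * rnorm R b"
    using assms(1) by (auto simp: banach_ring_def)
  show ?thesis
    by (rule banach_module_equivalent_norm[OF assms(2) equivalent_norm_uniform[OF assms]
      uniform_norm_triangle[OF assms] smult_bound_uniform[OF assms C]])
qed

text \<open>Every family of Banach modules can be renormed to have a common scalar multiplication constant.\<close>

lemma uniform_renorming:
  assumes "banach_ring R"
  obtains K where "\<And>M :: ('r, 'u) normed_module. banach_module R M \<Longrightarrow>
      equivalent_norm M (uniform_norm R M) \<and>
      banach_module R (M\<lparr>mnorm := uniform_norm R M\<rparr>) \<and>
      smult_bound R (M\<lparr>mnorm := uniform_norm R M\<rparr>) K"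
proof -
  obtain C where C: "C > 0" "\<And>a b. a \<in> carrier R \<Longrightarrow> b \<in> carrier R \<Longrightarrow>
      rnorm R (a \<otimes>\<^bsub>R\<^esub> b) \<le> C * rnorm R a * rnorm R b"
    using assms by (auto simp: banach_ring_def)
  show ?thesis
    by (rule that[of "max 1 C"])
      (use assms equivalent_norm_uniform banach_module_uniform smult_bound_uniform[OF _ _ C] in blast)
qed


section \<open>Modules of bounded compatible families\<close>

lemma ban_prod_simps [simp]:
  "\<zero>\<^bsub>ban_prod I W\<^esub> = utuple (\<lambda>i\<in>I. \<zero>\<^bsub>W i\<^esub>)"
  "s \<oplus>\<^bsub>ban_prod I W\<^esub> t = utuple (\<lambda>i\<in>I. uproj s i \<oplus>\<^bsub>W i\<^esub> uproj t i)"
  "a \<odot>\<^bsub>ban_prod I W\<^esub> t = utuple (\<lambda>i\<in>I. a \<odot>\<^bsub>W i\<^esub> uproj t i)"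
  by (simp_all add: ban_prod_def)

lemma ban_prod_carrierD:
  assumes "t \<in> carrier (ban_prod I W)"
  shows "i \<in> I \<Longrightarrow> uproj t i \<in> carrier (W i)"
    "i \<in> I \<Longrightarrow> mnorm (W i) (uproj t i) \<le> mnorm (ban_prod I W) t"
    "t = utuple (\<lambda>i\<in>I. uproj t i)"
proof -
  obtain v where t: "t = utuple v" and v: "v \<in> (\<Pi>\<^sub>E i\<in>I. carrier (W i))"
    "bdd_above ((\<lambda>i. mnorm (W i) (v i)) ` I)"
    using assms by (auto simp: ban_prod_def)
  show "i \<in> I \<Longrightarrow> uproj t i \<in> carrier (W i)" using v by (auto simp: t)
  show "i \<in> I \<Longrightarrow> mnorm (W i) (uproj t i) \<le> mnorm (ban_prod I W) t"
    using cSUP_upper[OF _ v(2)] by (simp add: ban_prod_def t)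
  show "t = utuple (\<lambda>i\<in>I. uproj t i)" using v(1) by (simp add: t PiE_restrict)
qed

lemma ban_prod_eqI:
  assumes "s \<in> carrier (ban_prod I W)" "t \<in> carrier (ban_prod I W)"
    "\<And>i. i \<in> I \<Longrightarrow> uproj s i = uproj t i"
  shows "s = t"
  using ban_prod_carrierD(3)[OF assms(1)] ban_prod_carrierD(3)[OF assms(2)] assms(3)
  by (metis (mono_tags, lifting) restrict_ext)

lemma ban_prod_carrierI:
  assumes "\<And>i. i \<in> I \<Longrightarrow> w i \<in> carrier (W i)" "\<And>i. i \<in> I \<Longrightarrow> mnorm (W i) (w i) \<le> B"
  shows "utuple (\<lambda>i\<in>I. w i) \<in> carrier (ban_prod I W)"
proof -
  have "bdd_above ((\<lambda>i. mnorm (W i) (restrict w I i)) ` I)"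
    using assms(2) by (intro bdd_aboveI2[of _ _ B]) simp
  then show ?thesis using assms(1) by (auto simp: ban_prod_def)
qed

lemma ban_prod_norm_le:
  assumes "I \<noteq> {}" "\<And>i. i \<in> I \<Longrightarrow> mnorm (W i) (uproj t i) \<le> B"
  shows "mnorm (ban_prod I W) t \<le> B"
  unfolding ban_prod_def using assms by (simp add: cSUP_least)

text \<open>
  The submodule of \<open>ban_prod I W\<close> of the families \<open>t\<close> with \<open>g t\<^sub>i = t\<^sub>j\<close> for all \<open>(i, j, g) \<in> E\<close>.
\<close>

definition compat_module ::
    "nat set \<Rightarrow> (nat \<Rightarrow> ('r, 'u::universe) normed_module) \<Rightarrow> (nat \<times> nat \<times> ('u \<Rightarrow> 'u)) set \<Rightarrow>
     ('r, 'u) normed_module" where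
  "compat_module I W E = (ban_prod I W)\<lparr>carrier :=
     {t \<in> carrier (ban_prod I W). \<forall>(i, j, g)\<in>E. g (uproj t i) = uproj t j}\<rparr>"

lemma compat_module_simps [simp]:
  "\<zero>\<^bsub>compat_module I W E\<^esub> = utuple (\<lambda>i\<in>I. \<zero>\<^bsub>W i\<^esub>)"
  "s \<oplus>\<^bsub>compat_module I W E\<^esub> t = utuple (\<lambda>i\<in>I. uproj s i \<oplus>\<^bsub>W i\<^esub> uproj t i)"
  "a \<odot>\<^bsub>compat_module I W E\<^esub> t = utuple (\<lambda>i\<in>I. a \<odot>\<^bsub>W i\<^esub> uproj t i)"
  "mnorm (compat_module I W E) t = mnorm (ban_prod I W) t"
  by (simp_all add: compat_module_def ban_prod_def)

lemma compat_module_carrier: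
  "t \<in> carrier (compat_module I W E) \<longleftrightarrow>
     t \<in> carrier (ban_prod I W) \<and> (\<forall>i j g. (i, j, g) \<in> E \<longrightarrow> g (uproj t i) = uproj t j)"
  by (auto simp: compat_module_def)

text \<open>
  A nonempty family of Banach modules with a common scalar multiplication constant \<open>K\<close>, and a set \<open>E\<close>
  of bounded linear maps between its members.
\<close>

locale compat_setting =
  fixes R :: "'r normed_ring" and I :: "nat set" and W :: "nat \<Rightarrow> ('r, 'u::universe) normed_module"
    and E :: "(nat \<times> nat \<times> ('u \<Rightarrow> 'u)) set" and K :: real
  assumes I: "I \<noteq> {}"
    and W: "i \<in> I \<Longrightarrow> banach_module R (W i)"
    and K: "i \<in> I \<Longrightarrow> smult_bound R (W i) K"
    and E: "(i, j, g) \<in> E \<Longrightarrow> i \<in> I \<and> j \<in> I \<and> g \<in> Mor (Ban R) (W i) (W j)"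
begin

abbreviation "Y \<equiv> compat_module I W E"

lemma carrierD:
  assumes "t \<in> carrier Y"
  shows "i \<in> I \<Longrightarrow> uproj t i \<in> carrier (W i)"
    "i \<in> I \<Longrightarrow> mnorm (W i) (uproj t i) \<le> mnorm Y t"
    "(i, j, g) \<in> E \<Longrightarrow> g (uproj t i) = uproj t j"
  using assms ban_prod_carrierD[of t I W] by (auto simp: compat_module_carrier)

lemma carrierI:
  assumes "\<And>i. i \<in> I \<Longrightarrow> w i \<in> carrier (W i)" "\<And>i. i \<in> I \<Longrightarrow> mnorm (W i) (w i) \<le> B"
    "\<And>i j g. (i, j, g) \<in> E \<Longrightarrow> g (w i) = w j"
  shows "utuple (\<lambda>i\<in>I. w i) \<in> carrier Y"
  using assms E ban_prod_carrierI[of I w W B] by (simp add: compat_module_carrier)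

lemma eqI:
  "s \<in> carrier Y \<Longrightarrow> t \<in> carrier Y \<Longrightarrow> (\<And>i. i \<in> I \<Longrightarrow> uproj s i = uproj t i) \<Longrightarrow> s = t"
  by (rule ban_prod_eqI) (auto simp: compat_module_carrier)

lemma norm_le: "(\<And>i. i \<in> I \<Longrightarrow> mnorm (W i) (uproj t i) \<le> B) \<Longrightarrow> mnorm Y t \<le> B"
  using ban_prod_norm_le[OF I, of W t B] by simp

lemma E_linear:
  assumes "(i, j, g) \<in> E" "x \<in> carrier (W i)"
  shows "y \<in> carrier (W i) \<Longrightarrow> g (x \<oplus>\<^bsub>W i\<^esub> y) = g x \<oplus>\<^bsub>W j\<^esub> g y"
    "y \<in> carrier (W i) \<Longrightarrow> g (x \<ominus>\<^bsub>W i\<^esub> y) = g x \<ominus>\<^bsub>W j\<^esub> g y"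
    "a \<in> carrier R \<Longrightarrow> g (a \<odot>\<^bsub>W i\<^esub> x) = a \<odot>\<^bsub>W j\<^esub> g x"
    "g x \<in> carrier (W j)" "g \<zero>\<^bsub>W i\<^esub> = \<zero>\<^bsub>W j\<^esub>" "g (\<ominus>\<^bsub>W i\<^esub> x) = \<ominus>\<^bsub>W j\<^esub> g x"
proof -
  have ij: "i \<in> I" "j \<in> I" and g: "g \<in> Mor (Ban R) (W i) (W j)" using E[OF assms(1)] by auto
  note Wi = W[OF ij(1)] and Wj = W[OF ij(2)]
  interpret i: abelian_group "W i" using banach_moduleD(2)[OF Wi] .
  interpret j: abelian_group "W j" using banach_moduleD(2)[OF Wj] .
  note minus = Ban_Mor_minus[OF Wi Wj g]
  have car: "g z \<in> carrier (W j)" if "z \<in> carrier (W i)" for z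
    using g that by (auto simp: Ban_Mor_iff)
  show "y \<in> carrier (W i) \<Longrightarrow> g (x \<oplus>\<^bsub>W i\<^esub> y) = g x \<oplus>\<^bsub>W j\<^esub> g y"
    "y \<in> carrier (W i) \<Longrightarrow> g (x \<ominus>\<^bsub>W i\<^esub> y) = g x \<ominus>\<^bsub>W j\<^esub> g y"
    "a \<in> carrier R \<Longrightarrow> g (a \<odot>\<^bsub>W i\<^esub> x) = a \<odot>\<^bsub>W j\<^esub> g x"  "g x \<in> carrier (W j)"
    using g assms minus by (auto simp: Ban_Mor_iff)
  show z: "g \<zero>\<^bsub>W i\<^esub> = \<zero>\<^bsub>W j\<^esub>"
    using minus[OF i.zero_closed i.zero_closed] car[OF i.zero_closed]
    by (metis i.minus_eq i.r_neg i.zero_closed j.minus_eq j.r_neg)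
  show "g (\<ominus>\<^bsub>W i\<^esub> x) = \<ominus>\<^bsub>W j\<^esub> g x"
    using minus[OF i.zero_closed assms(2)] z car assms(2) by (simp add: a_minus_def)
qed

lemma add_closed: "s \<in> carrier Y \<Longrightarrow> t \<in> carrier Y \<Longrightarrow> s \<oplus>\<^bsub>Y\<^esub> t \<in> carrier Y"
  unfolding compat_module_simps
proof (rule carrierI[where B = "mnorm Y s + mnorm Y t"])
  assume s: "s \<in> carrier Y" and t: "t \<in> carrier Y"
  note d = carrierD[OF s] carrierD[OF t]
  fix i assume i: "i \<in> I"
  show "uproj s i \<oplus>\<^bsub>W i\<^esub> uproj t i \<in> carrier (W i)" using banach_moduleD(8)[OF W[OF i]] d i by blast
  show "mnorm (W i) (uproj s i \<oplus>\<^bsub>W i\<^esub> uproj t i) \<le> mnorm Y s + mnorm Y t"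
    using banach_moduleD(12)[OF W[OF i], of "uproj s i" "uproj t i"] d[of i] i by fastforce
next
  fix i j g assume "s \<in> carrier Y" "t \<in> carrier Y" and g: "(i, j, g) \<in> E"
  then show "g (uproj s i \<oplus>\<^bsub>W i\<^esub> uproj t i) = uproj s j \<oplus>\<^bsub>W j\<^esub> uproj t j"
    using E[OF g] E_linear(1)[OF g] carrierD by auto
qed

lemma smult_closed:
  assumes a: "a \<in> carrier R" "rnorm R a \<ge> 0" and t: "t \<in> carrier Y"
  shows "a \<odot>\<^bsub>Y\<^esub> t \<in> carrier Y" "mnorm Y (a \<odot>\<^bsub>Y\<^esub> t) \<le> K * rnorm R a * mnorm Y t"
proof -
  note d = carrierD[OF t]
  have le: "mnorm (W i) (a \<odot>\<^bsub>W i\<^esub> uproj t i) \<le> K * rnorm R a * mnorm Y t" if i: "i \<in> I" for i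
  proof -
    have "mnorm (W i) (a \<odot>\<^bsub>W i\<^esub> uproj t i) \<le> K * rnorm R a * mnorm (W i) (uproj t i)"
      using K[OF i] a d(1)[OF i] by (simp add: smult_bound_def)
    also have "\<dots> \<le> K * rnorm R a * mnorm Y t"
      using K[OF i] a d(2)[OF i] by (intro mult_left_mono) (auto simp: smult_bound_def)
    finally show ?thesis .
  qed
  show "a \<odot>\<^bsub>Y\<^esub> t \<in> carrier Y"
    unfolding compat_module_simps
  proof (rule carrierI[OF _ le])
    fix i assume i: "i \<in> I"
    show "a \<odot>\<^bsub>W i\<^esub> uproj t i \<in> carrier (W i)" using banach_moduleD(11)[OF W[OF i] a(1)] d i by blast
  next
    fix i j g assume g: "(i, j, g) \<in> E"
    show "g (a \<odot>\<^bsub>W i\<^esub> uproj t i) = a \<odot>\<^bsub>W j\<^esub> uproj t j"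
      using E[OF g] E_linear(3)[OF g _ a(1)] d(1) d(3)[OF g] by auto
  qed
  show "mnorm Y (a \<odot>\<^bsub>Y\<^esub> t) \<le> K * rnorm R a * mnorm Y t"
    by (rule norm_le) (use le in simp)
qed

lemma zero_closed: "\<zero>\<^bsub>Y\<^esub> \<in> carrier Y"
  unfolding compat_module_simps
proof (rule carrierI[where B = 0])
  show "i \<in> I \<Longrightarrow> \<zero>\<^bsub>W i\<^esub> \<in> carrier (W i)" "i \<in> I \<Longrightarrow> mnorm (W i) \<zero>\<^bsub>W i\<^esub> \<le> 0" for i
    using banach_moduleD(4,7)[OF W] by auto
  show "g \<zero>\<^bsub>W i\<^esub> = \<zero>\<^bsub>W j\<^esub>" if "(i, j, g) \<in> E" for i j g
    using E_linear(5)[OF that] E[OF that] banach_moduleD(4)[OF W] by blast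
qed

lemma uminus_mem:
  assumes R: "rnorm R (\<ominus>\<^bsub>R\<^esub> \<one>\<^bsub>R\<^esub>) \<ge> 0" and t: "t \<in> carrier Y"
  shows "utuple (\<lambda>i\<in>I. \<ominus>\<^bsub>W i\<^esub> uproj t i) \<in> carrier Y"
proof -
  note d = carrierD[OF t]
  show ?thesis
  proof (rule carrierI)
    fix i assume i: "i \<in> I"
    show "\<ominus>\<^bsub>W i\<^esub> uproj t i \<in> carrier (W i)" using banach_moduleD(10)[OF W[OF i]] d i by blast
    have "mnorm (W i) (\<ominus>\<^bsub>W i\<^esub> uproj t i) \<le>
        K * rnorm R (\<ominus>\<^bsub>R\<^esub> \<one>\<^bsub>R\<^esub>) * mnorm (W i) (uproj t i)"
      by (rule mnorm_uminus_le[OF W[OF i] K[OF i] d(1)[OF i]])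
    also have "\<dots> \<le> K * rnorm R (\<ominus>\<^bsub>R\<^esub> \<one>\<^bsub>R\<^esub>) * mnorm Y t"
      using d(2)[OF i] K[OF i] R by (intro mult_left_mono) (auto simp: smult_bound_def)
    finally show "mnorm (W i) (\<ominus>\<^bsub>W i\<^esub> uproj t i) \<le> K * rnorm R (\<ominus>\<^bsub>R\<^esub> \<one>\<^bsub>R\<^esub>) * mnorm Y t" .
  next
    fix i j g assume g: "(i, j, g) \<in> E"
    show "g (\<ominus>\<^bsub>W i\<^esub> uproj t i) = \<ominus>\<^bsub>W j\<^esub> uproj t j"
      using E[OF g] E_linear(6)[OF g] d(1) d(3)[OF g] by auto
  qed
qed

context
  assumes R: "banach_ring R"
begin

lemma neg_one: "rnorm R (\<ominus>\<^bsub>R\<^esub> \<one>\<^bsub>R\<^esub>) \<ge> 0"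
proof -
  interpret cring R using banach_ringD(1)[OF R] .
  show ?thesis by (rule banach_ringD(2)[OF R]) simp
qed

lemma abelian_group_compat: "abelian_group Y"
proof (rule abelian_groupI)
  show "s \<oplus>\<^bsub>Y\<^esub> t \<in> carrier Y" if "s \<in> carrier Y" "t \<in> carrier Y" for s t
    using add_closed[OF that] .
  show "\<zero>\<^bsub>Y\<^esub> \<in> carrier Y" using zero_closed .
  note g = abelian_groupE[OF banach_moduleD(2)[OF W]]
  fix x assume x: "x \<in> carrier Y"
  note dx = carrierD(1)[OF x]
  show "\<zero>\<^bsub>Y\<^esub> \<oplus>\<^bsub>Y\<^esub> x = x"
    by (rule eqI[OF add_closed[OF zero_closed x] x]) (use g dx in simp)
  show "\<exists>y\<in>carrier Y. y \<oplus>\<^bsub>Y\<^esub> x = \<zero>\<^bsub>Y\<^esub>"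
  proof
    show y: "utuple (\<lambda>i\<in>I. \<ominus>\<^bsub>W i\<^esub> uproj x i) \<in> carrier Y" using uminus_mem[OF neg_one x] .
    show "utuple (\<lambda>i\<in>I. \<ominus>\<^bsub>W i\<^esub> uproj x i) \<oplus>\<^bsub>Y\<^esub> x = \<zero>\<^bsub>Y\<^esub>"
      by (rule eqI[OF add_closed[OF y x] zero_closed])
        (use abelian_group.l_neg[OF banach_moduleD(2)[OF W]] dx in simp)
  qed
  fix y assume y: "y \<in> carrier Y"
  note dy = carrierD(1)[OF y]
  show "x \<oplus>\<^bsub>Y\<^esub> y = y \<oplus>\<^bsub>Y\<^esub> x"
    by (rule eqI[OF add_closed[OF x y] add_closed[OF y x]])
      (use dx dy g in simp)
  fix z assume z: "z \<in> carrier Y"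
  note dz = carrierD(1)[OF z]
  show "x \<oplus>\<^bsub>Y\<^esub> y \<oplus>\<^bsub>Y\<^esub> z = x \<oplus>\<^bsub>Y\<^esub> (y \<oplus>\<^bsub>Y\<^esub> z)"
    by (rule eqI[OF add_closed[OF add_closed[OF x y] z] add_closed[OF x add_closed[OF y z]]])
      (use dx dy dz g in simp)
qed

lemma module_compat: "module R Y"
proof (rule moduleI)
  show "cring R" using banach_ringD(1)[OF R] .
  show "abelian_group Y" by (rule abelian_group_compat)
  note sc = smult_closed(1)[OF _ banach_ringD(2)[OF R]]
  note ac = add_closed
  interpret cring R using banach_ringD(1)[OF R] .
  fix x assume x: "x \<in> carrier Y"
  note dx = carrierD(1)[OF x]
  note mW = banach_moduleD(1)[OF W]
  show "\<one>\<^bsub>R\<^esub> \<odot>\<^bsub>Y\<^esub> x = x"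
    by (rule eqI[OF sc[OF _ _ x] x]) (use module.smult_one[OF mW dx] in auto)
  fix a assume a: "a \<in> carrier R"
  show "a \<odot>\<^bsub>Y\<^esub> x \<in> carrier Y" using sc[OF a a x] .
  show "a \<odot>\<^bsub>Y\<^esub> (x \<oplus>\<^bsub>Y\<^esub> y) = a \<odot>\<^bsub>Y\<^esub> x \<oplus>\<^bsub>Y\<^esub> a \<odot>\<^bsub>Y\<^esub> y" if y: "y \<in> carrier Y" for y
    by (rule eqI[OF sc[OF a a ac[OF x y]] ac[OF sc[OF a a x] sc[OF a a y]]])
      (use module.smult_r_distr[OF mW a dx carrierD(1)[OF y]] in simp)
  fix b assume b: "b \<in> carrier R"
  show "(a \<oplus>\<^bsub>R\<^esub> b) \<odot>\<^bsub>Y\<^esub> x = a \<odot>\<^bsub>Y\<^esub> x \<oplus>\<^bsub>Y\<^esub> b \<odot>\<^bsub>Y\<^esub> x"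
    by (rule eqI[OF sc[OF _ _ x] ac[OF sc[OF a a x] sc[OF b b x]]])
      (use a b module.smult_l_distr[OF mW a b dx] in simp_all)
  show "(a \<otimes>\<^bsub>R\<^esub> b) \<odot>\<^bsub>Y\<^esub> x = a \<odot>\<^bsub>Y\<^esub> (b \<odot>\<^bsub>Y\<^esub> x)"
    by (rule eqI[OF sc[OF _ _ x] sc[OF a a sc[OF b b x]]])
      (use a b module.smult_assoc1[OF mW a b dx] in simp_all)
qed

lemma uproj_minus:
  assumes s: "s \<in> carrier Y" and t: "t \<in> carrier Y" and i: "i \<in> I"
  shows "uproj (s \<ominus>\<^bsub>Y\<^esub> t) i = uproj s i \<ominus>\<^bsub>W i\<^esub> uproj t i"
proof -
  interpret Y: abelian_group Y by (rule abelian_group_compat)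
  interpret Wi: abelian_group "W i" using banach_moduleD(2)[OF W[OF i]] .
  note d = carrierD(1)[OF s i] carrierD(1)[OF t i] carrierD(1)[OF Y.minus_closed[OF s t] i]
  have "(s \<ominus>\<^bsub>Y\<^esub> t) \<oplus>\<^bsub>Y\<^esub> t = s" using s t by (simp only: a_minus_def Y.a_assoc Y.a_inv_closed Y.l_neg Y.r_zero)
  then have "uproj ((s \<ominus>\<^bsub>Y\<^esub> t) \<oplus>\<^bsub>Y\<^esub> t) i = uproj s i" by simp
  then have "uproj (s \<ominus>\<^bsub>Y\<^esub> t) i \<oplus>\<^bsub>W i\<^esub> uproj t i = uproj s i" using i by simp
  then show ?thesis using d by (metis Wi.a_assoc Wi.a_inv_closed Wi.minus_eq Wi.r_neg Wi.r_zero)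
qed

lemma complete_compat:
  assumes s: "\<And>n. s n \<in> carrier Y"
    and cau: "\<And>e. e > 0 \<Longrightarrow> \<exists>N. \<forall>m\<ge>N. \<forall>n\<ge>N. mnorm Y (s m \<ominus>\<^bsub>Y\<^esub> s n) < e"
  shows "\<exists>l\<in>carrier Y. (\<lambda>n. mnorm Y (s n \<ominus>\<^bsub>Y\<^esub> l)) \<longlonglongrightarrow> 0"
proof -
  interpret Y: abelian_group Y by (rule abelian_group_compat)
  note d = carrierD(1)[OF s]
  have diff: "mnorm (W i) (uproj (s m) i \<ominus>\<^bsub>W i\<^esub> uproj (s n) i) \<le> mnorm Y (s m \<ominus>\<^bsub>Y\<^esub> s n)"
    if "i \<in> I" for i m n
    using carrierD(2)[OF Y.minus_closed[OF s s] that, of m n] uproj_minus[OF s s that] by simp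
  have "\<exists>l. \<forall>i\<in>I. l i \<in> carrier (W i) \<and>
      (\<lambda>n. mnorm (W i) (uproj (s n) i \<ominus>\<^bsub>W i\<^esub> l i)) \<longlonglongrightarrow> 0"
  proof (rule bchoice, rule ballI)
    fix i assume i: "i \<in> I"
    have "\<exists>l\<in>carrier (W i). (\<lambda>n. mnorm (W i) (uproj (s n) i \<ominus>\<^bsub>W i\<^esub> l)) \<longlonglongrightarrow> 0"
    proof (rule banach_module_complete[OF W[OF i] d[OF i]])
      fix e :: real assume "e > 0"
      then show "\<exists>N. \<forall>m\<ge>N. \<forall>n\<ge>N. mnorm (W i) (uproj (s m) i \<ominus>\<^bsub>W i\<^esub> uproj (s n) i) < e"
        using cau diff[OF i] by (meson le_less_trans)
    qed
    then show "\<exists>l. l \<in> carrier (W i) \<and>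
      (\<lambda>n. mnorm (W i) (uproj (s n) i \<ominus>\<^bsub>W i\<^esub> l)) \<longlonglongrightarrow> 0" by blast
  qed
  then obtain l where l: "\<And>i. i \<in> I \<Longrightarrow> l i \<in> carrier (W i)"
    and lim: "\<And>i. i \<in> I \<Longrightarrow> (\<lambda>n. mnorm (W i) (uproj (s n) i \<ominus>\<^bsub>W i\<^esub> l i)) \<longlonglongrightarrow> 0"
    by blast
  \<comment> \<open>The convergence of the components is uniform.\<close>
  have unif: "mnorm (W i) (uproj (s n) i \<ominus>\<^bsub>W i\<^esub> l i) \<le> e"
    if N: "\<And>m n. m \<ge> N \<Longrightarrow> n \<ge> N \<Longrightarrow> mnorm Y (s m \<ominus>\<^bsub>Y\<^esub> s n) < e" and i: "i \<in> I" and n: "n \<ge> N"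
    for N e i n
  proof (rule Lim_bounded2)
    show "(\<lambda>m. e + mnorm (W i) (uproj (s m) i \<ominus>\<^bsub>W i\<^esub> l i)) \<longlonglongrightarrow> e"
      using tendsto_add[OF tendsto_const lim[OF i], of e] by simp
    show "\<forall>m\<ge>N. mnorm (W i) (uproj (s n) i \<ominus>\<^bsub>W i\<^esub> l i) \<le>
        e + mnorm (W i) (uproj (s m) i \<ominus>\<^bsub>W i\<^esub> l i)"
    proof (intro allI impI)
      fix m assume m: "m \<ge> N"
      show "mnorm (W i) (uproj (s n) i \<ominus>\<^bsub>W i\<^esub> l i) \<le>
          e + mnorm (W i) (uproj (s m) i \<ominus>\<^bsub>W i\<^esub> l i)"
        using mnorm_diff_tri[OF W[OF i] d[OF i, of n] d[OF i, of m] l[OF i]]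
          diff[OF i, of n m] N[OF n m] by linarith
    qed
  qed
  define t where "t = utuple (\<lambda>i\<in>I. l i)"
  let ?c = "K * rnorm R (\<ominus>\<^bsub>R\<^esub> \<one>\<^bsub>R\<^esub>)"
  have c0: "?c \<ge> 0"
  proof -
    obtain i where "i \<in> I" using I by blast
    then show ?thesis using K[of i] neg_one by (simp add: smult_bound_def)
  qed
  have swap: "mnorm (W i) (y \<ominus>\<^bsub>W i\<^esub> x) \<le> ?c * mnorm (W i) (x \<ominus>\<^bsub>W i\<^esub> y)"
    if "i \<in> I" "x \<in> carrier (W i)" "y \<in> carrier (W i)" for i x y
    using mnorm_uminus_le[OF W[OF that(1)] K[OF that(1)], of "x \<ominus>\<^bsub>W i\<^esub> y"]
      minus_swap[OF banach_moduleD(2)[OF W[OF that(1)]] that(2,3)]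
      banach_moduleD(9)[OF W[OF that(1)] that(2,3)] by simp
  have t: "t \<in> carrier Y"
    unfolding t_def
  proof -
    obtain N where N: "\<And>m n. m \<ge> N \<Longrightarrow> n \<ge> N \<Longrightarrow> mnorm Y (s m \<ominus>\<^bsub>Y\<^esub> s n) < 1"
      using cau[of 1] by auto
    have le: "mnorm (W i) (l i) \<le> ?c * 1 + mnorm Y (s N)" if i: "i \<in> I" for i
    proof -
      interpret Wi: abelian_group "W i" using banach_moduleD(2)[OF W[OF i]] .
      have "mnorm (W i) (l i \<ominus>\<^bsub>W i\<^esub> uproj (s N) i) \<le> ?c * mnorm (W i) (uproj (s N) i \<ominus>\<^bsub>W i\<^esub> l i)"
        by (rule swap[OF i d[OF i] l[OF i]])
      also have "\<dots> \<le> ?c * 1" using unif[OF N i, of N] by (intro mult_left_mono[OF _ c0]) simp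
      finally have "mnorm (W i) (l i \<ominus>\<^bsub>W i\<^esub> uproj (s N) i) \<le> ?c * 1" .
      moreover have "(l i \<ominus>\<^bsub>W i\<^esub> uproj (s N) i) \<oplus>\<^bsub>W i\<^esub> uproj (s N) i = l i"
        using d[OF i] l[OF i] by (simp add: a_minus_def Wi.a_assoc Wi.l_neg)
      ultimately show ?thesis
        using banach_moduleD(12)[OF W[OF i] Wi.minus_closed[OF l[OF i] d[OF i]] d[OF i], of N N]
          carrierD(2)[OF s i, of N] by simp
    qed
    show "utuple (restrict l I) \<in> carrier Y"
    proof (rule carrierI[OF l le])
      \<comment> \<open>Bounded maps are continuous, so the conditions pass to the limit.\<close>
      fix i j g assume g: "(i, j, g) \<in> E"
      have ij: "i \<in> I" "j \<in> I" and gm: "g \<in> Mor (Ban R) (W i) (W j)" using E[OF g] by auto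
      obtain L where L: "L > 0" "\<And>x. x \<in> carrier (W i) \<Longrightarrow> mnorm (W j) (g x) \<le> L * mnorm (W i) x"
        using Ban_MorE[OF gm W[OF ij(1)]] by blast
      have gl: "g (l i) \<in> carrier (W j)" using E_linear(4)[OF g l[OF ij(1)]] .
      have "mnorm (W j) (g (l i) \<ominus>\<^bsub>W j\<^esub> l j) \<le> 0"
      proof (rule Lim_bounded2)
        show "(\<lambda>n. L * (?c * mnorm (W i) (uproj (s n) i \<ominus>\<^bsub>W i\<^esub> l i)) +
            mnorm (W j) (uproj (s n) j \<ominus>\<^bsub>W j\<^esub> l j)) \<longlonglongrightarrow> 0"
          using tendsto_add[OF tendsto_mult_left[OF tendsto_mult_left[OF lim[OF ij(1)], of ?c], of L]
              lim[OF ij(2)]] by simp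
        show "\<forall>n\<ge>0. mnorm (W j) (g (l i) \<ominus>\<^bsub>W j\<^esub> l j) \<le>
            L * (?c * mnorm (W i) (uproj (s n) i \<ominus>\<^bsub>W i\<^esub> l i)) + mnorm (W j) (uproj (s n) j \<ominus>\<^bsub>W j\<^esub> l j)"
        proof (intro allI impI)
          fix n
          have gs: "g (uproj (s n) i) = uproj (s n) j" using carrierD(3)[OF s g] .
          have "mnorm (W j) (g (l i) \<ominus>\<^bsub>W j\<^esub> uproj (s n) j) = mnorm (W j) (g (l i \<ominus>\<^bsub>W i\<^esub> uproj (s n) i))"
            using E_linear(2)[OF g l[OF ij(1)] d[OF ij(1)], of n] gs by simp
          also have "\<dots> \<le> L * mnorm (W i) (l i \<ominus>\<^bsub>W i\<^esub> uproj (s n) i)"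
            by (rule L(2)[OF banach_moduleD(9)[OF W[OF ij(1)] l[OF ij(1)] d[OF ij(1)]]])
          also have "\<dots> \<le> L * (?c * mnorm (W i) (uproj (s n) i \<ominus>\<^bsub>W i\<^esub> l i))"
            using swap[OF ij(1) d[OF ij(1)] l[OF ij(1)]] L(1) by (intro mult_left_mono) auto
          finally show "mnorm (W j) (g (l i) \<ominus>\<^bsub>W j\<^esub> l j) \<le>
            L * (?c * mnorm (W i) (uproj (s n) i \<ominus>\<^bsub>W i\<^esub> l i)) + mnorm (W j) (uproj (s n) j \<ominus>\<^bsub>W j\<^esub> l j)"
            using mnorm_diff_tri[OF W[OF ij(2)] gl d[OF ij(2), of n] l[OF ij(2)]] by linarith
        qed
      qed
      then have "g (l i) \<ominus>\<^bsub>W j\<^esub> l j = \<zero>\<^bsub>W j\<^esub>"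
        using banach_moduleD(5,6)[OF W[OF ij(2)] banach_moduleD(9)[OF W[OF ij(2)] gl l[OF ij(2)]]]
        by linarith
      then show "g (l i) = l j"
        using minus_eq_zero_iff[OF banach_moduleD(2)[OF W[OF ij(2)]] gl l[OF ij(2)]] by simp
    qed
  qed
  have "(\<lambda>n. mnorm Y (s n \<ominus>\<^bsub>Y\<^esub> t)) \<longlonglongrightarrow> 0"
  proof (rule LIMSEQ_I)
    fix e :: real assume "e > 0"
    then obtain N where N: "\<And>m n. m \<ge> N \<Longrightarrow> n \<ge> N \<Longrightarrow> mnorm Y (s m \<ominus>\<^bsub>Y\<^esub> s n) < e / 2"
      using cau[of "e / 2"] by auto
    have "norm (mnorm Y (s n \<ominus>\<^bsub>Y\<^esub> t) - 0) < e" if n: "n \<ge> N" for n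
    proof -
      note st = Y.minus_closed[OF s t, of n]
      have "mnorm Y (s n \<ominus>\<^bsub>Y\<^esub> t) \<le> e / 2"
        by (rule norm_le) (use unif[OF N _ n] in \<open>simp add: uproj_minus[OF s t, unfolded t_def] t_def\<close>)
      moreover have "0 \<le> mnorm Y (s n \<ominus>\<^bsub>Y\<^esub> t)"
      proof -
        obtain i where i: "i \<in> I" using I by blast
        then show ?thesis using carrierD(1,2)[OF st i] banach_moduleD(5)[OF W[OF i]] by fastforce
      qed
      ultimately show ?thesis using \<open>e > 0\<close> by simp
    qed
    then show "\<exists>N. \<forall>n\<ge>N. norm (mnorm Y (s n \<ominus>\<^bsub>Y\<^esub> t) - 0) < e" by blast
  qed
  then show ?thesis using t by blast
qed

text \<open>
  The common constant is needed for closure under negation and scalar multiplication, and for the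
  boundedness of the limit of a Cauchy sequence.
\<close>

theorem banach_module_compat: "banach_module R Y"
  unfolding banach_module_iff complete_norm_def
proof (intro conjI ballI allI impI)
  show "module R Y" by (rule module_compat)
  obtain i0 where i0: "i0 \<in> I" using I by blast
  show "\<exists>K. smult_bound R Y K"
    using smult_closed(2)[OF _ banach_ringD(2)[OF R]] K[OF i0]
    unfolding smult_bound_def by blast
  fix x assume x: "x \<in> carrier Y"
  note dx = carrierD[OF x]
  show x0: "0 \<le> mnorm Y x"
    using banach_moduleD(5)[OF W[OF i0] dx(1)[OF i0]] dx(2)[OF i0] by linarith
  show "mnorm Y x = 0 \<longleftrightarrow> x = \<zero>\<^bsub>Y\<^esub>"
  proof
    assume "mnorm Y x = 0"
    then have "uproj x i = \<zero>\<^bsub>W i\<^esub>" if i: "i \<in> I" for i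
      using banach_moduleD(5,6)[OF W[OF i] dx(1)[OF i]] dx(2)[OF i] by linarith
    then show "x = \<zero>\<^bsub>Y\<^esub>" by (intro eqI[OF x zero_closed]) simp
  next
    assume "x = \<zero>\<^bsub>Y\<^esub>"
    then have "mnorm Y x \<le> 0" using banach_moduleD(7)[OF W] by (intro norm_le) simp
    then show "mnorm Y x = 0" using x0 by simp
  qed
  fix y assume y: "y \<in> carrier Y"
  note dy = carrierD[OF y]
  show "mnorm Y (x \<oplus>\<^bsub>Y\<^esub> y) \<le> mnorm Y x + mnorm Y y"
  proof (rule norm_le)
    fix i assume i: "i \<in> I"
    then show "mnorm (W i) (uproj (x \<oplus>\<^bsub>Y\<^esub> y) i) \<le> mnorm Y x + mnorm Y y"
      using banach_moduleD(12)[OF W[OF i] dx(1)[OF i] dy(1)[OF i]] dx(2)[OF i] dy(2)[OF i] by simp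
  qed
next
  fix s :: "nat \<Rightarrow> 'u"
  assume "\<forall>n. s n \<in> carrier Y"
    "\<forall>e>0. \<exists>N. \<forall>m\<ge>N. \<forall>n\<ge>N. mnorm Y (s m \<ominus>\<^bsub>Y\<^esub> s n) < e"
  then show "\<exists>l\<in>carrier Y. (\<lambda>n. mnorm Y (s n \<ominus>\<^bsub>Y\<^esub> l)) \<longlonglongrightarrow> 0"
    by (intro complete_compat) auto
qed

end

lemma projection_Mor:
  assumes R: "banach_ring R" and i: "i \<in> I"
  shows "(\<lambda>t\<in>carrier Y. uproj t i) \<in> Mor (Ban R) Y (W i)"
proof -
  note c = add_closed smult_closed(1)[OF _ banach_ringD(2)[OF R]]
  have "\<exists>C. \<forall>t\<in>carrier Y. mnorm (W i) ((\<lambda>t\<in>carrier Y. uproj t i) t) \<le> C * mnorm Y t"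
    using carrierD(2)[OF _ i] by (intro exI[of _ 1]) simp
  then show ?thesis
    using carrierD(1)[OF _ i] c i unfolding Ban_Mor_iff by (auto simp: compat_module_simps)
qed

lemma tuple_Mor:
  assumes X: "banach_module R X" and g: "\<And>i. i \<in> I \<Longrightarrow> g i \<in> Mor (Ban R) X (W i)"
    and le: "\<And>i x. i \<in> I \<Longrightarrow> x \<in> carrier X \<Longrightarrow> mnorm (W i) (g i x) \<le> L * mnorm X x"
    and compat: "\<And>i j h x. (i, j, h) \<in> E \<Longrightarrow> x \<in> carrier X \<Longrightarrow> h (g i x) = g j x"
  shows "(\<lambda>x\<in>carrier X. utuple (\<lambda>i\<in>I. g i x)) \<in> Mor (Ban R) X Y"
  unfolding Ban_Mor_iff
proof (intro conjI ballI exI[of _ L])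
  have mem: "utuple (\<lambda>i\<in>I. g i x) \<in> carrier Y" if "x \<in> carrier X" for x
    using carrierI[of "\<lambda>i. g i x" "L * mnorm X x"] g le compat that
    by (auto simp: Ban_Mor_iff PiE_iff)
  then show "(\<lambda>x\<in>carrier X. utuple (\<lambda>i\<in>I. g i x)) \<in> carrier X \<rightarrow>\<^sub>E carrier Y" by auto
  fix x assume x: "x \<in> carrier X"
  show "mnorm Y ((\<lambda>x\<in>carrier X. utuple (\<lambda>i\<in>I. g i x)) x) \<le> L * mnorm X x"
    by (rule norm_le) (use le x in simp)
  show "(\<lambda>x\<in>carrier X. utuple (\<lambda>i\<in>I. g i x)) (x \<oplus>\<^bsub>X\<^esub> y) =
      (\<lambda>x\<in>carrier X. utuple (\<lambda>i\<in>I. g i x)) x \<oplus>\<^bsub>Y\<^esub> (\<lambda>x\<in>carrier X. utuple (\<lambda>i\<in>I. g i x)) y"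
    if y: "y \<in> carrier X" for y
    using x y g banach_moduleD(8)[OF X x y] by (auto simp: Ban_Mor_iff intro!: arg_cong[where f = utuple] restrict_ext)
  show "(\<lambda>x\<in>carrier X. utuple (\<lambda>i\<in>I. g i x)) (a \<odot>\<^bsub>X\<^esub> x) =
      a \<odot>\<^bsub>Y\<^esub> (\<lambda>x\<in>carrier X. utuple (\<lambda>i\<in>I. g i x)) x" if a: "a \<in> carrier R" for a
    using x a g banach_moduleD(11)[OF X a x] by (auto simp: Ban_Mor_iff intro!: arg_cong[where f = utuple] restrict_ext)
qed

end


section \<open>Weights\<close>

text \<open>
  One weight dominates countably many sequences up to constants: \<open>\<psi> i\<close> exceeds \<open>B n i\<close> for \<open>n \<le> i\<close>, and
  the finitely many remaining entries of the \<open>n\<close>-th sequence are absorbed by \<open>L n\<close>.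
\<close>

lemma dominating_weight:
  fixes B :: "nat \<Rightarrow> nat \<Rightarrow> real"
  assumes "\<And>n i. B n i \<ge> 0"
  obtains \<psi> :: "nat \<Rightarrow> nat" and L :: "nat \<Rightarrow> real" where
    "mono \<psi>" "\<And>i. \<psi> i \<ge> 1" "\<And>n i. B n i \<le> L n * real (\<psi> i)"
proof -
  define \<psi> where "\<psi> i = 1 + (\<Sum>n\<le>i. \<Sum>j\<le>i. nat \<lceil>B n j\<rceil>)" for i
  define L where "L n = 1 + (\<Sum>i\<le>n. B n i)" for n
  have "mono \<psi>"
  proof (rule monoI)
    fix i j :: nat assume ij: "i \<le> j"
    have "(\<Sum>n\<le>i. \<Sum>k\<le>i. nat \<lceil>B n k\<rceil>) \<le> (\<Sum>n\<le>i. \<Sum>k\<le>j. nat \<lceil>B n k\<rceil>)"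
      using ij by (intro sum_mono sum_mono2) auto
    also have "\<dots> \<le> (\<Sum>n\<le>j. \<Sum>k\<le>j. nat \<lceil>B n k\<rceil>)" using ij by (intro sum_mono2) auto
    finally show "\<psi> i \<le> \<psi> j" by (simp add: \<psi>_def)
  qed
  moreover have psi1: "\<psi> i \<ge> 1" for i by (simp add: \<psi>_def)
  moreover have "B n i \<le> L n * real (\<psi> i)" for n i
  proof (cases "n \<le> i")
    case True
    have L1: "L n \<ge> 1" using assms by (simp add: L_def sum_nonneg)
    have "nat \<lceil>B n i\<rceil> \<le> (\<Sum>j\<le>i. nat \<lceil>B n j\<rceil>)" by (rule member_le_sum) auto
    also have "\<dots> \<le> (\<Sum>n\<le>i. \<Sum>j\<le>i. nat \<lceil>B n j\<rceil>)"
      using True by (intro member_le_sum[where f = "\<lambda>n. \<Sum>j\<le>i. nat \<lceil>B n j\<rceil>"]) auto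
    finally have "nat \<lceil>B n i\<rceil> \<le> \<psi> i" by (simp add: \<psi>_def)
    then have "real (nat \<lceil>B n i\<rceil>) \<le> real (\<psi> i)" by (simp only: of_nat_le_iff)
    then have "B n i \<le> 1 * real (\<psi> i)" by linarith
    also have "\<dots> \<le> L n * real (\<psi> i)" using L1 by (intro mult_right_mono) auto
    finally show ?thesis .
  next
    case False
    have "B n i \<le> (\<Sum>i\<le>n. B n i)" using False assms by (intro member_le_sum) auto
    then have "B n i \<le> L n * 1" by (simp add: L_def)
    also have "\<dots> \<le> L n * real (\<psi> i)"
      using psi1[of i] assms by (intro mult_left_mono) (auto simp: L_def intro!: add_nonneg_nonneg sum_nonneg)
    finally show ?thesis .
  qed
  ultimately show ?thesis using that by blast
qed

lemma (in compat_setting) compat_setting_rescale: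
  assumes "\<And>i. i \<in> I \<Longrightarrow> r i > 0"
  shows "compat_setting R I (\<lambda>i. rescale (r i) (W i)) E K"
proof
  show "I \<noteq> {}" by (rule I)
  show "banach_module R (rescale (r i) (W i))" "smult_bound R (rescale (r i) (W i)) K"
    if "i \<in> I" for i
    using banach_module_rescale[OF assms W] smult_bound_rescale[OF assms K] that by auto
  show "i \<in> I \<and> j \<in> I \<and> g \<in> Mor (Ban R) (rescale (r i) (W i)) (rescale (r j) (W j))"
    if "(i, j, g) \<in> E" for i j g
    using E[OF that] assms[of i] assms[of j] W[of i] W[of j] by (simp add: Ban_Mor_rescale)
qed


section \<open>The formal colimit of kernels is the limit of the tower\<close>

lemma psi_code_decode:
  assumes "\<psi> \<in> Psi"
  shows "psi_decode (psi_code \<psi> :: 'u::universe) = \<psi>"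
proof -
  have "inj (psi_code :: (nat \<Rightarrow> nat) \<Rightarrow> 'u)"
  proof (rule injI)
    fix \<psi> \<psi>' assume "(psi_code \<psi> :: 'u) = psi_code \<psi>'"
    then have "(\<lambda>i. unat (\<psi> i) :: 'u) = (\<lambda>i. unat (\<psi>' i))"
      unfolding psi_code_def by (rule injD[OF inj_utuple])
    then show "\<psi> = \<psi>'" by (auto simp: fun_eq_iff dest: injD[OF inj_unat])
  qed
  then show ?thesis
    unfolding psi_decode_def using assms by (intro inv_into_f_f) (auto intro: inj_on_subset)
qed

lemma Psi_restrict: "mono \<psi> \<Longrightarrow> (\<And>i. \<psi> i \<ge> 1) \<Longrightarrow> restrict \<psi> {1..} \<in> Psi"
  by (auto simp: Psi_def mono_on_def mono_def)

lemma PsiD: "\<psi> \<in> Psi \<Longrightarrow> i \<ge> 1 \<Longrightarrow> \<psi> i \<ge> 1"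
  by (auto simp: Psi_def PiE_iff)

lemma Psi_directed:
  assumes "\<psi> \<in> Psi" "\<psi>' \<in> Psi"
  obtains \<chi> where "\<chi> \<in> Psi" "\<And>i. i \<ge> 1 \<Longrightarrow> \<psi> i \<le> \<chi> i" "\<And>i. i \<ge> 1 \<Longrightarrow> \<psi>' i \<le> \<chi> i"
proof -
  have m: "mono_on {1..} \<psi>" "mono_on {1..} \<psi>'" using assms by (auto simp: Psi_def)
  have "(\<lambda>i\<in>{1..}. max (\<psi> i) (\<psi>' i)) \<in> Psi"
    unfolding Psi_def
  proof (intro CollectI conjI mono_onI)
    show "(\<lambda>i\<in>{1..}. max (\<psi> i) (\<psi>' i)) \<in> {1..} \<rightarrow>\<^sub>E {1..}"
      using PsiD[OF assms(1)] by (auto simp: le_max_iff_disj)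
    show "(\<lambda>i\<in>{1..}. max (\<psi> i) (\<psi>' i)) r \<le> (\<lambda>i\<in>{1..}. max (\<psi> i) (\<psi>' i)) s"
      if "r \<in> {1..}" "s \<in> {1..}" "r \<le> s" for r s
      using that mono_onD[OF m(1) that] mono_onD[OF m(2) that] by (simp add: max.coboundedI1 max.coboundedI2)
  qed
  then show ?thesis by (rule that) auto
qed

text \<open>
  The modules \<open>W i\<close> are the terms \<open>V i\<close> of a tower with equivalent norms \<open>nrm i\<close> for which the
  scalar multiplication has the common constant \<open>K\<close>.
\<close>

locale tower_setting =
  fixes R :: "'r normed_ring" and V :: "nat \<Rightarrow> ('r, 'u::universe) normed_module"
    and f :: "nat \<Rightarrow> 'u \<Rightarrow> 'u" and nrm :: "nat \<Rightarrow> 'u \<Rightarrow> real" and K :: real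
  assumes R: "banach_ring R"
    and V: "i \<ge> 1 \<Longrightarrow> banach_module R (V i)"
    and nrm: "i \<ge> 1 \<Longrightarrow> equivalent_norm (V i) (nrm i)"
    and V': "i \<ge> 1 \<Longrightarrow> banach_module R ((V i)\<lparr>mnorm := nrm i\<rparr>)"
    and K: "i \<ge> 1 \<Longrightarrow> smult_bound R ((V i)\<lparr>mnorm := nrm i\<rparr>) K"
    and f: "i \<ge> 1 \<Longrightarrow> f i \<in> Mor (Ban R) (V (i + 1)) (V i)"
begin

definition W :: "nat \<Rightarrow> ('r, 'u) normed_module" where
  "W i = (V i)\<lparr>mnorm := nrm i\<rparr>"

text \<open>The maps of the tower, in the format of \<open>compat_module\<close>.\<close>

definition E :: "(nat \<times> nat \<times> ('u \<Rightarrow> 'u)) set" where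
  "E = {(j + 1, j, f j) | j. j \<ge> 1}"

text \<open>The factors of \<open>ker_dom W \<psi>\<close>.\<close>

definition wt :: "(nat \<Rightarrow> nat) \<Rightarrow> nat \<Rightarrow> ('r, 'u) normed_module" where
  "wt \<psi> i = rescale (inverse (real (\<psi> i))) (W i)"

lemma W_simps [simp]:
  "carrier (W i) = carrier (V i)" "\<zero>\<^bsub>W i\<^esub> = \<zero>\<^bsub>V i\<^esub>" "x \<ominus>\<^bsub>W i\<^esub> y = x \<ominus>\<^bsub>V i\<^esub> y"
  "mnorm (W i) = nrm i"
  by (simp_all add: W_def)

lemma wt_simps [simp]:
  "carrier (wt \<psi> i) = carrier (V i)"
  "mnorm (wt \<psi> i) x = inverse (real (\<psi> i)) * nrm i x"
  by (simp_all add: wt_def)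

lemma W_Mor:
  assumes "i \<ge> 1"
  shows "Mor (Ban R) X (W i) = Mor (Ban R) X (V i)" "Mor (Ban R) (W i) X = Mor (Ban R) (V i) X"
  using assms Ban_Mor_equivalent_norm_cod[OF nrm] Ban_Mor_equivalent_norm_dom[OF nrm V V']
  by (auto simp: W_def)

lemma wt_Mor:
  assumes "\<psi> \<in> Psi" "i \<ge> 1"
  shows "Mor (Ban R) X (wt \<psi> i) = Mor (Ban R) X (V i)"
proof -
  have "inverse (real (\<psi> i)) > 0" "banach_module R (W i)"
    using PsiD[OF assms] V' assms by (auto simp: W_def)
  then show ?thesis using W_Mor[OF assms(2)] by (simp add: wt_def Ban_Mor_rescale)
qed

lemma compat_setting_W: "compat_setting R {1..} W E K"
proof
  show "{1..} \<noteq> ({} :: nat set)" by auto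
  show "banach_module R (W i)" "smult_bound R (W i) K" if "i \<in> {1..}" for i
    using V' K that by (auto simp: W_def)
  show "i \<in> {1..} \<and> j \<in> {1..} \<and> g \<in> Mor (Ban R) (W i) (W j)" if "(i, j, g) \<in> E" for i j g
    using that f by (auto simp: E_def W_Mor)
qed

lemma compat_setting_wt: "\<psi> \<in> Psi \<Longrightarrow> compat_setting R {1..} (wt \<psi>) E K"
  unfolding wt_def using PsiD
  by (intro compat_setting.compat_setting_rescale[OF compat_setting_W]) fastforce

abbreviation T :: "(nat \<Rightarrow> nat) \<Rightarrow> ('r, 'u) normed_module" where
  "T \<equiv> tower_ker W f"

text \<open>An element of the kernel of \<open>id - s\<close> is a bounded family compatible with the maps of the tower.\<close>

lemma tower_ker_eq:
  assumes "\<psi> \<in> Psi"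
  shows "T \<psi> = compat_module {1..} (wt \<psi>) E"
proof -
  have "id_minus_s W f \<psi> t = \<zero>\<^bsub>ker_cod W \<psi>\<^esub> \<longleftrightarrow> (\<forall>i j g. (i, j, g) \<in> E \<longrightarrow> g (uproj t i) = uproj t j)"
    if t: "t \<in> carrier (ker_dom W \<psi>)" for t
  proof -
    have t': "uproj t j \<in> carrier (V j)" if "j \<ge> 1" for j
      using ban_prod_carrierD(1)[OF t[unfolded ker_dom_def], of j] that by simp
    have ft: "f j (uproj t (j + 1)) \<in> carrier (V j)" if "j \<ge> 1" for j
      using f[OF that] t'[of "j + 1"] by (auto simp: Ban_Mor_iff)
    have z: "uproj t j \<ominus>\<^bsub>V j\<^esub> f j (uproj t (j + 1)) = \<zero>\<^bsub>V j\<^esub> \<longleftrightarrow>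
        f j (uproj t (j + 1)) = uproj t j" if "j \<ge> 1" for j
      using minus_eq_zero_iff[OF banach_moduleD(2)[OF V[OF that]] t'[OF that] ft[OF that]] by metis
    have "id_minus_s W f \<psi> t = \<zero>\<^bsub>ker_cod W \<psi>\<^esub> \<longleftrightarrow>
        (\<lambda>j\<in>{1..}. uproj t j \<ominus>\<^bsub>V j\<^esub> f j (uproj t (j + 1))) = (\<lambda>j\<in>{1..}. \<zero>\<^bsub>V j\<^esub>)"
      using t by (simp add: id_minus_s_def ker_cod_def inj_eq[OF inj_utuple])
    also have "\<dots> \<longleftrightarrow> (\<forall>j\<ge>1. uproj t j \<ominus>\<^bsub>V j\<^esub> f j (uproj t (j + 1)) = \<zero>\<^bsub>V j\<^esub>)"
      by (auto simp: fun_eq_iff restrict_def)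
    also have "\<dots> \<longleftrightarrow> (\<forall>j\<ge>1. f j (uproj t (j + 1)) = uproj t j)"
      by (simp only: z cong: imp_cong)
    also have "\<dots> \<longleftrightarrow> (\<forall>i j g. (i, j, g) \<in> E \<longrightarrow> g (uproj t i) = uproj t j)"
      by (auto simp: E_def)
    finally show ?thesis .
  qed
  then have "{t \<in> carrier (ker_dom W \<psi>). id_minus_s W f \<psi> t = \<zero>\<^bsub>ker_cod W \<psi>\<^esub>} =
      {t \<in> carrier (ker_dom W \<psi>). \<forall>(i, j, g)\<in>E. g (uproj t i) = uproj t j}"
    by auto
  moreover have "wt \<psi> = (\<lambda>i. rescale (inverse (real (\<psi> i))) (W i))" by (simp add: wt_def fun_eq_iff)
  ultimately show ?thesis
    by (simp add: tower_ker_def ban_ker_def compat_module_def ker_dom_def)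
qed

lemma T_banach: "\<psi> \<in> Psi \<Longrightarrow> banach_module R (T \<psi>)"
  using compat_setting.banach_module_compat[OF compat_setting_wt R] by (simp add: tower_ker_eq)

lemma T_carrierD:
  assumes "\<psi> \<in> Psi" "t \<in> carrier (T \<psi>)"
  shows "i \<ge> 1 \<Longrightarrow> uproj t i \<in> carrier (V i)"
    "i \<ge> 1 \<Longrightarrow> inverse (real (\<psi> i)) * nrm i (uproj t i) \<le> mnorm (T \<psi>) t"
    "i \<ge> 1 \<Longrightarrow> f i (uproj t (i + 1)) = uproj t i"
    "t = utuple (\<lambda>i\<in>{1..}. uproj t i)"
proof -
  note s = compat_setting.carrierD[OF compat_setting_wt[OF assms(1)], of t]
  have t: "t \<in> carrier (compat_module {1..} (wt \<psi>) E)" using assms by (simp add: tower_ker_eq)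
  show "i \<ge> 1 \<Longrightarrow> uproj t i \<in> carrier (V i)"
    "i \<ge> 1 \<Longrightarrow> inverse (real (\<psi> i)) * nrm i (uproj t i) \<le> mnorm (T \<psi>) t"
    "i \<ge> 1 \<Longrightarrow> f i (uproj t (i + 1)) = uproj t i"
    using s(1)[OF t, of i] s(2)[OF t, of i] s(3)[OF t, of "i + 1" i "f i"] assms(1)
    by (auto simp: tower_ker_eq E_def)
  show "t = utuple (\<lambda>i\<in>{1..}. uproj t i)"
    using t by (intro ban_prod_carrierD(3)[where W = "wt \<psi>"]) (simp add: compat_module_carrier)
qed

lemma T_proj_Mor:
  assumes "\<psi> \<in> Psi" "i \<ge> 1"
  shows "(\<lambda>t\<in>carrier (T \<psi>). uproj t i) \<in> Mor (Ban R) (T \<psi>) (V i)"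
  using compat_setting.projection_Mor[OF compat_setting_wt[OF assms(1)] R, of i] assms
  unfolding tower_ker_eq[OF assms(1)] by (simp add: wt_Mor)

lemma T_tuple_Mor:
  assumes "\<psi> \<in> Psi" "banach_module R X" "\<And>i. i \<ge> 1 \<Longrightarrow> g i \<in> Mor (Ban R) X (V i)"
    "\<And>i x. i \<ge> 1 \<Longrightarrow> x \<in> carrier X \<Longrightarrow> inverse (real (\<psi> i)) * nrm i (g i x) \<le> L * mnorm X x"
    "\<And>i x. i \<ge> 1 \<Longrightarrow> x \<in> carrier X \<Longrightarrow> f i (g (i + 1) x) = g i x"
  shows "(\<lambda>x\<in>carrier X. utuple (\<lambda>i\<in>{1..}. g i x)) \<in> Mor (Ban R) X (T \<psi>)"
  unfolding tower_ker_eq[OF assms(1)]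
  by (rule compat_setting.tuple_Mor[OF compat_setting_wt[OF assms(1)] assms(2), of g L])
    (use assms wt_Mor in \<open>auto simp: E_def\<close>)

lemma T_inclusion_Mor:
  assumes \<psi>: "\<psi> \<in> Psi" and \<chi>: "\<chi> \<in> Psi" and le: "\<And>i. i \<ge> 1 \<Longrightarrow> \<psi> i \<le> \<chi> i"
  shows "(\<lambda>t\<in>carrier (T \<psi>). t) \<in> Mor (Ban R) (T \<psi>) (T \<chi>)"
proof -
  have "(\<lambda>t\<in>carrier (T \<psi>). utuple (\<lambda>i\<in>{1..}. (\<lambda>t\<in>carrier (T \<psi>). uproj t i) t))
      \<in> Mor (Ban R) (T \<psi>) (T \<chi>)"
  proof (rule T_tuple_Mor[where L = 1, OF \<chi> T_banach[OF \<psi>] T_proj_Mor[OF \<psi>]])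
    fix i :: nat and t assume i: "i \<ge> 1" and t: "t \<in> carrier (T \<psi>)"
    note d = T_carrierD[OF \<psi> t]
    show "f i ((\<lambda>t\<in>carrier (T \<psi>). uproj t (i + 1)) t) = (\<lambda>t\<in>carrier (T \<psi>). uproj t i) t"
      using d(3)[OF i] t by simp
    have "0 \<le> nrm i (uproj t i)"
      using banach_moduleD(5)[OF V'[OF i], of "uproj t i"] d(1)[OF i] by simp
    moreover have "inverse (real (\<chi> i)) \<le> inverse (real (\<psi> i))"
      using le[OF i] PsiD[OF \<psi> i] by (intro le_imp_inverse_le) auto
    ultimately have "inverse (real (\<chi> i)) * nrm i (uproj t i) \<le> inverse (real (\<psi> i)) * nrm i (uproj t i)"
      by (intro mult_right_mono)
    then show "inverse (real (\<chi> i)) * nrm i ((\<lambda>t\<in>carrier (T \<psi>). uproj t i) t) \<le> 1 * mnorm (T \<psi>) t"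
      using d(2)[OF i] t by simp
  qed
  also have "(\<lambda>t\<in>carrier (T \<psi>). utuple (\<lambda>i\<in>{1..}. (\<lambda>t\<in>carrier (T \<psi>). uproj t i) t)) =
      (\<lambda>t\<in>carrier (T \<psi>). t)"
    by (rule restrict_ext) (use T_carrierD(4)[OF \<psi>] in \<open>simp cong: restrict_cong\<close>)
  finally show ?thesis .
qed

sublocale ind_setting "Ban R"
  by standard (rule is_category_Ban)

abbreviation L :: "('u, ('r, 'u) normed_module, 'u \<Rightarrow> 'u) ind_ob" where
  "L \<equiv> tower_colim W f"

lemma L_simps [simp]:
  "Ob (shape L) = psi_code ` Psi"
  "dob L a = T (psi_decode a)"
  "dmor L a b p = (\<lambda>t\<in>carrier (T (psi_decode a)). t)"
  by (simp_all add: tower_colim_def poset_cat_def)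

lemma L_arrow:
  "Mor (shape L) a b = (if \<forall>i\<in>{1..}. psi_decode a i \<le> psi_decode b i then {unat 0} else {})"
  by (simp add: tower_colim_def poset_cat_def)

lemma decode_Psi: "a \<in> (psi_code ` Psi :: 'u set) \<Longrightarrow> psi_decode a \<in> Psi"
  by (auto simp: psi_code_decode)

lemma L_transition:
  assumes "g \<in> Mor (Ban R) X (T \<psi>)"
  shows "compose (carrier X) (\<lambda>t\<in>carrier (T \<psi>). t) g = g"
  using assms by (auto simp: Ban_Mor_iff compose_def fun_eq_iff PiE_iff extensional_def)

lemma L_Ob: "L \<in> Ob (Ind (Ban R))"
proof -
  have c: "is_category (shape L)"
    unfolding tower_colim_def diagram.simps by (rule is_category_poset_cat) (auto intro: order_trans)
  have "filtered (shape L)"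
    unfolding tower_colim_def diagram.simps
  proof (rule filtered_poset_cat)
    show "is_category (poset_cat (psi_code ` Psi :: 'u set)
        (\<lambda>a b. \<forall>i\<in>{1..}. psi_decode a i \<le> psi_decode b i) (unat 0 :: 'u))"
      using c by (simp add: tower_colim_def)
    have "restrict (\<lambda>_. 1) {1..} \<in> Psi" by (rule Psi_restrict) (auto simp: mono_def)
    then show "psi_code ` Psi \<noteq> {}" by blast
    fix a b :: 'u assume a: "a \<in> psi_code ` Psi" "b \<in> psi_code ` Psi"
    obtain \<chi> where "\<chi> \<in> Psi" "\<And>i. i \<ge> 1 \<Longrightarrow> psi_decode a i \<le> \<chi> i" "\<And>i. i \<ge> 1 \<Longrightarrow> psi_decode b i \<le> \<chi> i"
      using Psi_directed[OF decode_Psi[OF a(1)] decode_Psi[OF a(2)]] by blast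
    then show "\<exists>z\<in>psi_code ` Psi. (\<forall>i\<in>{1..}. psi_decode a i \<le> psi_decode z i) \<and>
        (\<forall>i\<in>{1..}. psi_decode b i \<le> psi_decode z i)"
      by (intro bexI[of _ "psi_code \<chi>"]) (auto simp: psi_code_decode)
  qed auto
  moreover have "is_diagram (Ban R) L"
    unfolding is_diagram_def
  proof (intro conjI ballI c)
    fix a assume a: "a \<in> Ob (shape L)"
    then have pa: "psi_decode a \<in> Psi" using decode_Psi by simp
    show "dob L a \<in> Ob (Ban R)" using T_banach[OF pa] by simp
    show "dmor L a a (Ident (shape L) a) = Ident (Ban R) (dob L a)" by simp
    fix b u assume b: "b \<in> Ob (shape L)" and u: "u \<in> Mor (shape L) a b"
    then have pb: "psi_decode b \<in> Psi" using decode_Psi by simp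
    show m: "dmor L a b u \<in> Mor (Ban R) (dob L a) (dob L b)"
      using T_inclusion_Mor[OF pa pb] u by (auto simp: L_arrow split: if_splits)
    fix c v assume "c \<in> Ob (shape L)"
    show "dmor L a c (Cmp (shape L) a b c v u) =
        Cmp (Ban R) (dob L a) (dob L b) (dob L c) (dmor L b c v) (dmor L a b u)"
      using L_transition[OF m[unfolded L_simps]] by simp
  qed
  ultimately show ?thesis by (simp add: Ind_simps)
qed

text \<open>
  The transition maps of \<open>L\<close> are inclusions of carriers, so a germ is determined by the underlying
  function of a representative.
\<close>

lemma L_germ_mem:
  assumes "b \<in> Ob (shape L)" "g \<in> Mor (Ban R) X (dob L b)"
  shows "(a, h) \<in> germ (Ban R) L X b g \<longleftrightarrow>
    a \<in> Ob (shape L) \<and> h \<in> Mor (Ban R) X (dob L a) \<and> h = g"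
proof
  assume "(a, h) \<in> germ (Ban R) L X b g"
  then have "((b, g), (a, h)) \<in> ind_equiv (Ban R) L X" by (simp add: germ_mem_iff)
  then show "a \<in> Ob (shape L) \<and> h \<in> Mor (Ban R) X (dob L a) \<and> h = g"
    by (rule ind_equivE) (auto simp: L_transition)
next
  assume a: "a \<in> Ob (shape L) \<and> h \<in> Mor (Ban R) X (dob L a) \<and> h = g"
  obtain c u v where "c \<in> Ob (shape L)" "u \<in> Mor (shape L) b c" "v \<in> Mor (shape L) a c"
    using L_Ob assms(1) a unfolding Ind_simps filtered_def by blast
  then show "(a, h) \<in> germ (Ban R) L X b g"
    unfolding germ_mem_iff using a assms by (intro ind_equivI) (auto simp: L_transition)
qed

lemma tower_simps [simp]:
  "Ob (shape (tower V f)) = {1..}"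
  "dob (tower V f) i = V i"
  "Mor (shape (tower V f)) i j = (if j \<le> i then {()} else {})"
  "dmor (tower V f) i j a = tower_comp V f j (i - j)"
  by (simp_all add: tower_def poset_cat_def)

lemma tower_comp_Mor: "i \<ge> 1 \<Longrightarrow> tower_comp V f i k \<in> Mor (Ban R) (V (i + k)) (V i)"
proof (induction k)
  case 0
  then have "Ident (Ban R) (V i) \<in> Mor (Ban R) (V i) (V i)"
    using V by (intro cat_ident[OF is_category_Ban]) simp
  then show ?case by (simp only: tower_comp.simps Ban_simps add_0_right)
next
  case (Suc k)
  have fk: "f (i + k) \<in> Mor (Ban R) (V (i + Suc k)) (V (i + k))" using f[of "i + k"] Suc by simp
  show ?case
    using cat_comp[OF is_category_Ban _ _ _ fk Suc.IH[OF Suc.prems]] V Suc.prems by simp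
qed

lemma tower_typed: "well_typed (tower V f)"
  unfolding well_typed_def
proof (intro conjI ballI)
  fix i assume i: "i \<in> Ob (shape (tower V f))"
  then show "dob (tower V f) i \<in> Ob (Ban R)" using V by simp
  fix j a assume "j \<in> Ob (shape (tower V f))" "a \<in> Mor (shape (tower V f)) i j"
  then show "dmor (tower V f) i j a \<in> Mor (Ban R) (dob (tower V f) i) (dob (tower V f) j)"
    using tower_comp_Mor[of j "i - j"] by (simp split: if_splits)
qed

lemma tower_comp_uproj:
  assumes \<psi>: "\<psi> \<in> Psi" and t: "t \<in> carrier (T \<psi>)" and i: "i \<ge> 1"
  shows "tower_comp V f i k (uproj t (i + k)) = uproj t i"
proof (induction k)
  case 0
  then show ?case using T_carrierD(1)[OF \<psi> t i] by simp
next
  case (Suc k)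
  then show ?case
    using T_carrierD(1)[OF \<psi> t, of "i + Suc k"] T_carrierD(3)[OF \<psi> t, of "i + k"] i
    by (simp add: compose_def)
qed

text \<open>The projections from the kernels, and the cone from \<open>L\<close> to the original tower formed by them.\<close>

definition prj :: "nat \<Rightarrow> 'u \<Rightarrow> 'u \<Rightarrow> 'u" where
  "prj i a = (\<lambda>t\<in>carrier (T (psi_decode a)). uproj t i)"

definition tower_cone :: "nat \<Rightarrow> ('u, 'u \<Rightarrow> 'u) ind_mor" where
  "tower_cone i = to_const L (prj i)"

lemma prj_Mor: "a \<in> psi_code ` Psi \<Longrightarrow> i \<ge> 1 \<Longrightarrow> prj i a \<in> Mor (Ban R) (T (psi_decode a)) (V i)"
  unfolding prj_def by (intro T_proj_Mor decode_Psi)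

lemma is_cone_tower_cone:
  "is_cone (Ind (Ban R)) (ind_const_diagram (Ban R) (tower V f)) L tower_cone"
proof (rule cone_to_constI[OF tower_typed L_Ob])
  show "tower_cone i = to_const L (prj i)" for i by (simp add: tower_cone_def)
  show "prj i a \<in> Mor (Ban R) (dob L a) (dob (tower V f) i)"
    if "i \<in> Ob (shape (tower V f))" "a \<in> Ob (shape L)" for i a
    using prj_Mor that by simp
  show "Cmp (Ban R) (dob L a) (dob L b) (dob (tower V f) i) (prj i b) (dmor L a b u) = prj i a"
    if "a \<in> Ob (shape L)" "b \<in> Ob (shape L)" "u \<in> Mor (shape L) a b" for i a b u
  proof -
    have "(\<lambda>t\<in>carrier (T (psi_decode a)). t) \<in> Mor (Ban R) (T (psi_decode a)) (T (psi_decode b))"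
      using that T_inclusion_Mor[OF decode_Psi decode_Psi, of a b] by (auto simp: L_arrow split: if_splits)
    then show ?thesis
      by (auto simp: prj_def compose_def Ban_Mor_iff fun_eq_iff PiE_iff)
  qed
  show "Cmp (Ban R) (dob L a) (dob (tower V f) i) (dob (tower V f) j) (dmor (tower V f) i j u) (prj i a) =
      prj j a"
    if "i \<in> Ob (shape (tower V f))" "j \<in> Ob (shape (tower V f))" "u \<in> Mor (shape (tower V f)) i j"
      "a \<in> Ob (shape L)" for i j u a
    using that tower_comp_uproj[OF decode_Psi, of a _ j "i - j"]
    by (auto simp: prj_def compose_def fun_eq_iff split: if_splits)
qed

lemma T_mor_eqI:
  assumes \<psi>: "\<psi> \<in> Psi" and v: "v \<in> Mor (Ban R) X (T \<psi>)"
    and w: "w = (\<lambda>x\<in>carrier X. utuple (\<lambda>i\<in>{1..}. g i x))"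
    and eq: "\<And>i. i \<ge> 1 \<Longrightarrow> compose (carrier X) (\<lambda>t\<in>carrier (T \<psi>). uproj t i) v = g i"
  shows "v = w"
proof (rule extensionalityI[of _ "carrier X"])
  show "v \<in> extensional (carrier X)" "w \<in> extensional (carrier X)"
    using v w by (auto simp: Ban_Mor_iff PiE_def)
  fix x assume x: "x \<in> carrier X"
  have vx: "v x \<in> carrier (T \<psi>)" using v x by (auto simp: Ban_Mor_iff)
  have "uproj (v x) i = g i x" if "i \<ge> 1" for i
    using fun_cong[OF eq[OF that], of x] x vx by (simp add: compose_def)
  then have "(\<lambda>i\<in>{1..}. uproj (v x) i) = (\<lambda>i\<in>{1..}. g i x)" by (intro restrict_ext) simp
  then show "v x = w x" using T_carrierD(4)[OF \<psi> vx] x by (simp add: w)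
qed

lemma is_limit_tower_cone:
  "is_limit (Ind (Ban R)) (ind_const_diagram (Ban R) (tower V f)) L tower_cone"
  unfolding is_limit_def
proof (intro conjI is_cone_tower_cone allI impI)
  fix Y :: "('u, ('r, 'u) normed_module, 'u \<Rightarrow> 'u) ind_ob" and d
  assume c: "is_cone (Ind (Ban R)) (ind_const_diagram (Ban R) (tower V f)) Y d"
  then have Y: "Y \<in> Ob (Ind (Ban R))" by (simp add: is_cone_def)
  obtain g where g: "\<And>i. i \<ge> 1 \<Longrightarrow> d i = to_const Y (g i)"
    "\<And>i k. i \<ge> 1 \<Longrightarrow> k \<in> Ob (shape Y) \<Longrightarrow> g i k \<in> Mor (Ban R) (dob Y k) (V i)"
    "\<And>i k l a. i \<ge> 1 \<Longrightarrow> k \<in> Ob (shape Y) \<Longrightarrow> l \<in> Ob (shape Y) \<Longrightarrow>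
       a \<in> Mor (shape Y) k l \<Longrightarrow> compose (carrier (dob Y k)) (g i l) (dmor Y k l a) = g i k"
    and g4: "\<And>i j a k. i \<ge> 1 \<Longrightarrow> j \<ge> 1 \<Longrightarrow> a \<in> Mor (shape (tower V f)) i j \<Longrightarrow>
       k \<in> Ob (shape Y) \<Longrightarrow> compose (carrier (dob Y k)) (tower_comp V f j (i - j)) (g i k) = g j k"
    by (rule cone_to_constE[OF tower_typed c], rule that) simp_all
  have D: "is_diagram (Ban R) Y" using Y by (simp add: Ind_simps)
  have Yb: "banach_module R (dob Y k)" if "k \<in> Ob (shape Y)" for k
    using diagram_simps(2)[OF D that] by simp
  have compat: "f i (g (i + 1) k x) = g i k x"
    if i: "i \<ge> 1" and k: "k \<in> Ob (shape Y)" and x: "x \<in> carrier (dob Y k)" for i k x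
  proof -
    have "g (i + 1) k x \<in> carrier (V (i + 1))" using g(2)[of "i + 1" k] k x by (auto simp: Ban_Mor_iff)
    moreover from this have "f i (g (i + 1) k x) \<in> carrier (V i)" using f[OF i] by (auto simp: Ban_Mor_iff)
    ultimately show ?thesis
      using fun_cong[OF g4[of "i + 1" i "()" k], of x] i k x by (simp add: compose_def)
  qed
  define u where "u k = (\<lambda>x\<in>carrier (dob Y k). utuple (\<lambda>i\<in>{1..}. g i k x))" for k
  \<comment> \<open>The bounds of the maps \<open>g i k\<close> are absorbed by a weight.\<close>
  have "\<exists>\<psi>\<in>Psi. u k \<in> Mor (Ban R) (dob Y k) (T \<psi>)" if k: "k \<in> Ob (shape Y)" for k
  proof -
    have "\<exists>C. C \<ge> 0 \<and> (\<forall>x\<in>carrier (dob Y k). nrm i (g i k x) \<le> C * mnorm (dob Y k) x)"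
      if i: "i \<ge> 1" for i
      using Ban_MorE[OF _ Yb[OF k], of "g i k" "W i"] g(2)[OF i k] W_Mor(1)[OF i]
      by (metis W_simps(4) less_imp_le)
    then obtain C where C: "\<And>i. i \<ge> 1 \<Longrightarrow> C i \<ge> 0"
      "\<And>i x. i \<ge> 1 \<Longrightarrow> x \<in> carrier (dob Y k) \<Longrightarrow> nrm i (g i k x) \<le> C i * mnorm (dob Y k) x"
      by metis
    obtain \<psi> and M :: "nat \<Rightarrow> real" where \<psi>: "mono \<psi>" "\<And>i. \<psi> i \<ge> 1"
      and M: "\<And>n i. (if i \<ge> 1 then C i else 0) \<le> M n * real (\<psi> i)"
      by (rule dominating_weight[of "\<lambda>n i. if i \<ge> 1 then C i else 0"], use C(1) in simp, rule that)
    have "u k \<in> Mor (Ban R) (dob Y k) (T (restrict \<psi> {1..}))"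
      unfolding u_def
    proof (rule T_tuple_Mor[OF Psi_restrict[OF \<psi>] Yb[OF k], where L = "M 0"])
      fix i :: nat and x assume i: "i \<ge> 1" and x: "x \<in> carrier (dob Y k)"
      show "f i (g (i + 1) k x) = g i k x" by (rule compat[OF i k x])
      have "nrm i (g i k x) \<le> C i * mnorm (dob Y k) x" by (rule C(2)[OF i x])
      also have "\<dots> \<le> (M 0 * real (\<psi> i)) * mnorm (dob Y k) x"
        using M[of i 0] i banach_moduleD(5)[OF Yb[OF k] x] by (intro mult_right_mono) auto
      finally have "inverse (real (\<psi> i)) * nrm i (g i k x) \<le>
          inverse (real (\<psi> i)) * ((M 0 * real (\<psi> i)) * mnorm (dob Y k) x)"
        by (intro mult_left_mono) auto
      then show "inverse (real (restrict \<psi> {1..} i)) * nrm i (g i k x) \<le> M 0 * mnorm (dob Y k) x"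
        using \<psi>(2)[of i] i by (simp add: field_simps)
    qed (use g(2) k in auto)
    then show ?thesis using Psi_restrict[OF \<psi>] by blast
  qed
  then obtain \<psi> where \<psi>: "\<And>k. k \<in> Ob (shape Y) \<Longrightarrow> \<psi> k \<in> Psi"
    "\<And>k. k \<in> Ob (shape Y) \<Longrightarrow> u k \<in> Mor (Ban R) (dob Y k) (T (\<psi> k))" by metis
  have uL: "psi_code (\<psi> k) \<in> Ob (shape L)" "u k \<in> Mor (Ban R) (dob Y k) (dob L (psi_code (\<psi> k)))"
    if "k \<in> Ob (shape Y)" for k
    using \<psi>[OF that] by (auto simp: psi_code_decode)
  define h where "h = (\<lambda>k\<in>Ob (shape Y). germ (Ban R) L (dob Y k) (psi_code (\<psi> k)) (u k))"
  have h_mem: "(a, v) \<in> h k \<longleftrightarrow> a \<in> Ob (shape L) \<and> v \<in> Mor (Ban R) (dob Y k) (dob L a) \<and> v = u k"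
    if "k \<in> Ob (shape Y)" for a v k
    using that L_germ_mem[OF uL[OF that]] by (simp add: h_def)
  have h: "h \<in> Mor (Ind (Ban R)) Y L"
    unfolding Ind_Mor_iff
  proof (intro conjI ballI allI impI)
    show "h \<in> (\<Pi>\<^sub>E k\<in>Ob (shape Y). colim_hom (Ban R) L (dob Y k))"
      unfolding h_def using germ_colim_hom[OF uL] by (simp del: L_simps)
    fix k l a b v
    assume k: "k \<in> Ob (shape Y)" and l: "l \<in> Ob (shape Y)" and a: "a \<in> Mor (shape Y) k l"
      and v: "(b, v) \<in> h l"
    have v': "b \<in> Ob (shape L)" "v \<in> Mor (Ban R) (dob Y l) (dob L b)" "v = u l"
      using v h_mem[OF l] by auto
    have y: "dmor Y k l a \<in> Mor (Ban R) (dob Y k) (dob Y l)" by (rule diagram_simps(3)[OF D k l a])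
    have "compose (carrier (dob Y k)) (u l) (dmor Y k l a) = u k"
    proof (rule extensionalityI)
      fix x assume x: "x \<in> carrier (dob Y k)"
      have "dmor Y k l a x \<in> carrier (dob Y l)" using y x by (auto simp: Ban_Mor_iff)
      moreover have "g i l (dmor Y k l a x) = g i k x" if "i \<ge> 1" for i
        using fun_cong[OF g(3)[OF that k l a], of x] x by (simp add: compose_def)
      ultimately show "compose (carrier (dob Y k)) (u l) (dmor Y k l a) x = u k x"
        using x by (simp add: u_def compose_def cong: restrict_cong)
    qed (auto simp: u_def compose_def)
    moreover have "compose (carrier (dob Y k)) v (dmor Y k l a) \<in> Mor (Ban R) (dob Y k) (dob L b)"
      using cat_comp[OF is_category_Ban, of "dob Y k" R "dob Y l" "dob L b" "dmor Y k l a" v]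
        v' y Yb k l T_banach decode_Psi by simp
    ultimately show "(b, Cmp (Ban R) (dob Y k) (dob Y l) (dob L b) v (dmor Y k l a)) \<in> h k"
      using v' h_mem[OF k] by simp
  qed
  have prj: "to_const L (prj i) \<in> Mor (Ind (Ban R)) L (ind_const (Ban R) (V i))" if "i \<ge> 1" for i
    using is_cone_tower_cone that by (auto simp: is_cone_def tower_cone_def)
  have cmp: "Cmp (Ind (Ban R)) Y L (ind_const (Ban R) (V i)) (tower_cone i) F k =
      {(unat 0, compose (carrier (dob Y k)) (prj i a) v)}"
    if "i \<ge> 1" "F \<in> Mor (Ind (Ban R)) Y L" "k \<in> Ob (shape Y)" "(a, v) \<in> F k" for i F k a v
    using Cmp_to_const[OF Y L_Ob _ that(2) prj[OF that(1)] that(3,4)] V that(1)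
    by (simp add: tower_cone_def)
  show "\<exists>!h. h \<in> Mor (Ind (Ban R)) Y L \<and>
      (\<forall>i\<in>Ob (shape (ind_const_diagram (Ban R) (tower V f))).
        Cmp (Ind (Ban R)) Y L (dob (ind_const_diagram (Ban R) (tower V f)) i) (tower_cone i) h = d i)"
  proof (intro ex1I[of _ h] conjI ballI h)
    fix i assume "i \<in> Ob (shape (ind_const_diagram (Ban R) (tower V f)))"
    then have i: "i \<ge> 1" by simp
    have "Cmp (Ind (Ban R)) Y L (ind_const (Ban R) (V i)) (tower_cone i) h = to_const Y (g i)"
    proof (rule extensionalityI[of _ "Ob (shape Y)"])
      fix k assume k: "k \<in> Ob (shape Y)"
      have "(psi_code (\<psi> k), u k) \<in> h k" using h_mem[OF k] uL[OF k] by blast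
      from cmp[OF i h k this]
      have "Cmp (Ind (Ban R)) Y L (ind_const (Ban R) (V i)) (tower_cone i) h k =
          {(unat 0, compose (carrier (dob Y k)) (prj i (psi_code (\<psi> k))) (u k))}" .
      moreover have "compose (carrier (dob Y k)) (prj i (psi_code (\<psi> k))) (u k) = g i k"
      proof (rule extensionalityI)
        show "g i k \<in> extensional (carrier (dob Y k))"
          using g(2)[OF i k] by (auto simp: Ban_Mor_iff PiE_def)
        fix x assume x: "x \<in> carrier (dob Y k)"
        have "u k x \<in> carrier (T (\<psi> k))" using \<psi>(2)[OF k] x by (auto simp: Ban_Mor_iff)
        then show "compose (carrier (dob Y k)) (prj i (psi_code (\<psi> k))) (u k) x = g i k x"
          using x i psi_code_decode[OF \<psi>(1)[OF k], where 'u = 'u]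
          by (simp add: prj_def compose_def) (simp add: u_def)
      qed (simp add: compose_def)
      ultimately show "Cmp (Ind (Ban R)) Y L (ind_const (Ban R) (V i)) (tower_cone i) h k =
          to_const Y (g i) k" using k by (simp add: to_const_def)
    qed (auto simp: Ind_simps to_const_def)
    then show "Cmp (Ind (Ban R)) Y L (dob (ind_const_diagram (Ban R) (tower V f)) i) (tower_cone i) h = d i"
      using g(1)[OF i] by simp
  next
    fix h' assume h': "h' \<in> Mor (Ind (Ban R)) Y L \<and>
      (\<forall>i\<in>Ob (shape (ind_const_diagram (Ban R) (tower V f))).
        Cmp (Ind (Ban R)) Y L (dob (ind_const_diagram (Ban R) (tower V f)) i) (tower_cone i) h' = d i)"
    then have h'M: "h' \<in> Mor (Ind (Ban R)) Y L" by blast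
    show "h' = h"
    proof (rule Ind_Mor_eqI[OF Y L_Ob h'M h])
      fix k assume k: "k \<in> Ob (shape Y)"
      obtain a v where av: "(a, v) \<in> h' k" using Ind_MorD(2)[OF Y L_Ob h'M k] by blast
      have a: "a \<in> Ob (shape L)" and v: "v \<in> Mor (Ban R) (dob Y k) (dob L a)"
        using Ind_MorD(3,5)[OF Y L_Ob h'M k av] by auto
      have "compose (carrier (dob Y k)) (prj i a) v = g i k" if i: "i \<ge> 1" for i
      proof -
        have "Cmp (Ind (Ban R)) Y L (ind_const (Ban R) (V i)) (tower_cone i) h' = to_const Y (g i)"
          using h' g(1)[OF i] i by simp
        then show ?thesis using cmp[OF i h'M k av] k by (simp add: to_const_def)
      qed
      then have "v = u k"
        using v a decode_Psi[of a]
        by (intro T_mor_eqI[of "psi_decode a" v _ "u k" "\<lambda>i. g i k"]) (auto simp: u_def prj_def)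
      then have "(a, v) \<in> h k" using h_mem[OF k] a v by blast
      then show "\<exists>p. p \<in> h' k \<and> p \<in> h k" using av by blast
    qed
  qed
qed

end


section \<open>Countable limits of Banach modules are metrizable\<close>

text \<open>The one-element module, with the arbitrary element \<open>unat 0\<close> of the universe.\<close>

definition zero_module :: "('r, 'u::universe) normed_module" where
  "zero_module = \<lparr>carrier = {unat 0}, mult = undefined, one = undefined, zero = unat 0,
     add = (\<lambda>_ _. unat 0), smult = (\<lambda>_ _. unat 0), mnorm = (\<lambda>_. 0)\<rparr>"

lemma zero_module_simps [simp]:
  "carrier zero_module = {unat 0}" "\<zero>\<^bsub>zero_module\<^esub> = unat 0"
  "x \<oplus>\<^bsub>zero_module\<^esub> y = unat 0" "a \<odot>\<^bsub>zero_module\<^esub> x = unat 0" "mnorm zero_module x = 0"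
  by (simp_all add: zero_module_def)

lemma smult_bound_zero_module: "K > 0 \<Longrightarrow> smult_bound R zero_module K"
  by (simp add: smult_bound_def)

lemma banach_module_zero_module:
  assumes "banach_ring R"
  shows "banach_module R zero_module"
proof -
  have "abelian_group zero_module" by (rule abelian_groupI) auto
  then have "module R zero_module"
    by (intro moduleI) (auto simp: banach_ringD(1)[OF assms])
  moreover have "complete_norm zero_module (mnorm zero_module)"
    by (simp add: complete_norm_def)
  ultimately show ?thesis using smult_bound_zero_module[of 1 R] unfolding banach_module_iff by auto
qed

lemma zero_map_Mor:
  assumes "banach_module R X"
  shows "(\<lambda>x\<in>carrier X. unat 0) \<in> Mor (Ban R) X zero_module"
  using banach_moduleD(8,11)[OF assms] by (auto simp: Ban_Mor_iff intro!: exI[of _ 0])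

text \<open>
  Countably many cones \<open>\<gamma> n\<close> over \<open>D\<close>, with apex \<open>X n\<close>, all factor through one cone \<open>d\<close>, and the
  factorisations are compatible with all morphisms of cones.
\<close>

lemma weighted_cone:
  fixes R :: "'r normed_ring" and D :: "(nat, 'a, ('r, 'u::universe) normed_module, 'u \<Rightarrow> 'u) diagram"
    and X :: "nat \<Rightarrow> ('r, 'u) normed_module"
  assumes R: "banach_ring R" and D: "ind_setting.well_typed (Ban R) D"
    and X: "\<And>n. n \<in> N \<Longrightarrow> banach_module R (X n)"
    and \<gamma>: "\<And>n i. n \<in> N \<Longrightarrow> i \<in> Ob (shape D) \<Longrightarrow> \<gamma> n i \<in> Mor (Ban R) (X n) (dob D i)"
    and cone: "\<And>n i j a. n \<in> N \<Longrightarrow> i \<in> Ob (shape D) \<Longrightarrow> j \<in> Ob (shape D) \<Longrightarrow>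
      a \<in> Mor (shape D) i j \<Longrightarrow> compose (carrier (X n)) (dmor D i j a) (\<gamma> n i) = \<gamma> n j"
  obtains Y d u where "banach_module R Y"
    "\<And>i. i \<in> Ob (shape D) \<Longrightarrow> d i \<in> Mor (Ban R) Y (dob D i)"
    "\<And>i j a. i \<in> Ob (shape D) \<Longrightarrow> j \<in> Ob (shape D) \<Longrightarrow>
      a \<in> Mor (shape D) i j \<Longrightarrow> compose (carrier Y) (dmor D i j a) (d i) = d j"
    "\<And>n. n \<in> N \<Longrightarrow> u n \<in> Mor (Ban R) (X n) Y"
    "\<And>n i. n \<in> N \<Longrightarrow> i \<in> Ob (shape D) \<Longrightarrow> compose (carrier (X n)) (d i) (u n) = \<gamma> n i"
    "\<And>n m \<theta>. n \<in> N \<Longrightarrow> m \<in> N \<Longrightarrow> \<theta> \<in> Mor (Ban R) (X n) (X m) \<Longrightarrow>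
      (\<And>i. i \<in> Ob (shape D) \<Longrightarrow> compose (carrier (X n)) (\<gamma> m i) \<theta> = \<gamma> n i) \<Longrightarrow>
      compose (carrier (X n)) (u m) \<theta> = u n"
proof -
  let ?I = "Ob (shape D)"
  have Db: "banach_module R (dob D i)" if "i \<in> ?I" for i
    using D that by (auto simp: ind_setting.well_typed_def[OF ind_setting.intro[OF is_category_Ban]])
  have Dm: "dmor D i j a \<in> Mor (Ban R) (dob D i) (dob D j)"
    if "i \<in> ?I" "j \<in> ?I" "a \<in> Mor (shape D) i j" for i j a
    using D that by (auto simp: ind_setting.well_typed_def[OF ind_setting.intro[OF is_category_Ban]])
  obtain K where K: "\<And>M :: ('r, 'u) normed_module. banach_module R M \<Longrightarrow>
      equivalent_norm M (uniform_norm R M) \<and>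
      banach_module R (M\<lparr>mnorm := uniform_norm R M\<rparr>) \<and>
      smult_bound R (M\<lparr>mnorm := uniform_norm R M\<rparr>) K"
    using uniform_renorming[OF R] by blast
  have K0: "K > 0"
    using K[OF banach_module_zero_module[OF R]] by (simp add: smult_bound_def)
  \<comment> \<open>The zero module outside the shape makes the index set nonempty.\<close>
  define W where "W i = (if i \<in> ?I then (dob D i)\<lparr>mnorm := uniform_norm R (dob D i)\<rparr> else zero_module)"
    for i
  define E where "E = {(i, j, dmor D i j a) | i j a. i \<in> ?I \<and> j \<in> ?I \<and> a \<in> Mor (shape D) i j}"
  have W_Mor: "Mor (Ban R) Z (W i) = Mor (Ban R) Z (dob D i)"
    "Mor (Ban R) (W i) Z = Mor (Ban R) (dob D i) Z" if "i \<in> ?I" for i Z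
    using K[OF Db[OF that]] Db[OF that] that by (simp_all add: W_def
      Ban_Mor_equivalent_norm_cod[of "dob D i"] Ban_Mor_equivalent_norm_dom[of "dob D i"])
  have W: "banach_module R (W i)" "smult_bound R (W i) K" for i
    using K[OF Db] K0 banach_module_zero_module[OF R] smult_bound_zero_module by (auto simp: W_def)
  interpret W: compat_setting R UNIV W E K
  proof
    show "UNIV \<noteq> ({} :: nat set)" "banach_module R (W i)" "smult_bound R (W i) K" for i
      using W by auto
    show "i \<in> UNIV \<and> j \<in> UNIV \<and> g \<in> Mor (Ban R) (W i) (W j)" if "(i, j, g) \<in> E" for i j g
      using that Dm by (auto simp: E_def W_Mor)
  qed
  define g where "g n i = (if i \<in> ?I then \<gamma> n i else (\<lambda>x\<in>carrier (X n). unat 0))" for n i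
  have g_Mor: "g n i \<in> Mor (Ban R) (X n) (W i)" if "n \<in> N" for n i
    using \<gamma>[OF that] zero_map_Mor[OF X[OF that]]
    by (cases "i \<in> ?I") (simp_all add: g_def W_Mor, simp add: W_def)
  have "\<exists>B. B \<ge> 0 \<and> (\<forall>x\<in>carrier (X n). mnorm (W i) (g n i x) \<le> B * mnorm (X n) x)"
    if "n \<in> N" for n i
    using Ban_MorE[OF g_Mor[OF that] X[OF that]] by (metis less_imp_le)
  then obtain B where B: "\<And>n i. n \<in> N \<Longrightarrow> B n i \<ge> 0"
    "\<And>n i x. n \<in> N \<Longrightarrow> x \<in> carrier (X n) \<Longrightarrow> mnorm (W i) (g n i x) \<le> B n i * mnorm (X n) x"
    by metis
  obtain \<psi> :: "nat \<Rightarrow> nat" and L :: "nat \<Rightarrow> real" where \<psi>: "\<And>i. \<psi> i \<ge> 1"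
    and L: "\<And>n i. (if n \<in> N then B n i else 0) \<le> L n * real (\<psi> i)"
    by (rule dominating_weight[of "\<lambda>n i. if n \<in> N then B n i else 0"], use B(1) in simp, rule that)
  have \<psi>0: "inverse (real (\<psi> i)) > 0" for i using \<psi>[of i] by simp
  let ?W = "\<lambda>i. rescale (inverse (real (\<psi> i))) (W i)"
  interpret Y: compat_setting R UNIV ?W E K
    by (rule W.compat_setting_rescale) (rule \<psi>0)
  have Y_Mor: "Mor (Ban R) Z (?W i) = Mor (Ban R) Z (W i)" for Z i
    using \<psi>0 W(1) by (rule Ban_Mor_rescale(1))
  let ?Y = "compat_module UNIV ?W E"
  define d where "d i = (\<lambda>t\<in>carrier ?Y. uproj t i)" for i
  define u where "u n = (\<lambda>x\<in>carrier (X n). utuple (\<lambda>i\<in>UNIV. g n i x))" for n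
  have compat: "h (g n i x) = g n j x" if "(i, j, h) \<in> E" "n \<in> N" "x \<in> carrier (X n)" for i j h n x
    using that fun_cong[OF cone, of n i j _ x] by (auto simp: E_def g_def compose_def)
  have u_Mor: "u n \<in> Mor (Ban R) (X n) ?Y" if n: "n \<in> N" for n
    unfolding u_def
  proof (rule Y.tuple_Mor[OF X[OF n]])
    show "g n i \<in> Mor (Ban R) (X n) (?W i)" for i using g_Mor[OF n] by (simp add: Y_Mor)
    show "h (g n i x) = g n j x" if "(i, j, h) \<in> E" "x \<in> carrier (X n)" for i j h x
      using compat[OF that(1) n that(2)] .
    fix i x assume x: "x \<in> carrier (X n)"
    have "mnorm (W i) (g n i x) \<le> B n i * mnorm (X n) x" by (rule B(2)[OF n x])
    also have "\<dots> \<le> (L n * real (\<psi> i)) * mnorm (X n) x"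
      using L[of n i] n banach_moduleD(5)[OF X[OF n] x] by (intro mult_right_mono) auto
    finally have "inverse (real (\<psi> i)) * mnorm (W i) (g n i x) \<le>
        inverse (real (\<psi> i)) * ((L n * real (\<psi> i)) * mnorm (X n) x)"
      by (intro mult_left_mono) auto
    then show "mnorm (?W i) (g n i x) \<le> L n * mnorm (X n) x"
      using \<psi>[of i] by (simp add: field_simps)
  qed
  show ?thesis
  proof (rule that)
    show "banach_module R ?Y" by (rule Y.banach_module_compat[OF R])
    show "d i \<in> Mor (Ban R) ?Y (dob D i)" if "i \<in> ?I" for i
      using Y.projection_Mor[OF R, of i] that by (simp add: d_def Y_Mor W_Mor)
    show "compose (carrier ?Y) (dmor D i j a) (d i) = d j"
      if "i \<in> ?I" "j \<in> ?I" "a \<in> Mor (shape D) i j" for i j a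
    proof (rule extensionalityI)
      fix t assume t: "t \<in> carrier ?Y"
      have "(i, j, dmor D i j a) \<in> E" using that by (auto simp: E_def)
      then show "compose (carrier ?Y) (dmor D i j a) (d i) t = d j t"
        using Y.carrierD(3)[OF t] t by (simp add: d_def compose_def)
    qed (auto simp: d_def)
    show "u n \<in> Mor (Ban R) (X n) ?Y" if "n \<in> N" for n using u_Mor[OF that] .
    show "compose (carrier (X n)) (d i) (u n) = \<gamma> n i" if n: "n \<in> N" and i: "i \<in> ?I" for n i
    proof (rule extensionalityI)
      show "\<gamma> n i \<in> extensional (carrier (X n))" using \<gamma>[OF n i] by (auto simp: Ban_Mor_iff PiE_def)
      fix x assume x: "x \<in> carrier (X n)"
      have "u n x \<in> carrier ?Y" using u_Mor[OF n] x by (auto simp: Ban_Mor_iff)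
      then show "compose (carrier (X n)) (d i) (u n) x = \<gamma> n i x"
        using x i by (simp add: d_def compose_def) (simp add: u_def g_def)
    qed auto
    show "compose (carrier (X n)) (u m) \<theta> = u n"
      if n: "n \<in> N" and m: "m \<in> N" and \<theta>: "\<theta> \<in> Mor (Ban R) (X n) (X m)"
        and eq: "\<And>i. i \<in> ?I \<Longrightarrow> compose (carrier (X n)) (\<gamma> m i) \<theta> = \<gamma> n i" for n m \<theta>
    proof (rule extensionalityI)
      fix x assume x: "x \<in> carrier (X n)"
      have \<theta>x: "\<theta> x \<in> carrier (X m)" using \<theta> x by (auto simp: Ban_Mor_iff)
      have "g m i (\<theta> x) = g n i x" for i
        using fun_cong[OF eq, of i x] x \<theta>x by (auto simp: g_def compose_def)
      then show "compose (carrier (X n)) (u m) \<theta> x = u n x"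
        using x \<theta>x by (simp add: u_def compose_def)
    qed (auto simp: u_def)
  qed
qed

text \<open>
  In the proof, \<open>(X n, \<phi> n)\<close> are the objects of a countable diagram over \<open>F\<close>, and \<open>\<gamma> n i\<close> is the map
  in \<open>Ban R\<close> underlying \<open>\<pi> i \<circ> \<phi> n\<close>.
\<close>

lemma metrizable_limit:
  fixes R :: "'r normed_ring" and D :: "(nat, 'a, ('r, 'u::universe) normed_module, 'u \<Rightarrow> 'u) diagram"
    and F :: "('u, ('r, 'u) normed_module, 'u \<Rightarrow> 'u) ind_ob"
  assumes R: "banach_ring R" and D: "ind_setting.well_typed (Ban R) D"
    and lim: "is_limit (Ind (Ban R)) (ind_const_diagram (Ban R) D) F \<pi>"
  shows "metrizable (Ban R) F"
proof -
  interpret ind_setting "Ban R" by standard (rule is_category_Ban)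
  note Ic = is_category_Ind and DI = ind_const_diagram_typed[OF D]
  have F: "F \<in> Ob (Ind (Ban R))"
    and cone: "is_cone (Ind (Ban R)) (ind_const_diagram (Ban R) D) F \<pi>"
    using lim by (auto simp: is_limit_def is_cone_def)
  have \<pi>: "\<pi> i \<in> Mor (Ind (Ban R)) F (ind_const (Ban R) (dob D i))" if "i \<in> Ob (shape D)" for i
    using cone that by (auto simp: is_cone_def)
  have Db: "dob D i \<in> Ob (Ban R)" if "i \<in> Ob (shape D)" for i
    using D that unfolding well_typed_def by blast
  have "\<exists>x c. is_cocone (over_cat (Ban R) F) G x c"
    if G: "is_diagram (over_cat (Ban R) F) G"
    for G :: "(nat, nat, ('r, 'u) normed_module \<times> ('u, 'u \<Rightarrow> 'u) ind_mor, 'u \<Rightarrow> 'u) diagram"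
  proof -
    let ?N = "Ob (shape G)"
    define X where "X n = fst (dob G n)" for n
    define \<phi> where "\<phi> n = snd (dob G n)" for n
    have G_ob: "dob G n = (X n, \<phi> n)" for n by (simp add: X_def \<phi>_def)
    have X: "X n \<in> Ob (Ban R)" and \<phi>: "\<phi> n \<in> Mor (Ind (Ban R)) (ind_const (Ban R) (X n)) F"
      if "n \<in> ?N" for n
      using diagram_simps(2)[OF G that] by (auto simp: over_cat_def G_ob)
    have X': "ind_const (Ban R) (X n) \<in> Ob (Ind (Ban R))" if "n \<in> ?N" for n
      using ind_const_Ob[OF X[OF that]] .
    have G_mor: "dmor G n m a \<in> Mor (Ban R) (X n) (X m)"
      "Cmp (Ind (Ban R)) (ind_const (Ban R) (X n)) (ind_const (Ban R) (X m)) F (\<phi> m)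
        (ind_const_mor (Ban R) (X n) (X m) (dmor G n m a)) = \<phi> n"
      if "n \<in> ?N" "m \<in> ?N" "a \<in> Mor (shape G) n m" for n m a
      using diagram_simps(3)[OF G that] by (auto simp: over_cat_def G_ob)
    have "\<exists>\<gamma>. (\<forall>i\<in>Ob (shape D). \<gamma> i \<in> Mor (Ban R) (X n) (dob D i) \<and>
          Cmp (Ind (Ban R)) (ind_const (Ban R) (X n)) F (ind_const (Ban R) (dob D i)) (\<pi> i) (\<phi> n) =
            ind_const_mor (Ban R) (X n) (dob D i) (\<gamma> i)) \<and>
        (\<forall>i\<in>Ob (shape D). \<forall>j\<in>Ob (shape D). \<forall>a\<in>Mor (shape D) i j.
          compose (carrier (X n)) (dmor D i j a) (\<gamma> i) = \<gamma> j)" if n: "n \<in> ?N" for n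
    proof -
      have c: "is_cone (Ind (Ban R)) (ind_const_diagram (Ban R) D) (ind_const (Ban R) (X n))
          (\<lambda>i. Cmp (Ind (Ban R)) (ind_const (Ban R) (X n)) F (dob (ind_const_diagram (Ban R) D) i)
            (\<pi> i) (\<phi> n))"
        by (rule is_cone_restrict[OF Ic cone DI X'[OF n] \<phi>[OF n]])
      obtain g where g0: "\<And>i. i \<in> Ob (shape D) \<Longrightarrow>
          Cmp (Ind (Ban R)) (ind_const (Ban R) (X n)) F (ind_const (Ban R) (dob D i)) (\<pi> i) (\<phi> n) =
            to_const (ind_const (Ban R) (X n)) (g i)"
        "\<And>i k. i \<in> Ob (shape D) \<Longrightarrow> k = unat 0 \<Longrightarrow> g i k \<in> Mor (Ban R) (X n) (dob D i)"
        "\<And>i j a k. i \<in> Ob (shape D) \<Longrightarrow> j \<in> Ob (shape D) \<Longrightarrow> a \<in> Mor (shape D) i j \<Longrightarrow>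
          k = unat 0 \<Longrightarrow> compose (carrier (X n)) (dmor D i j a) (g i k) = g j k"
        by (rule cone_to_constE[OF D c], rule that) simp_all
      note g = g0(1) g0(2)[OF _ refl] g0(3)[OF _ _ _ refl]
      have "to_const (ind_const (Ban R) (X n)) (g i) = ind_const_mor (Ban R) (X n) (dob D i) (g i (unat 0))"
        if "i \<in> Ob (shape D)" for i
        by (subst ind_const_mor_to_const[OF X[OF n] Db[OF that] g(2)[OF that]])
          (simp add: to_const_eq_iff)
      then show ?thesis using g by (intro exI[of _ "\<lambda>i. g i (unat 0)"]) auto
    qed
    then obtain \<gamma> where \<gamma>: "\<And>n i. n \<in> ?N \<Longrightarrow> i \<in> Ob (shape D) \<Longrightarrow> \<gamma> n i \<in> Mor (Ban R) (X n) (dob D i)"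
      "\<And>n i. n \<in> ?N \<Longrightarrow> i \<in> Ob (shape D) \<Longrightarrow>
          Cmp (Ind (Ban R)) (ind_const (Ban R) (X n)) F (ind_const (Ban R) (dob D i)) (\<pi> i) (\<phi> n) =
            ind_const_mor (Ban R) (X n) (dob D i) (\<gamma> n i)"
      "\<And>n i j a. n \<in> ?N \<Longrightarrow> i \<in> Ob (shape D) \<Longrightarrow> j \<in> Ob (shape D) \<Longrightarrow> a \<in> Mor (shape D) i j \<Longrightarrow>
          compose (carrier (X n)) (dmor D i j a) (\<gamma> n i) = \<gamma> n j"
      by metis
    have Xb: "banach_module R (X n)" if "n \<in> ?N" for n using X[OF that] by simp
    obtain Y d u where Yb: "banach_module R Y"
      and d: "\<And>i. i \<in> Ob (shape D) \<Longrightarrow> d i \<in> Mor (Ban R) Y (dob D i)"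
        "\<And>i j a. i \<in> Ob (shape D) \<Longrightarrow> j \<in> Ob (shape D) \<Longrightarrow>
          a \<in> Mor (shape D) i j \<Longrightarrow> compose (carrier Y) (dmor D i j a) (d i) = d j"
      and u: "\<And>n. n \<in> ?N \<Longrightarrow> u n \<in> Mor (Ban R) (X n) Y"
        "\<And>n i. n \<in> ?N \<Longrightarrow> i \<in> Ob (shape D) \<Longrightarrow> compose (carrier (X n)) (d i) (u n) = \<gamma> n i"
        "\<And>n m \<theta>. n \<in> ?N \<Longrightarrow> m \<in> ?N \<Longrightarrow> \<theta> \<in> Mor (Ban R) (X n) (X m) \<Longrightarrow>
          (\<And>i. i \<in> Ob (shape D) \<Longrightarrow> compose (carrier (X n)) (\<gamma> m i) \<theta> = \<gamma> n i) \<Longrightarrow>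
          compose (carrier (X n)) (u m) \<theta> = u n"
      by (rule weighted_cone[OF R D Xb \<gamma>(1) \<gamma>(3)]) blast+
    have Y: "Y \<in> Ob (Ban R)" using Yb by simp
    note Y' = ind_const_Ob[OF Y]
    have cY: "is_cone (Ind (Ban R)) (ind_const_diagram (Ban R) D) (ind_const (Ban R) Y)
        (\<lambda>i. ind_const_mor (Ban R) Y (dob D i) (d i))"
    proof (rule cone_to_constI[OF D Y', of _ "\<lambda>i _. d i"])
      show "ind_const_mor (Ban R) Y (dob D i) (d i) = to_const (ind_const (Ban R) Y) (\<lambda>_. d i)"
        if "i \<in> Ob (shape D)" for i
        by (rule ind_const_mor_to_const[OF Y Db[OF that] d(1)[OF that]])
      show "Cmp (Ban R) (dob (ind_const (Ban R) Y) k) (dob (ind_const (Ban R) Y) l) (dob D i) (d i)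
          (dmor (ind_const (Ban R) Y) k l a) = d i" if "i \<in> Ob (shape D)" for i k l a
        using cat_id_right[OF is_category_Ban Y Db[OF that] d(1)[OF that]] by simp
    qed (use d in simp_all)
    define h where "h = limit_lift (Ind (Ban R)) (ind_const_diagram (Ban R) D) F \<pi> (ind_const (Ban R) Y)
        (\<lambda>i. ind_const_mor (Ban R) Y (dob D i) (d i))"
    have h: "h \<in> Mor (Ind (Ban R)) (ind_const (Ban R) Y) F"
      "\<And>i. i \<in> Ob (shape D) \<Longrightarrow> Cmp (Ind (Ban R)) (ind_const (Ban R) Y) F (ind_const (Ban R) (dob D i))
        (\<pi> i) h = ind_const_mor (Ban R) Y (dob D i) (d i)"
      using is_limit_lift[OF lim cY] unfolding h_def by simp_all
    have uh: "Cmp (Ind (Ban R)) (ind_const (Ban R) (X n)) (ind_const (Ban R) Y) F h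
        (ind_const_mor (Ban R) (X n) Y (u n)) = \<phi> n" if n: "n \<in> ?N" for n
    proof (rule is_limit_mor_eqI[OF Ic lim DI X'[OF n] _ \<phi>[OF n]])
      have uM: "ind_const_mor (Ban R) (X n) Y (u n) \<in>
          Mor (Ind (Ban R)) (ind_const (Ban R) (X n)) (ind_const (Ban R) Y)"
        using ind_const_mor_Mor[OF X[OF n] Y u(1)[OF n]] .
      then show "Cmp (Ind (Ban R)) (ind_const (Ban R) (X n)) (ind_const (Ban R) Y) F h
        (ind_const_mor (Ban R) (X n) Y (u n)) \<in> Mor (Ind (Ban R)) (ind_const (Ban R) (X n)) F"
        using h(1) by (rule cat_comp[OF Ic X'[OF n] Y' F])
      fix i assume "i \<in> Ob (shape (ind_const_diagram (Ban R) D))"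
      then have i: "i \<in> Ob (shape D)" by simp
      have "Cmp (Ind (Ban R)) (ind_const (Ban R) (X n)) F (ind_const (Ban R) (dob D i)) (\<pi> i)
          (Cmp (Ind (Ban R)) (ind_const (Ban R) (X n)) (ind_const (Ban R) Y) F h
            (ind_const_mor (Ban R) (X n) Y (u n))) =
        Cmp (Ind (Ban R)) (ind_const (Ban R) (X n)) (ind_const (Ban R) Y) (ind_const (Ban R) (dob D i))
          (ind_const_mor (Ban R) Y (dob D i) (d i)) (ind_const_mor (Ban R) (X n) Y (u n))"
        using cat_assoc[OF Ic X'[OF n] Y' F ind_const_Ob[OF Db[OF i]] uM h(1) \<pi>[OF i]] h(2)[OF i]
        by simp
      also have "\<dots> = ind_const_mor (Ban R) (X n) (dob D i) (\<gamma> n i)"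
        using ind_const_mor_comp[OF X[OF n] Y Db[OF i] u(1)[OF n] d(1)[OF i]] u(2)[OF n i] by simp
      finally show "Cmp (Ind (Ban R)) (ind_const (Ban R) (X n)) F
          (dob (ind_const_diagram (Ban R) D) i) (\<pi> i)
          (Cmp (Ind (Ban R)) (ind_const (Ban R) (X n)) (ind_const (Ban R) Y) F h
            (ind_const_mor (Ban R) (X n) Y (u n))) =
        Cmp (Ind (Ban R)) (ind_const (Ban R) (X n)) F
          (dob (ind_const_diagram (Ban R) D) i) (\<pi> i) (\<phi> n)"
        using \<gamma>(2)[OF n i] by simp
    qed
    have "compose (carrier (X n)) (u m) (dmor G n m a) = u n"
      if n: "n \<in> ?N" and m: "m \<in> ?N" and a: "a \<in> Mor (shape G) n m" for n m a
    proof (rule u(3)[OF n m G_mor(1)[OF n m a]])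
      fix i assume i: "i \<in> Ob (shape D)"
      note \<theta> = G_mor[OF n m a]
      have \<theta>M: "ind_const_mor (Ban R) (X n) (X m) (dmor G n m a) \<in>
          Mor (Ind (Ban R)) (ind_const (Ban R) (X n)) (ind_const (Ban R) (X m))"
        using ind_const_mor_Mor[OF X[OF n] X[OF m] \<theta>(1)] .
      have c: "compose (carrier (X n)) (\<gamma> m i) (dmor G n m a) \<in> Mor (Ban R) (X n) (dob D i)"
        using cat_comp[OF is_category_Ban X[OF n] X[OF m] Db[OF i] \<theta>(1) \<gamma>(1)[OF m i]] by simp
      have "ind_const_mor (Ban R) (X n) (dob D i) (compose (carrier (X n)) (\<gamma> m i) (dmor G n m a)) =
          Cmp (Ind (Ban R)) (ind_const (Ban R) (X n)) (ind_const (Ban R) (X m)) (ind_const (Ban R) (dob D i))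
            (Cmp (Ind (Ban R)) (ind_const (Ban R) (X m)) F (ind_const (Ban R) (dob D i)) (\<pi> i) (\<phi> m))
            (ind_const_mor (Ban R) (X n) (X m) (dmor G n m a))"
        by (simp only: \<gamma>(2)[OF m i] Ban_simps
          ind_const_mor_comp[OF X[OF n] X[OF m] Db[OF i] \<theta>(1) \<gamma>(1)[OF m i]])
      also have "\<dots> = Cmp (Ind (Ban R)) (ind_const (Ban R) (X n)) F (ind_const (Ban R) (dob D i)) (\<pi> i) (\<phi> n)"
        using cat_assoc[OF Ic X'[OF n] X'[OF m] F ind_const_Ob[OF Db[OF i]] \<theta>M \<phi>[OF m] \<pi>[OF i]] \<theta>(2)
        by simp
      also have "\<dots> = ind_const_mor (Ban R) (X n) (dob D i) (\<gamma> n i)" by (rule \<gamma>(2)[OF n i])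
      finally show "compose (carrier (X n)) (\<gamma> m i) (dmor G n m a) = \<gamma> n i"
        by (simp only: ind_const_mor_inject[OF X[OF n] Db[OF i] c \<gamma>(1)[OF n i]])
    qed
    then have "is_cocone (over_cat (Ban R) F) G (Y, h) u"
      using Y h(1) u(1) uh unfolding is_cocone_def by (simp add: over_cat_def G_ob)
    then show ?thesis by blast
  qed
  then show ?thesis using F unfolding metrizable_def aleph1_filtered_def by blast
qed

lemma frechet_metrizable:
  fixes R :: "'r normed_ring" and F :: "('u::universe, ('r, 'u) normed_module, 'u \<Rightarrow> 'u) ind_ob"
  assumes "banach_ring R" "frechet (Ban R) F"
  shows "metrizable (Ban R) F"
proof -
  obtain D :: "(nat, nat, ('r, 'u) normed_module, 'u \<Rightarrow> 'u) diagram" and \<pi>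
    where D: "is_diagram (Ban R) D" and lim: "is_limit (Ind (Ban R)) (ind_const_diagram (Ban R) D) F \<pi>"
    using assms(2) unfolding frechet_def by blast
  interpret ind_setting "Ban R" by standard (rule is_category_Ban)
  have "well_typed D" unfolding well_typed_def using diagram_simps(2,3)[OF D] by blast
  then show ?thesis by (rule metrizable_limit[OF assms(1) _ lim])
qed

text \<open>A common constant for the factors is obtained from families supported at one index.\<close>

lemma smult_bound_of_ban_prod:
  fixes V :: "nat \<Rightarrow> ('r, 'u::universe) normed_module"
  assumes P: "banach_module R (ban_prod I V)" and V: "\<And>i. i \<in> I \<Longrightarrow> banach_module R (V i)"
    and K: "smult_bound R (ban_prod I V) K" and i: "i \<in> I" and R: "banach_ring R"
  shows "smult_bound R (V i) K"
  unfolding smult_bound_def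
proof (intro conjI ballI)
  show K0: "K > 0" using K by (simp add: smult_bound_def)
  fix a x assume a: "a \<in> carrier R" and x: "x \<in> carrier (V i)"
  define t where "t = utuple (\<lambda>j\<in>I. if j = i then x else \<zero>\<^bsub>V j\<^esub>)"
  have le: "mnorm (V j) (if j = i then x else \<zero>\<^bsub>V j\<^esub>) \<le> mnorm (V i) x" if "j \<in> I" for j
    using banach_moduleD(7)[OF V[OF that]] banach_moduleD(5)[OF V[OF i] x] by simp
  have t: "t \<in> carrier (ban_prod I V)"
    unfolding t_def by (rule ban_prod_carrierI[OF _ le]) (use x banach_moduleD(4)[OF V] in auto)
  have at: "a \<odot>\<^bsub>ban_prod I V\<^esub> t \<in> carrier (ban_prod I V)" using banach_moduleD(11)[OF P a t] .
  have "mnorm (V i) (a \<odot>\<^bsub>V i\<^esub> x) \<le> mnorm (ban_prod I V) (a \<odot>\<^bsub>ban_prod I V\<^esub> t)"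
    using ban_prod_carrierD(2)[OF at i] i by (simp add: t_def)
  also have "\<dots> \<le> K * rnorm R a * mnorm (ban_prod I V) t"
    using K a t by (simp add: smult_bound_def)
  also have "\<dots> \<le> K * rnorm R a * mnorm (V i) x"
  proof (rule mult_left_mono)
    show "mnorm (ban_prod I V) t \<le> mnorm (V i) x"
      using i le by (intro ban_prod_norm_le) (auto simp: t_def)
    show "0 \<le> K * rnorm R a" using K0 banach_ringD(2)[OF R a] by simp
  qed
  finally show "mnorm (V i) (a \<odot>\<^bsub>V i\<^esub> x) \<le> K * rnorm R a * mnorm (V i) x" .
qed

theorem corollary5p13:
  fixes R :: "'r normed_ring"
    and V :: "nat \<Rightarrow> ('r, 'u::universe) normed_module"
    and f :: "nat \<Rightarrow> 'u \<Rightarrow> 'u"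
  assumes "banach_ring R"
    and "\<forall>i\<ge>1. V i \<in> Ob (Ban R)"
    and "\<forall>i\<ge>1. f i \<in> Mor (Ban_le1 R) (V (i + 1)) (V i)"
  shows "(\<exists>(L :: ('u, ('r, 'u) normed_module, 'u \<Rightarrow> 'u) ind_ob) \<pi>.
             is_limit (Ind (Ban R)) (ind_const_diagram (Ban R) (tower V f)) L \<pi>) \<and>
         (\<forall>(L :: ('u, ('r, 'u) normed_module, 'u \<Rightarrow> 'u) ind_ob) \<pi>.
             is_limit (Ind (Ban R)) (ind_const_diagram (Ban R) (tower V f)) L \<pi> \<longrightarrow>
               (ban_prod {1..} V \<in> Ob (Ban R) \<longrightarrow>
                  is_cone (Ind (Ban R)) (ind_const_diagram (Ban R) (tower V f))
                    (tower_colim V f) (tower_proj R V f) \<and>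
                  is_isomorphism (Ind (Ban R)) (tower_colim V f) L
                    (limit_lift (Ind (Ban R)) (ind_const_diagram (Ban R) (tower V f)) L \<pi>
                       (tower_colim V f) (tower_proj R V f))) \<and>
               metrizable (Ban R) L) \<and>
         (\<forall>F :: ('u, ('r, 'u) normed_module, 'u \<Rightarrow> 'u) ind_ob.
             frechet (Ban R) F \<longrightarrow> metrizable (Ban R) F)"
proof -
  have V: "banach_module R (V i)" if "i \<ge> 1" for i using assms(2) that by simp
  have f: "f i \<in> Mor (Ban R) (V (i + 1)) (V i)" if "i \<ge> 1" for i
  proof -
    have "f i \<in> linear_maps R (V (i + 1)) (V i) \<and>
        (\<forall>x\<in>carrier (V (i + 1)). mnorm (V i) (f i x) \<le> 1 * mnorm (V (i + 1)) x)"
      using assms(3) that by (simp add: Ban_le1_def)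
    then show ?thesis unfolding Ban_def by (auto intro!: exI[of _ 1])
  qed
  obtain K where K: "\<And>M :: ('r, 'u) normed_module. banach_module R M \<Longrightarrow>
      equivalent_norm M (uniform_norm R M) \<and>
      banach_module R (M\<lparr>mnorm := uniform_norm R M\<rparr>) \<and>
      smult_bound R (M\<lparr>mnorm := uniform_norm R M\<rparr>) K"
    using uniform_renorming[OF assms(1)] by blast
  \<comment> \<open>The kernels for the renormed modules give a limit without a condition on the constants.\<close>
  interpret U: tower_setting R V f "\<lambda>i. uniform_norm R (V i)" K
    by standard (use assms(1) V f K in auto)
  let ?D = "ind_const_diagram (Ban R) (tower V f)"
  have ex: "\<exists>(L :: ('u, ('r, 'u) normed_module, 'u \<Rightarrow> 'u) ind_ob) \<pi>. is_limit (Ind (Ban R)) ?D L \<pi>"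
    using U.is_limit_tower_cone by blast
  have met: "metrizable (Ban R) L" if "is_limit (Ind (Ban R)) ?D L \<pi>"
    for L :: "('u, ('r, 'u) normed_module, 'u \<Rightarrow> 'u) ind_ob" and \<pi>
    using metrizable_limit[OF assms(1) U.tower_typed that] .
  have colim: "is_limit (Ind (Ban R)) ?D (tower_colim V f) (tower_proj R V f)"
    if P: "ban_prod {1..} V \<in> Ob (Ban R)"
  proof -
    obtain C where C: "smult_bound R (ban_prod {1..} V) C" using P by (auto simp: banach_module_iff)
    have eq: "equivalent_norm (V i) (mnorm (V i))" for i
      unfolding equivalent_norm_def by (intro exI[of _ 1]) simp
    \<comment> \<open>Here the original norms have a common constant.\<close>
    interpret N: tower_setting R V f "\<lambda>i. mnorm (V i)" C
      by standard (use assms(1) V f eq P C smult_bound_of_ban_prod[of R "{1..}" V C] in auto)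
    have W: "N.W = V" by (simp add: N.W_def fun_eq_iff)
    have "tower_proj R V f i = N.tower_cone i" if i: "i \<ge> 1" for i
    proof -
      have "germ (Ban R) (ind_const (Ban R) (V i)) (tower_ker V f (psi_decode a)) (unat 0) (N.prj i a) =
          {(unat 0, N.prj i a)}" if "a \<in> (psi_code ` Psi :: 'u set)" for a
        using U.germ_ind_const[of "tower_ker V f (psi_decode a)" "V i" "N.prj i a"]
          N.T_banach[OF N.decode_Psi[OF that]] V[OF i] N.prj_Mor[OF that i] by (simp add: W)
      then show ?thesis
        unfolding tower_proj_def N.tower_cone_def U.to_const_def N.L_simps
        by (intro restrict_ext) (simp add: N.prj_def W)
    qed
    then show ?thesis
      using N.is_limit_tower_cone is_limit_cong[of ?D "tower_proj R V f" N.tower_cone]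
      by (simp add: W)
  qed
  have "is_isomorphism (Ind (Ban R)) (tower_colim V f) L
      (limit_lift (Ind (Ban R)) ?D L \<pi> (tower_colim V f) (tower_proj R V f))"
    if "ban_prod {1..} V \<in> Ob (Ban R)" "is_limit (Ind (Ban R)) ?D L \<pi>"
    for L :: "('u, ('r, 'u) normed_module, 'u \<Rightarrow> 'u) ind_ob" and \<pi>
    by (rule limit_lift_isomorphism[OF U.is_category_Ind U.ind_const_diagram_typed[OF U.tower_typed]
      that(2) colim[OF that(1)]])
  then show ?thesis
    using ex met colim frechet_metrizable[OF assms(1)] by (auto simp: is_limit_def)
qed

end
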